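(* Suppose $\Omega\subset\mathbb{R}^N$, $N\ge1$, is a domain with the segment property, $p,q>1$, $\alpha\in(0,1)$, and $a\in C^{0,\alpha}(\Omega)$ is nonnegative, where $$\frac qp\le 1+\frac{\alpha}{N}.$$ Let $H(x,s)=|s|^p+a(x)|s|^q$, and let $F:\Omega\times\mathbb{R}\times\mathbb{R}^N\to\mathbb{R}$ be a Carathéodory function such that, for some constants $0<\nu\le L$, $\nu H(x,z)\le F(x,v,z)\le LH(x,z)$ for all $x\in\Omega$, $v\in\mathbb{R}$, $z\in\mathbb{R}^N$. Then for every $u\in W^{1,p}_0(\Omega)\cap W^{1,F}(\Omega)$ compactly supported in $\Omega$ there exists a sequence $\{u_k\}_k\subset C_0^\infty(\Omega)$ such that, as $k\to\infty$, $u_k\to u$ in $W^{1,p}(\Omega)$ and $Du_k\to Du$ modularly in $W^{1,H}(\Omega)$, i.e. there is $\lambda>0$ with $$\int_\Omega H\Big(x,\frac{|Du_k-Du|}{\lambda}\Big)dx\to0,$$ which entails $F(\cdot,u_k,Du_k)\to F(\cdot,u,Du)$ in $L^1(\Omega)$.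
   Context: Segment property of $\Omega$: there exist a finite open covering $\{\theta_i\}_{i=1}^k$ of $\overline\Omega$ and corresponding nonzero vectors $z_i\in\mathbb{R}^N$ such that $(\overline\Omega\cap\theta_i)+tz_i\subset\Omega$ for all $t\in(0,1)$ and $i=1,\dots,k$. $C^{0,\alpha}(\Omega)$ denotes functions Hölder continuous with exponent $\alpha$. For $z\in\mathbb{R}^N$, $H(x,z)=|z|^p+a(x)|z|^q$. $W^{1,H}(\Omega)=\{u\in W^{1,1}_0(\Omega):H(\cdot,Du)\in L^1(\Omega)\}$ and $W^{1,F}(\Omega)=\{u\in W^{1,1}_0(\Omega):F(\cdot,u,Du)\in L^1(\Omega)\}$, where $W^{1,1}_0(\Omega)$ is the closure of $C_0^\infty(\Omega)$ in $W^{1,1}(\Omega)$. $C_0^\infty(\Omega)$ is the set of smooth functions compactly supported in $\Omega$. *)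

theory Defs
  imports "HOL-Analysis.Analysis"
begin

text \<open>
  The ambient space \<open>\<real>\<^sup>N\<close> is an arbitrary type of class \<open>euclidean_space\<close>, with \<open>N = DIM('a)\<close>;
  \<open>DIM('a) \<ge> 1\<close> holds for every such type.  Functions on \<open>\<Omega>\<close> are total functions whose values
  outside \<open>\<Omega>\<close> are irrelevant: all integrals and a.e. statements are over \<open>lebesgue_on \<Omega>\<close>.
  Elements of Lebesgue and Sobolev spaces are functions, not equivalence classes.
\<close>

definition segment_property :: "'a::euclidean_space set \<Rightarrow> bool" where
  "segment_property \<Omega> \<longleftrightarrow>
     (\<exists>(k::nat) (\<theta> :: nat \<Rightarrow> 'a set) (z :: nat \<Rightarrow> 'a).
        (\<forall>i\<in>{1..k}. open (\<theta> i) \<and> z i \<noteq> 0) \<and>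
        closure \<Omega> \<subseteq> (\<Union>i\<in>{1..k}. \<theta> i) \<and>
        (\<forall>i\<in>{1..k}. \<forall>t\<in>{0<..<1::real}. (\<lambda>x. x + t *\<^sub>R z i) ` (closure \<Omega> \<inter> \<theta> i) \<subseteq> \<Omega>))"

definition hoelder_continuous_on :: "real \<Rightarrow> 'a::metric_space set \<Rightarrow> ('a \<Rightarrow> real) \<Rightarrow> bool" where
  "hoelder_continuous_on \<alpha> \<Omega> a \<longleftrightarrow>
     (\<exists>C\<ge>0. \<forall>x\<in>\<Omega>. \<forall>y\<in>\<Omega>. \<bar>a x - a y\<bar> \<le> C * dist x y powr \<alpha>)"

primrec Ck :: "nat \<Rightarrow> ('a::euclidean_space \<Rightarrow> real) \<Rightarrow> bool" where
  "Ck 0 f \<longleftrightarrow> continuous_on UNIV f"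
| "Ck (Suc n) f \<longleftrightarrow>
     (\<forall>x. f differentiable (at x)) \<and>
     (\<forall>b\<in>Basis. Ck n (\<lambda>x. frechet_derivative f (at x) b))"

text \<open>A function in \<open>C\<^sub>0\<^sup>\<infinity>(\<Omega>)\<close> is identified with its extension by zero to the whole space.\<close>

definition C0_infinity :: "'a::euclidean_space set \<Rightarrow> ('a \<Rightarrow> real) set" where
  "C0_infinity \<Omega> =
     {\<phi>. (\<forall>n. Ck n \<phi>) \<and> compact (closure {x. \<phi> x \<noteq> 0}) \<and> closure {x. \<phi> x \<noteq> 0} \<subseteq> \<Omega>}"

definition locally_integrable ::
  "'a::euclidean_space set \<Rightarrow> ('a \<Rightarrow> 'b::euclidean_space) \<Rightarrow> bool" where
  "locally_integrable \<Omega> f \<longleftrightarrow> (\<forall>K. compact K \<and> K \<subseteq> \<Omega> \<longrightarrow> set_integrable lebesgue K f)"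

definition has_weak_gradient ::
  "'a::euclidean_space set \<Rightarrow> ('a \<Rightarrow> real) \<Rightarrow> ('a \<Rightarrow> 'a) \<Rightarrow> bool" where
  "has_weak_gradient \<Omega> u g \<longleftrightarrow>
     locally_integrable \<Omega> u \<and> locally_integrable \<Omega> g \<and>
     (\<forall>\<phi>\<in>C0_infinity \<Omega>. \<forall>b\<in>Basis.
        (\<integral>x. u x * frechet_derivative \<phi> (at x) b \<partial>lebesgue_on \<Omega>) =
        - (\<integral>x. (g x \<bullet> b) * \<phi> x \<partial>lebesgue_on \<Omega>))"

definition weakly_differentiable :: "'a::euclidean_space set \<Rightarrow> ('a \<Rightarrow> real) \<Rightarrow> bool" where
  "weakly_differentiable \<Omega> u \<longleftrightarrow> (\<exists>g. has_weak_gradient \<Omega> u g)"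

text \<open>\<open>Du\<close>: the weak gradient is determined up to null sets only, so a representative is chosen.\<close>

definition weak_gradient :: "'a::euclidean_space set \<Rightarrow> ('a \<Rightarrow> real) \<Rightarrow> 'a \<Rightarrow> 'a" where
  "weak_gradient \<Omega> u = (SOME g. has_weak_gradient \<Omega> u g)"

definition Lp_space ::
  "'a::euclidean_space set \<Rightarrow> real \<Rightarrow> ('a \<Rightarrow> 'b::euclidean_space) set" where
  "Lp_space \<Omega> p =
     {f. f \<in> borel_measurable (lebesgue_on \<Omega>) \<and>
         integrable (lebesgue_on \<Omega>) (\<lambda>x. norm (f x) powr p)}"

definition Lp_norm ::
  "'a::euclidean_space set \<Rightarrow> real \<Rightarrow> ('a \<Rightarrow> 'b::euclidean_space) \<Rightarrow> real" where
  "Lp_norm \<Omega> p f = (\<integral>x. norm (f x) powr p \<partial>lebesgue_on \<Omega>) powr (1 / p)"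

definition converges_Lp ::
  "'a::euclidean_space set \<Rightarrow> real \<Rightarrow> (nat \<Rightarrow> 'a \<Rightarrow> 'b::euclidean_space) \<Rightarrow> ('a \<Rightarrow> 'b) \<Rightarrow> bool" where
  "converges_Lp \<Omega> p f g \<longleftrightarrow>
     (\<forall>k. f k \<in> Lp_space \<Omega> p) \<and> g \<in> Lp_space \<Omega> p \<and>
     (\<lambda>k. Lp_norm \<Omega> p (\<lambda>x. f k x - g x)) \<longlonglongrightarrow> 0"

definition W1p :: "'a::euclidean_space set \<Rightarrow> real \<Rightarrow> ('a \<Rightarrow> real) set" where
  "W1p \<Omega> p =
     {u. weakly_differentiable \<Omega> u \<and> u \<in> Lp_space \<Omega> p \<and> weak_gradient \<Omega> u \<in> Lp_space \<Omega> p}"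

definition W1p_norm :: "'a::euclidean_space set \<Rightarrow> real \<Rightarrow> ('a \<Rightarrow> real) \<Rightarrow> real" where
  "W1p_norm \<Omega> p u = Lp_norm \<Omega> p u + Lp_norm \<Omega> p (weak_gradient \<Omega> u)"

definition W1p_0 :: "'a::euclidean_space set \<Rightarrow> real \<Rightarrow> ('a \<Rightarrow> real) set" where
  "W1p_0 \<Omega> p =
     {u \<in> W1p \<Omega> p. \<forall>e>0. \<exists>\<phi>\<in>C0_infinity \<Omega>. W1p_norm \<Omega> p (\<lambda>x. u x - \<phi> x) < e}"

definition converges_W1p ::
  "'a::euclidean_space set \<Rightarrow> real \<Rightarrow> (nat \<Rightarrow> 'a \<Rightarrow> real) \<Rightarrow> ('a \<Rightarrow> real) \<Rightarrow> bool" where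
  "converges_W1p \<Omega> p f u \<longleftrightarrow>
     (\<forall>k. f k \<in> W1p \<Omega> p) \<and> u \<in> W1p \<Omega> p \<and>
     (\<lambda>k. W1p_norm \<Omega> p (\<lambda>x. f k x - u x)) \<longlonglongrightarrow> 0"

text \<open>Polymorphic in \<open>s\<close>, since \<open>H\<close> is applied both to vectors and to nonnegative reals.\<close>

definition double_phase ::
  "real \<Rightarrow> real \<Rightarrow> ('a \<Rightarrow> real) \<Rightarrow> 'a \<Rightarrow> 'b::real_normed_vector \<Rightarrow> real" where
  "double_phase p q a x s = norm s powr p + a x * norm s powr q"

definition W1H ::
  "'a::euclidean_space set \<Rightarrow> ('a \<Rightarrow> 'a \<Rightarrow> real) \<Rightarrow> ('a \<Rightarrow> real) set" where
  "W1H \<Omega> H = {u \<in> W1p_0 \<Omega> 1. integrable (lebesgue_on \<Omega>) (\<lambda>x. H x (weak_gradient \<Omega> u x))}"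

definition W1F ::
  "'a::euclidean_space set \<Rightarrow> ('a \<Rightarrow> real \<Rightarrow> 'a \<Rightarrow> real) \<Rightarrow> ('a \<Rightarrow> real) set" where
  "W1F \<Omega> F =
     {u \<in> W1p_0 \<Omega> 1. integrable (lebesgue_on \<Omega>) (\<lambda>x. F x (u x) (weak_gradient \<Omega> u x))}"

definition caratheodory ::
  "'a::euclidean_space set \<Rightarrow> ('a \<Rightarrow> real \<Rightarrow> 'a \<Rightarrow> real) \<Rightarrow> bool" where
  "caratheodory \<Omega> F \<longleftrightarrow>
     (\<forall>v z. (\<lambda>x. F x v z) \<in> borel_measurable (lebesgue_on \<Omega>)) \<and>
     (AE x in lebesgue_on \<Omega>. continuous_on UNIV (\<lambda>(v, z). F x v z))"

text \<open>Compact support in the a.e. sense, as \<open>u\<close> represents an equivalence class.\<close>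

definition compactly_supported_in :: "'a::euclidean_space set \<Rightarrow> ('a \<Rightarrow> real) \<Rightarrow> bool" where
  "compactly_supported_in \<Omega> u \<longleftrightarrow>
     (\<exists>K. compact K \<and> K \<subseteq> \<Omega> \<and> (AE x in lebesgue_on \<Omega>. x \<notin> K \<longrightarrow> u x = 0))"

text \<open>
  Modular convergence of the gradients in \<open>W\<^sup>1\<^sup>,\<^sup>H(\<Omega>)\<close>.  The integral is taken in the extended
  nonnegative reals, so a non-integrable integrand counts as infinite and not as zero.
\<close>

definition converges_modularly_W1H ::
  "'a::euclidean_space set \<Rightarrow> real \<Rightarrow> real \<Rightarrow> ('a \<Rightarrow> real) \<Rightarrow>
     (nat \<Rightarrow> 'a \<Rightarrow> real) \<Rightarrow> ('a \<Rightarrow> real) \<Rightarrow> bool" where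
  "converges_modularly_W1H \<Omega> p q a f u \<longleftrightarrow>
     (\<forall>k. f k \<in> W1H \<Omega> (double_phase p q a)) \<and> u \<in> W1H \<Omega> (double_phase p q a) \<and>
     (\<exists>c>0.
        (\<lambda>k. \<integral>\<^sup>+ x. ennreal (double_phase p q a x
                  (norm (weak_gradient \<Omega> (f k) x - weak_gradient \<Omega> u x) / c)) \<partial>lebesgue_on \<Omega>)
        \<longlonglongrightarrow> 0)"

end

theory Submission
  imports Defs
begin

text \<open>
  The approximants are mollifications \<open>u * \<rho>\<^sub>\<epsilon>\<close>. By Jensen, \<open>|Du * \<rho>\<^sub>\<epsilon>|\<^sup>p \<le> |Du|\<^sup>p * \<rho>\<^sub>\<epsilon>\<close>. Hoelder
  continuity gives \<open>a x \<le> a y + c \<epsilon> powr \<alpha>\<close> on the support of the kernel, while the \<open>L\<^sup>p\<close> bound on \<open>Du\<close> gives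
  \<open>|Du * \<rho>\<^sub>\<epsilon>| \<le> C \<epsilon> powr (- N / p)\<close>; the gap condition makes \<open>\<epsilon> powr \<alpha> |Du * \<rho>\<^sub>\<epsilon>| powr (q - p)\<close> bounded, so
  \<open>H(x, Du * \<rho>\<^sub>\<epsilon>)\<close> is dominated by \<open>Z * \<rho>\<^sub>\<epsilon>\<close> plus a fixed integrable function, for a single \<open>Z \<in> L\<^sup>1\<close>.
  Since \<open>Z * \<rho>\<^sub>\<epsilon> \<rightarrow> Z\<close> in \<open>L\<^sup>1\<close>, all the asserted convergences follow from dominated convergence with
  varying majorants along a subsequence converging almost everywhere.
\<close>

subsection \<open>Functions of class \<open>C\<^sup>k\<close>\<close>

text \<open>Jensen alone handles \<open>|Du|^p\<close>. For the weighted phase it fails: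
  \<open>a\<close> may be positive at \<open>x\<close> yet vanish at points of the kernel's support
  where \<open>Du\<close> is large, and there \<open>a x * |Du|^q\<close> is not controlled by the
  energy. Lowering \<open>a x\<close> to a bound valid on the whole support costs
  \<open>c * \<epsilon> powr \<alpha>\<close> times the \<open>q\<close>-th power, and only this
  cost has to be paid by the gap condition. Compact support of \<open>u\<close> keeps the
  mollifications inside \<Omega>, so they are test functions themselves. The majorants
  \<open>mollify (\<rho> n) Z\<close> move with \<open>n\<close> and are known to converge in
  \<open>L^1\<close> only, so a fixed dominating function is not at hand. A second obstacle is that
  Sobolev functions are known up to null sets, \<open>weak_gradient\<close> is an arbitrary choice,
  and values off \<Omega> are arbitrary. All computations are therefore made with Borel
  representatives on the whole space that vanish off a compact set; uniqueness of weak gradients,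
  which itself rests on mollification, carries the results back.\<close>

abbreviation partial_deriv :: "('a::euclidean_space \<Rightarrow> real) \<Rightarrow> 'a \<Rightarrow> 'a \<Rightarrow> real" where
  "partial_deriv f b \<equiv> (\<lambda>x. frechet_derivative f (at x) b)"

lemma Ck_SucI:
  assumes "\<And>x. (f has_derivative f' x) (at x)"
    and "\<And>b. b \<in> Basis \<Longrightarrow> Ck n (\<lambda>x. f' x b)"
  shows "Ck (Suc n) f"
proof -
  have "frechet_derivative f (at x) = f' x" for x
    using frechet_derivative_at[OF assms(1)] by simp
  then show ?thesis
    using assms by (auto simp: differentiable_def)
qed

lemma Ck_Suc_has_derivative:
  assumes "Ck (Suc n) f"
  shows "(f has_derivative frechet_derivative f (at x)) (at x)"
  using assms by (simp add: frechet_derivative_works)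

text \<open>The recursion records differentiability at each level and continuity at the last one
  only, so lower regularity has to be recovered: differentiability gives continuity at the base, and
  above it the induction hypothesis is applied to the partial derivatives.\<close>

lemma Ck_SucD: "Ck (Suc n) f \<Longrightarrow> Ck n f"
proof (induction n arbitrary: f)
  case 0
  then show ?case
    by (auto intro!: continuous_at_imp_continuous_on differentiable_imp_continuous_within)
next
  case (Suc n)
  then show ?case by (simp del: Ck.simps(1))
qed

lemma Ck_continuous: "Ck n f \<Longrightarrow> continuous_on UNIV f"
proof (induction n)
  case (Suc n)
  then show ?case using Ck_SucD by blast
qed simp

lemma Ck_partial_deriv: "\<forall>n. Ck n f \<Longrightarrow> b \<in> Basis \<Longrightarrow> Ck n (partial_deriv f b)"
  using Ck.simps(2) by blast

lemma Ck_const: "Ck n (\<lambda>x. c)"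
proof (induction n arbitrary: c)
  case (Suc n)
  have "((\<lambda>x. c) has_derivative (\<lambda>h. 0)) (at x)" for x :: 'a
    by (rule has_derivative_const)
  then show ?case by (rule Ck_SucI) (rule Suc.IH)
qed auto

lemma Ck_add: "Ck n f \<Longrightarrow> Ck n g \<Longrightarrow> Ck n (\<lambda>x. f x + g x)"
proof (induction n arbitrary: f g)
  case (Suc n)
  show ?case
  proof (rule Ck_SucI)
    show "((\<lambda>x. f x + g x) has_derivative
        (\<lambda>h. frechet_derivative f (at x) h + frechet_derivative g (at x) h)) (at x)" for x
      by (intro has_derivative_add Ck_Suc_has_derivative[OF Suc.prems(1)]
          Ck_Suc_has_derivative[OF Suc.prems(2)])
  qed (use Suc in simp)
qed (auto intro: continuous_on_add)

lemma Ck_mult: "Ck n f \<Longrightarrow> Ck n g \<Longrightarrow> Ck n (\<lambda>x. f x * g x)"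
proof (induction n arbitrary: f g)
  case (Suc n)
  show ?case
  proof (rule Ck_SucI)
    show "((\<lambda>x. f x * g x) has_derivative
        (\<lambda>h. f x * frechet_derivative g (at x) h + frechet_derivative f (at x) h * g x)) (at x)" for x
      by (intro has_derivative_mult Ck_Suc_has_derivative[OF Suc.prems(1)]
          Ck_Suc_has_derivative[OF Suc.prems(2)])
    show "Ck n (\<lambda>x. f x * frechet_derivative g (at x) b + frechet_derivative f (at x) b * g x)"
      if "b \<in> Basis" for b
      using Suc.prems that Ck_SucD[OF Suc.prems(1)] Ck_SucD[OF Suc.prems(2)]
      by (intro Ck_add Suc.IH) auto
  qed
qed (auto intro: continuous_on_mult)

lemma Ck_cmult: "Ck n f \<Longrightarrow> Ck n (\<lambda>x. c * f x)"
  by (intro Ck_mult Ck_const)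

lemma Ck_prod:
  assumes "finite I" "\<And>i. i \<in> I \<Longrightarrow> Ck n (f i)"
  shows "Ck n (\<lambda>x. \<Prod>i\<in>I. f i x)"
  using assms by (induction I rule: finite_induct) (auto intro: Ck_const Ck_mult)

lemma Ck_reflect: "Ck n f \<Longrightarrow> Ck n (\<lambda>y. f (x - y))"
proof (induction n arbitrary: f)
  case 0
  then show ?case
    by (auto intro!: continuous_on_compose2[of UNIV f] continuous_intros)
next
  case (Suc n)
  have d: "((\<lambda>y. f (x - y)) has_derivative (\<lambda>h. - 1 * frechet_derivative f (at (x - y)) h)) (at y)" for y
  proof -
    have "linear (frechet_derivative f (at (x - y)))"
      using Ck_Suc_has_derivative[OF Suc.prems] has_derivative_linear by blast
    note linear_neg[OF this]
    moreover
    have "((\<lambda>y. f (x - y)) has_derivative (\<lambda>h. frechet_derivative f (at (x - y)) (- h))) (at y)"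
      by (rule has_derivative_compose[of "\<lambda>y. x - y", OF _ Ck_Suc_has_derivative[OF Suc.prems]])
         (auto intro!: derivative_eq_intros)
    ultimately show ?thesis by simp
  qed
  show ?case
    by (rule Ck_SucI[OF d], rule Ck_cmult, rule Suc.IH) (use Suc.prems in auto)
qed

lemma partial_deriv_reflect:
  assumes "Ck (Suc n) f"
  shows "partial_deriv (\<lambda>y. f (x - y)) b y = - partial_deriv f b (x - y)"
proof -
  have lin: "linear (frechet_derivative f (at (x - y)))"
    using Ck_Suc_has_derivative[OF assms] has_derivative_linear by blast
  have "((\<lambda>y. f (x - y)) has_derivative (\<lambda>h. frechet_derivative f (at (x - y)) (- h))) (at y)"
    by (rule has_derivative_compose[of "\<lambda>y. x - y", OF _ Ck_Suc_has_derivative[OF assms]])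
       (auto intro!: derivative_eq_intros)
  from frechet_derivative_at[OF this] show ?thesis by (metis linear_neg[OF lin])
qed

lemma partial_deriv_eq_0:
  assumes "closed S" "\<And>y. y \<notin> S \<Longrightarrow> f y = 0" "x \<notin> S"
  shows "partial_deriv f b x = 0"
proof -
  have "(f has_derivative (\<lambda>h. 0)) (at x)"
    by (rule has_derivative_transform_within_open[of "\<lambda>_. 0" _ _ _ "- S"]) (use assms in auto)
  from frechet_derivative_at[OF this] show ?thesis by metis
qed

subsection \<open>Smooth bumps and mollifiers\<close>

text \<open>For \<open>k = 0\<close> this is the classical smooth function that is flat at 0. The
  factor \<open>(1 / t) ^ k\<close> makes the family closed under differentiation up to linear
  combinations, so that smoothness follows by one induction running over all
  \<open>k\<close>.\<close>

definition flat_exp :: "nat \<Rightarrow> real \<Rightarrow> real" where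
  "flat_exp k t = (if t > 0 then (1 / t) ^ k * exp (- (1 / t)) else 0)"

lemma flat_exp_bound_tendsto: "((\<lambda>t::real. (1 / t) ^ k * exp (- (1 / t))) \<longlongrightarrow> 0) (at_right 0)"
proof -
  have "((\<lambda>t::real. (inverse t) ^ k / exp (inverse t)) \<longlongrightarrow> 0) (at_right 0)"
    by (rule filterlim_compose[OF tendsto_power_div_exp_0 filterlim_inverse_at_top_right])
  then show ?thesis
    by (simp add: exp_minus field_simps)
qed

lemma flat_exp_tendsto: "(flat_exp k \<longlongrightarrow> 0) (at 0)"
proof (rule filterlim_split_at_real)
  have "\<forall>\<^sub>F t in at_right 0. (1 / t) ^ k * exp (- (1 / t)) = flat_exp k (t::real)"
    by (auto simp: eventually_at_filter flat_exp_def)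
  then show "(flat_exp k \<longlongrightarrow> 0) (at_right 0)"
    using flat_exp_bound_tendsto by (rule Lim_transform_eventually[rotated])
  have "\<forall>\<^sub>F t in at_left 0. 0 = flat_exp k (t::real)"
    by (auto simp: eventually_at_filter flat_exp_def)
  then show "(flat_exp k \<longlongrightarrow> 0) (at_left 0)"
    by (rule Lim_transform_eventually[rotated]) simp
qed

lemma DERIV_flat_exp:
  "(flat_exp k has_real_derivative flat_exp (k + 2) t - k * flat_exp (Suc k) t) (at t)"
proof -
  consider "t > 0" | "t < 0" | "t = 0" by linarith
  then show ?thesis
  proof cases
    case 1
    have pw: "n = 0" if "t ^ n \<noteq> t * t ^ (n - Suc 0)" for n
      using that by (cases n) auto
    have "((\<lambda>t. (1 / t) ^ k * exp (- (1 / t))) has_real_derivative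
        flat_exp (k + 2) t - k * flat_exp (Suc k) t) (at t)"
      using 1 pw by (cases k) (auto intro!: derivative_eq_intros simp: flat_exp_def field_simps power2_eq_square)
    then show ?thesis
      by (rule has_field_derivative_transform_within_open[of _ _ _ "{0<..}"])
         (use 1 in \<open>auto simp: flat_exp_def\<close>)
  next
    case 2
    have "((\<lambda>t. 0) has_real_derivative flat_exp (k + 2) t - k * flat_exp (Suc k) t) (at t)"
      using 2 by (auto simp: flat_exp_def)
    then show ?thesis
      by (rule has_field_derivative_transform_within_open[of _ _ _ "{..<0}"])
         (use 2 in \<open>auto simp: flat_exp_def\<close>)
  next
    case 3
    have "(flat_exp (Suc k) \<longlongrightarrow> 0) (at 0)" by (rule flat_exp_tendsto)
    \<comment> \<open>The difference quotient of \<open>flat_exp k\<close> at 0 is exactly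
      \<open>flat_exp (Suc k)\<close>, so the derivative there is the limit just obtained.\<close>
    then have "((\<lambda>h. (flat_exp k (0 + h) - flat_exp k 0) / h) \<longlongrightarrow> 0) (at 0)"
      by (rule Lim_transform_eventually) (auto simp: flat_exp_def eventually_at_filter)
    then show ?thesis
      using 3 by (simp add: DERIV_def flat_exp_def)
  qed
qed

lemma Ck_flat_exp_ridge: "Ck n (\<lambda>x. flat_exp k (x \<bullet> v + c))"
proof (induction n arbitrary: k)
  case 0
  have "continuous_on UNIV (flat_exp k)"
    using DERIV_isCont[OF DERIV_flat_exp] by (simp add: continuous_on_eq_continuous_at)
  then show ?case
    by (auto intro!: continuous_on_compose2[of UNIV "flat_exp k"] continuous_intros)
next
  case (Suc n)
  let ?D = "\<lambda>t. flat_exp (k + 2) t + (- real k) * flat_exp (Suc k) t"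
  show ?case
  proof (rule Ck_SucI)
    show "((\<lambda>x. flat_exp k (x \<bullet> v + c)) has_derivative (\<lambda>h. (h \<bullet> v) * ?D (x \<bullet> v + c))) (at x)" for x
    proof -
      have "((\<lambda>x. x \<bullet> v + c) has_derivative (\<lambda>h. h \<bullet> v)) (at x)"
        by (auto intro!: derivative_eq_intros)
      moreover have "(flat_exp k has_derivative (\<lambda>h. h * ?D (x \<bullet> v + c))) (at (x \<bullet> v + c))"
        using DERIV_flat_exp[of k "x \<bullet> v + c"]
        by (simp add: has_field_derivative_def mult_commute_abs)
      ultimately show ?thesis by (rule has_derivative_compose)
    qed
  qed (intro Ck_cmult Ck_add Suc.IH)
qed

text \<open>Neither sign nor mass is prescribed, so that test functions and the partial derivatives
  of a mollifier are covered as well.\<close>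

definition cutoff_kernel :: "real \<Rightarrow> ('a::euclidean_space \<Rightarrow> real) \<Rightarrow> bool" where
  "cutoff_kernel R k \<longleftrightarrow> continuous_on UNIV k \<and> (\<forall>x. R < norm x \<longrightarrow> k x = 0)"

lemma cutoff_kernel_measurable: "cutoff_kernel R k \<Longrightarrow> k \<in> borel_measurable borel"
  by (simp add: cutoff_kernel_def borel_measurable_continuous_onI)

lemma cutoff_kernel_integrable:
  assumes "cutoff_kernel R (k :: 'a::euclidean_space \<Rightarrow> real)"
  shows "integrable lborel k"
proof -
  have "integrable lborel (\<lambda>x. indicator (cball (0::'a) R) x *\<^sub>R k x)"
    using assms by (intro borel_integrable_compact) (auto simp: cutoff_kernel_def intro: continuous_on_subset)
  moreover have "(\<lambda>x. indicator (cball (0::'a) R) x *\<^sub>R k x) = k"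
    using assms by (auto simp: cutoff_kernel_def indicator_def fun_eq_iff)
  ultimately show ?thesis by simp
qed

lemma cutoff_kernel_bounded:
  assumes "cutoff_kernel R (k :: 'a::euclidean_space \<Rightarrow> real)"
  obtains B where "B \<ge> 0" "\<And>x. \<bar>k x\<bar> \<le> B"
proof -
  have "compact (k ` cball 0 R)"
    using assms by (intro compact_continuous_image)
      (auto simp: cutoff_kernel_def intro: continuous_on_subset)
  then obtain B where B: "\<And>x. norm x \<le> R \<Longrightarrow> \<bar>k x\<bar> \<le> B"
    using compact_imp_bounded bounded_real by (metis imageI mem_cball_0)
  have "\<bar>k x\<bar> \<le> max B 0" for x
    using B[of x] assms by (cases "norm x \<le> R") (auto simp: cutoff_kernel_def)
  then show ?thesis by (intro that[of "max B 0"]) auto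
qed

lemma cutoff_kernel_uniformly_continuous:
  assumes "cutoff_kernel R (k :: 'a::euclidean_space \<Rightarrow> real)" "e > 0"
  obtains d where "d > 0" "\<And>x y. norm (x - y) < d \<Longrightarrow> \<bar>k x - k y\<bar> < e"
proof -
  \<comment> \<open>Two points less than 1 apart either both lie in the ball of radius
    \<open>R + 1\<close> or both lie beyond \<open>R\<close>, where \<open>k\<close> vanishes. This
    is why the modulus is capped by 1 below.\<close>
  have "uniformly_continuous_on (cball 0 (R + 1)) k"
    using assms(1) by (intro compact_uniformly_continuous)
      (auto simp: cutoff_kernel_def intro: continuous_on_subset)
  then obtain d where d: "d > 0"
      "\<And>x y. x \<in> cball 0 (R + 1) \<Longrightarrow> y \<in> cball 0 (R + 1) \<Longrightarrow> dist y x < d \<Longrightarrow> dist (k y) (k x) < e"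
    using \<open>e > 0\<close> unfolding uniformly_continuous_on_def by metis
  show ?thesis
  proof
    show "min d 1 > 0" using d by simp
    fix x y :: 'a assume xy: "norm (x - y) < min d (1::real)"
    show "\<bar>k x - k y\<bar> < e"
    proof (cases "norm x \<le> R \<or> norm y \<le> R")
      case True
      then have "norm x \<le> R + 1" "norm y \<le> R + 1"
        using xy norm_triangle_ineq2[of x y] norm_triangle_ineq2[of y x] by (auto simp: norm_minus_commute)
      then show ?thesis
        using d(2)[of y x] xy by (auto simp: dist_norm)
    next
      case False
      then show ?thesis using assms by (auto simp: cutoff_kernel_def)
    qed
  qed
qed

lemma cutoff_kernel_partial_deriv:
  assumes "\<forall>n. Ck n k" "cutoff_kernel R k" "b \<in> Basis"
  shows "cutoff_kernel R (partial_deriv k b)"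
  using assms Ck_continuous[OF Ck_partial_deriv[OF assms(1,3), of 0]]
    partial_deriv_eq_0[of "cball 0 R" k _ b]
  by (auto simp: cutoff_kernel_def)

lemma lborel_translate:
  fixes f :: "'a::euclidean_space \<Rightarrow> 'b::{banach, second_countable_topology}"
  assumes [measurable]: "f \<in> borel_measurable borel"
  shows integrable_lborel_translate: "integrable lborel (\<lambda>x. f (x + c)) \<longleftrightarrow> integrable lborel f"
    and integral_lborel_translate: "(\<integral>x. f (x + c) \<partial>lborel) = (\<integral>x. f x \<partial>lborel)"
proof -
  have "integrable lborel f \<longleftrightarrow> integrable (distr lborel borel ((+) c)) f"
    by (simp add: lborel_distr_plus)
  also have "\<dots> \<longleftrightarrow> integrable lborel (\<lambda>x. f (x + c))"
    by (subst integrable_distr_eq) (auto simp: add.commute)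
  finally show "integrable lborel (\<lambda>x. f (x + c)) \<longleftrightarrow> integrable lborel f" ..
  have "(\<integral>x. f x \<partial>lborel) = (\<integral>x. f x \<partial>distr lborel borel ((+) c))"
    by (simp add: lborel_distr_plus)
  also have "\<dots> = (\<integral>x. f (x + c) \<partial>lborel)"
    by (subst integral_distr) (auto simp: add.commute)
  finally show "(\<integral>x. f (x + c) \<partial>lborel) = (\<integral>x. f x \<partial>lborel)" ..
qed

lemma integral_lborel_reflect:
  fixes f :: "'a::euclidean_space \<Rightarrow> 'b::{banach, second_countable_topology}"
  assumes [measurable]: "f \<in> borel_measurable borel"
  shows "(\<integral>y. f (x - y) \<partial>lborel) = (\<integral>x. f x \<partial>lborel)"
proof -
  have eq: "lborel = distr lborel borel (\<lambda>y. x - y)"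
    using lborel_affine[of "-1" x] by (simp add: density_1)
  have "(\<integral>x. f x \<partial>lborel) = (\<integral>y. f y \<partial>distr lborel borel (\<lambda>y. x - y))"
    by (subst eq) simp
  also have "\<dots> = (\<integral>y. f (x - y) \<partial>lborel)"
    by (subst integral_distr) auto
  finally show ?thesis ..
qed

definition mollifier :: "real \<Rightarrow> ('a::euclidean_space \<Rightarrow> real) \<Rightarrow> bool" where
  "mollifier \<epsilon> \<rho> \<longleftrightarrow> cutoff_kernel \<epsilon> \<rho> \<and> (\<forall>n. Ck n \<rho>) \<and> (\<forall>x. 0 \<le> \<rho> x) \<and> (\<integral>x. \<rho> x \<partial>lborel) = 1"

lemma mollifierD:
  assumes "mollifier \<epsilon> \<rho>"
  shows "cutoff_kernel \<epsilon> \<rho>" "Ck n \<rho>" "0 \<le> \<rho> x" "(\<integral>x. \<rho> x \<partial>lborel) = 1"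
    "\<rho> x \<noteq> 0 \<Longrightarrow> norm x \<le> \<epsilon>" "\<rho> \<in> borel_measurable borel"
  using assms cutoff_kernel_measurable[of \<epsilon> \<rho>]
  by (auto simp: mollifier_def cutoff_kernel_def not_less[symmetric])

lemma flat_exp_0_bounds: "0 \<le> flat_exp 0 t" "flat_exp 0 t \<le> 1"
  by (auto simp: flat_exp_def)

lemma flat_exp_0_lower: "1 / 2 \<le> t \<Longrightarrow> exp (- 2) \<le> flat_exp 0 t"
  by (auto simp: flat_exp_def field_simps)

text \<open>\<open>C\<close> is fixed before \<epsilon>: this scaling bound later turns the integral
  of \<open>|Du|^p\<close> into a pointwise bound of order \<open>\<epsilon>^(-N)\<close>. The
  kernel is a normalised product of one-dimensional bumps, and the bound comes from estimating its
  mass from below on a smaller cube.\<close>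

lemma mollifier_exists:
  obtains C where "C > 0"
    "\<And>\<epsilon>. \<epsilon> > 0 \<Longrightarrow> \<exists>\<rho>::'a::euclidean_space \<Rightarrow> real. mollifier \<epsilon> \<rho> \<and> (\<forall>x. \<rho> x * \<epsilon> ^ DIM('a) \<le> C)"
proof
  let ?N = "DIM('a)"
  \<comment> \<open>The quotient of \<open>\<epsilon> ^ N\<close> by
    \<open>exp (- 4) ^ N * \<delta> ^ N\<close>, the lower bound for the mass of the unnormalised
    bump \<open>w\<close>, which is itself at most 1.\<close>
  define C where "C = exp 4 ^ ?N * real ?N ^ ?N"
  show "C > 0" by (simp add: C_def)
  fix \<epsilon> :: real assume "\<epsilon> > 0"
  \<comment> \<open>The Euclidean norm is at most the sum of the N coordinate moduli, so the cube of
    half-width \<delta> lies in the ball of radius \<epsilon>.\<close>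
  define \<delta> where "\<delta> = \<epsilon> / ?N"
  have "\<delta> > 0" using \<open>\<epsilon> > 0\<close> by (simp add: \<delta>_def)
  define w where "w x = (\<Prod>b\<in>Basis. flat_exp 0 (1 - (x \<bullet> b) / \<delta>) * flat_exp 0 (1 + (x \<bullet> b) / \<delta>))" for x :: 'a
  have Ckw: "Ck n w" for n
  proof -
    have "Ck n (\<lambda>x. flat_exp 0 (1 - (x \<bullet> b) / \<delta>))" "Ck n (\<lambda>x. flat_exp 0 (1 + (x \<bullet> b) / \<delta>))" for b :: 'a
      using Ck_flat_exp_ridge[of n 0 "(- 1 / \<delta>) *\<^sub>R b" 1] Ck_flat_exp_ridge[of n 0 "(1 / \<delta>) *\<^sub>R b" 1]
      by (simp_all add: algebra_simps)
    then show ?thesis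
      unfolding w_def[abs_def] by (intro Ck_prod Ck_mult) auto
  qed
  have w0: "0 \<le> w x" for x
    unfolding w_def by (intro prod_nonneg) (auto simp: flat_exp_0_bounds)
  have w1: "w x \<le> 1" for x
    unfolding w_def by (intro prod_le_1) (auto intro!: mult_le_one simp: flat_exp_0_bounds)
  have supp: "w x = 0" if "\<epsilon> < norm x" for x
  proof (rule ccontr)
    assume "w x \<noteq> 0"
    have "\<bar>x \<bullet> b\<bar> \<le> \<delta>" if "b \<in> Basis" for b
    proof -
      have "flat_exp 0 (1 - (x \<bullet> b) / \<delta>) \<noteq> 0" "flat_exp 0 (1 + (x \<bullet> b) / \<delta>) \<noteq> 0"
        using \<open>w x \<noteq> 0\<close> that by (auto simp: w_def)
      then have "0 < 1 - (x \<bullet> b) / \<delta>" "0 < 1 + (x \<bullet> b) / \<delta>"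
        by (auto simp: flat_exp_def split: if_splits)
      then show ?thesis using \<open>\<delta> > 0\<close> by (auto simp: field_simps abs_le_iff)
    qed
    then have "(\<Sum>b\<in>Basis. \<bar>x \<bullet> b\<bar>) \<le> ?N * \<delta>" by (intro sum_bounded_above) auto
    then have "norm x \<le> \<epsilon>" using norm_le_l1[of x] by (simp add: \<delta>_def)
    then show False using that by simp
  qed
  have ker: "cutoff_kernel \<epsilon> w"
    using Ck_continuous[OF Ckw[of 0]] supp by (auto simp: cutoff_kernel_def)
  define I where "I = (\<integral>x. w x \<partial>lborel)"
  \<comment> \<open>On this cube of side \<delta> the arguments
    \<open>1 - (x \<bullet> b) / \<delta>\<close> and \<open>1 + (x \<bullet> b) / \<delta>\<close>
    are at least 1/2, so each of the 2N factors of \<open>w\<close> is at least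
    \<open>exp (- 2)\<close>.\<close>
  let ?Q = "cbox ((- \<delta> / 2) *\<^sub>R One) ((\<delta> / 2) *\<^sub>R One) :: 'a set"
  have Ilow: "exp (- 4) ^ ?N * \<delta> ^ ?N \<le> I"
  proof -
    have "exp (- 4) ^ ?N * indicator ?Q x \<le> w x" for x
    proof (cases "x \<in> ?Q")
      case True
      have "(\<Prod>b\<in>(Basis::'a set). exp (- 4)) \<le> w x"
        unfolding w_def
      proof (intro prod_mono conjI)
        fix b :: 'a assume "b \<in> Basis"
        then have "- \<delta> / 2 \<le> x \<bullet> b" "x \<bullet> b \<le> \<delta> / 2"
          using True by (auto simp: mem_box inner_sum_left inner_Basis if_distrib cong: if_cong)
        then have "1 / 2 \<le> 1 - (x \<bullet> b) / \<delta>" "1 / 2 \<le> 1 + (x \<bullet> b) / \<delta>"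
          using \<open>\<delta> > 0\<close> by (auto simp: field_simps)
        then have "exp (- 2) * exp (- 2) \<le> flat_exp 0 (1 - (x \<bullet> b) / \<delta>) * flat_exp 0 (1 + (x \<bullet> b) / \<delta>)"
          by (intro mult_mono flat_exp_0_lower) (auto simp: flat_exp_0_bounds)
        then show "exp (- 4) \<le> flat_exp 0 (1 - (x \<bullet> b) / \<delta>) * flat_exp 0 (1 + (x \<bullet> b) / \<delta>)"
          by (simp add: exp_add[symmetric])
      qed simp
      then show ?thesis using True by simp
    qed (use w0 in simp)
    then have "(\<integral>x. exp (- 4) ^ ?N * indicator ?Q x \<partial>lborel) \<le> I"
      unfolding I_def using cutoff_kernel_integrable[OF ker]
      by (intro integral_mono) (auto intro!: integrable_mult_right integrable_real_indicator emeasure_bounded_finite)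
    moreover have "measure lborel ?Q = (\<Prod>b\<in>(Basis::'a set). \<delta>)"
      using \<open>\<delta> > 0\<close>
      by (subst measure_lborel_cbox_eq) (auto simp: inner_add_left inner_diff_left intro!: prod.cong)
    ultimately show ?thesis by simp
  qed
  have pos: "0 < exp (- 4) ^ ?N * \<delta> ^ ?N"
    using \<open>\<delta> > 0\<close> by simp
  with Ilow have "I > 0" by linarith
  show "\<exists>\<rho>::'a \<Rightarrow> real. mollifier \<epsilon> \<rho> \<and> (\<forall>x. \<rho> x * \<epsilon> ^ DIM('a) \<le> C)"
  proof (intro exI[of _ "\<lambda>x. (1 / I) * w x"] conjI allI)
    show "mollifier \<epsilon> (\<lambda>x. (1 / I) * w x)"
      unfolding mollifier_def
    proof (intro conjI allI)
      show "cutoff_kernel \<epsilon> (\<lambda>x. 1 / I * w x)"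
        using ker \<open>I > 0\<close> by (auto simp: cutoff_kernel_def intro!: continuous_intros)
      show "Ck n (\<lambda>x. 1 / I * w x)" for n by (intro Ck_cmult Ckw)
      show "0 \<le> 1 / I * w x" for x using w0 \<open>I > 0\<close> by simp
      show "(\<integral>x. 1 / I * w x \<partial>lborel) = 1" using \<open>I > 0\<close> by (simp add: I_def[symmetric])
    qed
    fix x
    have "\<epsilon> ^ ?N = real ?N ^ ?N * \<delta> ^ ?N"
      by (simp add: \<delta>_def power_divide)
    also have "\<dots> = C * (exp (- 4) ^ ?N * \<delta> ^ ?N)"
      by (simp add: C_def exp_minus power_inverse)
    also have "\<dots> \<le> C * I" using Ilow \<open>C > 0\<close> by (intro mult_left_mono) auto
    finally have *: "\<epsilon> ^ ?N \<le> C * I" .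
    have "w x * \<epsilon> ^ ?N \<le> 1 * (C * I)"
      using * w0 w1 \<open>\<epsilon> > 0\<close> by (intro mult_mono) auto
    then show "1 / I * w x * \<epsilon> ^ ?N \<le> C"
      using \<open>I > 0\<close> by (simp add: field_simps)
  qed
qed

subsection \<open>Mollification\<close>

definition mollify ::
  "('a::euclidean_space \<Rightarrow> real) \<Rightarrow> ('a \<Rightarrow> 'b::euclidean_space) \<Rightarrow> 'a \<Rightarrow> 'b" where
  "mollify k f x = (\<integral>y. k (x - y) *\<^sub>R f y \<partial>lborel)"

lemma integrable_mollify_integrand:
  fixes f :: "'a::euclidean_space \<Rightarrow> 'b::euclidean_space"
  assumes k: "cutoff_kernel R k" and f: "integrable lborel f"
  shows "integrable lborel (\<lambda>y. k (x - y) *\<^sub>R f y)"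
proof -
  obtain B where B: "B \<ge> 0" "\<And>x. \<bar>k x\<bar> \<le> B"
    using cutoff_kernel_bounded[OF k] by metis
  note [measurable] = cutoff_kernel_measurable[OF k] borel_measurable_integrable[OF f]
  show ?thesis
  proof (rule Bochner_Integration.integrable_bound)
    show "integrable lborel (\<lambda>y. B * norm (f y))" using f by simp
  qed (auto intro!: AE_I2 mult_mono B simp: abs_mult B)
qed

lemma mollify_add:
  assumes "cutoff_kernel R k" "integrable lborel f" "integrable lborel g"
  shows "mollify k (\<lambda>x. f x + g x) x = mollify k f x + mollify k g x"
  using assms unfolding mollify_def
  by (subst Bochner_Integration.integral_add[symmetric])
     (auto simp: scaleR_add_right intro: integrable_mollify_integrand)

lemma mollify_diff:
  assumes "cutoff_kernel R k" "integrable lborel f" "integrable lborel g"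
  shows "mollify k (\<lambda>x. f x - g x) x = mollify k f x - mollify k g x"
  using assms unfolding mollify_def
  by (subst Bochner_Integration.integral_diff[symmetric])
     (auto simp: scaleR_diff_right intro: integrable_mollify_integrand)

lemma mollify_mono:
  fixes f g :: "'a::euclidean_space \<Rightarrow> real"
  assumes "mollifier \<epsilon> \<rho>" "integrable lborel f" "integrable lborel g" "\<And>x. f x \<le> g x"
  shows "mollify \<rho> f x \<le> mollify \<rho> g x"
  using assms mollifierD[OF assms(1)] unfolding mollify_def
  by (intro integral_mono integrable_mollify_integrand) (auto intro!: mult_left_mono)

lemma mollify_nonneg:
  fixes f :: "'a::euclidean_space \<Rightarrow> real"
  assumes "mollifier \<epsilon> \<rho>" "\<And>x. 0 \<le> f x"
  shows "0 \<le> mollify \<rho> f x"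
  using assms mollifierD[OF assms(1)] unfolding mollify_def by simp

lemma norm_mollify_le:
  assumes "mollifier \<epsilon> \<rho>"
  shows "norm (mollify \<rho> f x) \<le> mollify \<rho> (\<lambda>x. norm (f x)) x"
  using integral_norm_bound[of lborel "\<lambda>y. \<rho> (x - y) *\<^sub>R f y"] mollifierD[OF assms]
  unfolding mollify_def by simp

lemma mollify_eq_0:
  assumes "cutoff_kernel R k" "\<And>y. dist x y \<le> R \<Longrightarrow> f y = 0"
  shows "mollify k f x = 0"
proof -
  have "(\<lambda>y. k (x - y) *\<^sub>R f y) = (\<lambda>y. 0)"
    using assms by (auto simp: cutoff_kernel_def dist_norm fun_eq_iff not_less[symmetric])
  then show ?thesis by (simp add: mollify_def)
qed

lemma continuous_on_mollify:
  fixes f :: "'a::euclidean_space \<Rightarrow> 'b::euclidean_space"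
  assumes k: "cutoff_kernel R k" and f: "integrable lborel f"
  shows "continuous_on UNIV (mollify k f)"
proof -
  have "\<exists>d>0. \<forall>x'. dist x' x < d \<longrightarrow> dist (mollify k f x') (mollify k f x) < e" if "e > 0" for e x
  proof -
    \<comment> \<open>The added 1 keeps \<open>M\<close> positive when \<open>f\<close> vanishes and
      makes the final inequality strict.\<close>
    define M where "M = (\<integral>y. norm (f y) \<partial>lborel) + 1"
    have "M > 0" by (auto simp: M_def intro!: add_nonneg_pos)
    obtain d where d: "d > 0" "\<And>x y. norm (x - y) < d \<Longrightarrow> \<bar>k x - k y\<bar> < e / M"
      using cutoff_kernel_uniformly_continuous[OF k, of "e / M"] \<open>e > 0\<close> \<open>M > 0\<close> by auto
    show ?thesis
    proof (intro exI[of _ d] conjI allI impI d)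
      fix x' assume "dist x' x < d"
      have "mollify k f x' - mollify k f x = (\<integral>y. (k (x' - y) - k (x - y)) *\<^sub>R f y \<partial>lborel)"
        unfolding mollify_def
        by (subst Bochner_Integration.integral_diff[symmetric])
           (auto intro!: integrable_mollify_integrand[OF k f] simp: scaleR_diff_left)
      also have "norm \<dots> \<le> (\<integral>y. e / M * norm (f y) \<partial>lborel)"
      proof (rule Bochner_Integration.integral_norm_bound_integral)
        show "integrable lborel (\<lambda>y. (k (x' - y) - k (x - y)) *\<^sub>R f y)"
          by (simp add: scaleR_diff_left integrable_mollify_integrand[OF k f])
        show "norm ((k (x' - y) - k (x - y)) *\<^sub>R f y) \<le> e / M * norm (f y)" for y
          using d(2)[of "x' - y" "x - y"] \<open>dist x' x < d\<close>
          using mult_right_mono[of "\<bar>k (x' - y) - k (x - y)\<bar>" "e / M" "norm (f y)"]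
          by (auto simp: dist_norm)
      qed (use f in simp)
      also have "\<dots> = e / M * (M - 1)" by (simp add: M_def)
      also have "\<dots> < e" using \<open>e > 0\<close> \<open>M > 0\<close> by (simp add: field_simps)
      finally show "dist (mollify k f x') (mollify k f x) < e" by (simp add: dist_norm)
    qed
  qed
  then show ?thesis unfolding continuous_on_iff by blast
qed

section \<open>Differentiation of mollifications\<close>

lemma has_derivative_sum_partial_deriv:
  assumes "Ck (Suc n) k"
  shows "(k has_derivative (\<lambda>h. \<Sum>b\<in>Basis. (h \<bullet> b) * partial_deriv k b x)) (at x)"
proof -
  note D = Ck_Suc_has_derivative[OF assms, of x]
  have lin: "linear (frechet_derivative k (at x))"
    using D has_derivative_linear by blast
  have "frechet_derivative k (at x) h = (\<Sum>b\<in>Basis. (h \<bullet> b) * partial_deriv k b x)" for h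
  proof -
    have "frechet_derivative k (at x) h = frechet_derivative k (at x) (\<Sum>b\<in>Basis. (h \<bullet> b) *\<^sub>R b)"
      by (simp only: euclidean_representation)
    also have "\<dots> = (\<Sum>b\<in>Basis. (h \<bullet> b) * partial_deriv k b x)"
      by (simp only: linear_sum[OF lin] linear_scale[OF lin] real_scaleR_def)
    finally show ?thesis .
  qed
  then show ?thesis by (intro has_derivative_eq_rhs[OF D] ext)
qed

text \<open>Mean value inequality for \<open>k\<close> minus its linear part at \<open>x\<close>: on
  the ball the derivative of this difference has operator norm at most N times \<open>e\<close>,
  because each of the N partial derivatives moves by at most \<open>e\<close>.\<close>

lemma first_order_remainder_le:
  fixes k :: "'a::euclidean_space \<Rightarrow> real" and e :: real
  assumes k: "Ck (Suc n) k" and d: "norm h < d"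
    and close: "\<And>b z. b \<in> Basis \<Longrightarrow> norm (z - x) < d \<Longrightarrow> \<bar>partial_deriv k b z - partial_deriv k b x\<bar> \<le> e"
  shows "\<bar>k (x + h) - k x - (\<Sum>b\<in>Basis. (h \<bullet> b) * partial_deriv k b x)\<bar> \<le> real DIM('a) * e * norm h"
proof -
  let ?L = "\<lambda>h. \<Sum>b\<in>Basis. (h \<bullet> b) * partial_deriv k b x"
  have L: "linear ?L"
    using has_derivative_linear[OF has_derivative_sum_partial_deriv[OF k]] .
  let ?g = "\<lambda>z. k z - ?L z"
  have "norm (?g (x + h) - ?g x) \<le> (real DIM('a) * e) * norm (x + h - x)"
  proof (rule differentiable_bound[of "ball x d"])
    fix z assume z: "z \<in> ball x d"
    have "(?L has_derivative ?L) (at z within ball x d)"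
      using linear_imp_has_derivative[OF L] .
    then show "(?g has_derivative (\<lambda>v. (\<Sum>b\<in>Basis. (v \<bullet> b) * partial_deriv k b z) - ?L v)) (at z within ball x d)"
      by (rule has_derivative_diff[OF has_derivative_at_withinI[OF has_derivative_sum_partial_deriv[OF k]]])
    show "onorm (\<lambda>v. (\<Sum>b\<in>Basis. (v \<bullet> b) * partial_deriv k b z) - ?L v) \<le> real DIM('a) * e"
    proof (rule onorm_le)
      fix v
      have "norm ((\<Sum>b\<in>Basis. (v \<bullet> b) * partial_deriv k b z) - ?L v)
          = \<bar>\<Sum>b\<in>Basis. (v \<bullet> b) * (partial_deriv k b z - partial_deriv k b x)\<bar>"
        by (simp add: sum_subtractf right_diff_distrib)
      also have "\<dots> \<le> (\<Sum>b\<in>(Basis::'a set). norm v * e)"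
        using z by (intro order_trans[OF sum_abs] sum_mono)
          (auto simp: abs_mult dist_norm norm_minus_commute intro!: mult_mono Basis_le_norm close)
      finally show "norm ((\<Sum>b\<in>Basis. (v \<bullet> b) * partial_deriv k b z) - ?L v) \<le> real DIM('a) * e * norm v"
        by (simp add: mult_ac)
    qed
  qed (use d le_less_trans[OF norm_ge_zero d] in \<open>auto simp: dist_norm\<close>)
  moreover have "?L (x + h) = ?L x + ?L h" using linear_add[OF L] .
  ultimately show ?thesis by (simp add: algebra_simps)
qed

text \<open>The point is that \<open>d\<close> does not depend on \<open>x\<close>: the partial
  derivatives are again cutoff kernels, hence uniformly continuous. Uniformity is what allows the
  remainder to be integrated.\<close>

lemma cutoff_kernel_first_order:
  fixes k :: "'a::euclidean_space \<Rightarrow> real"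
  assumes k: "\<forall>n. Ck n k" "cutoff_kernel R k" and "e > 0"
  obtains d where "d > 0" "\<And>x h. norm h < d \<Longrightarrow>
    \<bar>k (x + h) - k x - (\<Sum>b\<in>Basis. (h \<bullet> b) * partial_deriv k b x)\<bar> \<le> real DIM('a) * e * norm h"
proof -
  have k1: "Ck (Suc 0) k" using k(1) by blast
  have "\<exists>d>0. \<forall>x y. norm (x - y) < d \<longrightarrow> \<bar>partial_deriv k b x - partial_deriv k b y\<bar> < e"
    if "b \<in> Basis" for b
    by (rule cutoff_kernel_uniformly_continuous[OF cutoff_kernel_partial_deriv[OF k that] \<open>e > 0\<close>]) blast
  then obtain d where d: "\<And>b. b \<in> Basis \<Longrightarrow> d b > 0"
    "\<And>b x y. b \<in> Basis \<Longrightarrow> norm (x - y) < d b \<Longrightarrow> \<bar>partial_deriv k b x - partial_deriv k b y\<bar> < e"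
    by metis
  define D where "D = Min (d ` Basis)"
  have D: "D > 0" "\<And>b. b \<in> Basis \<Longrightarrow> D \<le> d b"
    using d(1) by (auto simp: D_def)
  show ?thesis
  proof (rule that[OF D(1)])
    fix x h :: 'a assume h: "norm h < D"
    show "\<bar>k (x + h) - k x - (\<Sum>b\<in>Basis. (h \<bullet> b) * partial_deriv k b x)\<bar> \<le> real DIM('a) * e * norm h"
    proof (rule first_order_remainder_le[OF k1 h])
      fix b z :: 'a assume "b \<in> Basis" "norm (z - x) < D"
      then show "\<bar>partial_deriv k b z - partial_deriv k b x\<bar> \<le> e"
        using d(2)[of b z x] D(2)[of b] by simp
    qed
  qed
qed

text \<open>Differentiation under the integral sign. The first order remainder of the kernel is
  small uniformly in \<open>y\<close>, so its integral against \<open>u\<close> is small relative to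
  \<open>norm h\<close> as soon as \<open>u\<close> is integrable.\<close>

lemma has_derivative_mollify:
  fixes u :: "'a::euclidean_space \<Rightarrow> real"
  assumes k: "\<forall>n. Ck n k" "cutoff_kernel R k" and u: "integrable lborel u"
  shows "(mollify k u has_derivative (\<lambda>h. \<Sum>b\<in>Basis. (h \<bullet> b) * mollify (partial_deriv k b) u x)) (at x)"
proof -
  let ?L = "\<lambda>h. \<Sum>b\<in>Basis. (h \<bullet> b) * mollify (partial_deriv k b) u x"
  note int = integrable_mollify_integrand[OF k(2) u]
  note intb = integrable_mollify_integrand[OF cutoff_kernel_partial_deriv[OF k] u]
  have "\<exists>d>0. \<forall>h. norm h < d \<longrightarrow> norm (mollify k u (x + h) - mollify k u x - ?L h) \<le> e * norm h"
    if "e > 0" for e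
  proof -
    \<comment> \<open>Scaled so that the kernel tolerance \<open>e / M\<close>, multiplied by the
      dimension and by the \<open>L^1\<close> norm of \<open>u\<close>, is at most
      \<open>e\<close>.\<close>
    define M where "M = real DIM('a) * ((\<integral>y. \<bar>u y\<bar> \<partial>lborel) + 1)"
    have "M > 0" by (auto simp: M_def intro!: mult_pos_pos add_nonneg_pos)
    have "e / M > 0" using \<open>e > 0\<close> \<open>M > 0\<close> by simp
    then obtain D where D: "D > 0" "\<And>x h. norm h < D \<Longrightarrow>
      \<bar>k (x + h) - k x - (\<Sum>b\<in>Basis. (h \<bullet> b) * partial_deriv k b x)\<bar> \<le> real DIM('a) * (e / M) * norm h"
      by (rule cutoff_kernel_first_order[OF k]) blast
    show ?thesis
    proof (intro exI[of _ D] conjI allI impI D(1))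
      fix h :: 'a assume h: "norm h < D"
      let ?r = "\<lambda>y. k (x - y + h) - k (x - y) - (\<Sum>b\<in>Basis. (h \<bullet> b) * partial_deriv k b (x - y))"
      have r: "\<bar>?r y\<bar> \<le> real DIM('a) * (e / M) * norm h" for y
        by (rule D(2)[OF h])
      have req: "?r y * u y = k (x + h - y) * u y - k (x - y) * u y
          - (\<Sum>b\<in>Basis. (h \<bullet> b) * (partial_deriv k b (x - y) * u y))" for y
        by (simp add: algebra_simps sum_distrib_right sum_distrib_left)
      have int': "integrable lborel (\<lambda>y. k (z - y) * u y)" for z using int[of z] by simp
      have intb': "b \<in> Basis \<Longrightarrow> integrable lborel (\<lambda>y. partial_deriv k b (x - y) * u y)" for b
        using intb[of b x] by simp
      have "mollify k u (x + h) - mollify k u x - ?L h = (\<integral>y. ?r y * u y \<partial>lborel)"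
        unfolding req mollify_def real_scaleR_def by (simp add: int' intb')
      also have "norm \<dots> \<le> (\<integral>y. (real DIM('a) * (e / M) * norm h) * \<bar>u y\<bar> \<partial>lborel)"
      proof (rule Bochner_Integration.integral_norm_bound_integral)
        show "integrable lborel (\<lambda>y. ?r y * u y)"
          unfolding req using int' intb'
          by (intro Bochner_Integration.integrable_diff Bochner_Integration.integrable_sum
              Bochner_Integration.integrable_mult_right)
        show "norm (?r y * u y) \<le> (real DIM('a) * (e / M) * norm h) * \<bar>u y\<bar>" for y
          using mult_right_mono[OF r, of "\<bar>u y\<bar>"] by (simp add: abs_mult)
      qed (use u in simp)
      also have "\<dots> = e * norm h * ((real DIM('a) * (\<integral>y. \<bar>u y\<bar> \<partial>lborel)) / M)" by simp
      also have "\<dots> \<le> e * norm h * 1"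
        using \<open>e > 0\<close> \<open>M > 0\<close> by (intro mult_left_mono) (auto simp: M_def field_simps)
      finally show "norm (mollify k u (x + h) - mollify k u x - ?L h) \<le> e * norm h" by simp
    qed
  qed
  moreover have "bounded_linear ?L"
    by (intro bounded_linear_sum bounded_linear_mult_left[THEN bounded_linear_compose]
        bounded_linear_inner_left)
  ultimately show ?thesis
    unfolding has_derivative_at_alt
  proof (intro conjI allI impI)
    fix e :: real assume "e > 0"
    assume "\<And>e. e > 0 \<Longrightarrow> \<exists>d>0. \<forall>h. norm h < d \<longrightarrow> norm (mollify k u (x + h) - mollify k u x - ?L h) \<le> e * norm h"
    from this[OF \<open>e > 0\<close>] obtain d where d: "d > 0"
      "\<And>h. norm h < d \<Longrightarrow> norm (mollify k u (x + h) - mollify k u x - ?L h) \<le> e * norm h" by blast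
    then show "\<exists>d>0. \<forall>y. norm (y - x) < d \<longrightarrow>
        norm (mollify k u y - mollify k u x - ?L (y - x)) \<le> e * norm (y - x)"
      using d(2)[of "_ - x"] by (intro exI[of _ d]) (auto simp del: real_norm_def)
  qed
qed

lemma partial_deriv_mollify:
  fixes u :: "'a::euclidean_space \<Rightarrow> real"
  assumes "\<forall>n. Ck n k" "cutoff_kernel R k" "integrable lborel u" "b \<in> Basis"
  shows "partial_deriv (mollify k u) b x = mollify (partial_deriv k b) u x"
  using frechet_derivative_at[OF has_derivative_mollify[OF assms(1-3)], of x, symmetric] assms(4)
  by (simp add: inner_Basis if_distrib[of "\<lambda>c. c * _"] sum.delta cong: if_cong)

text \<open>Each partial derivative is again a mollification of the same \<open>u\<close>, with
  kernel \<open>partial_deriv k b\<close>; hence the induction is over all kernels.\<close>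

lemma Ck_mollify:
  fixes u :: "'a::euclidean_space \<Rightarrow> real"
  assumes "\<forall>n. Ck n k" "cutoff_kernel R k" "integrable lborel u"
  shows "Ck n (mollify k u)"
  using assms
proof (induction n arbitrary: k)
  case 0
  then show ?case using continuous_on_mollify by (auto simp del: Ck.simps(2))
next
  case (Suc n)
  show ?case
  proof (rule Ck_SucI[OF has_derivative_mollify[OF Suc.prems]])
    fix c :: 'a assume c: "c \<in> Basis"
    have "(\<lambda>x. \<Sum>b\<in>Basis. (c \<bullet> b) * mollify (partial_deriv k b) u x) = mollify (partial_deriv k c) u"
      using c by (simp add: fun_eq_iff inner_Basis if_distrib[of "\<lambda>c. c * _"] sum.delta cong: if_cong)
    moreover have "Ck n (mollify (partial_deriv k c) u)"
      using Suc.prems c by (intro Suc.IH cutoff_kernel_partial_deriv) (auto intro: Ck_partial_deriv)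
    ultimately show "Ck n (\<lambda>x. \<Sum>b\<in>Basis. (c \<bullet> b) * mollify (partial_deriv k b) u x)" by metis
  qed
qed

section \<open>Mollification as an \<open>L^1\<close> contraction and its convergence in
  \<open>L^1\<close>\<close>

lemma integrable_mollify_pair:
  fixes f :: "'a::euclidean_space \<Rightarrow> 'b::euclidean_space"
  assumes \<rho>: "mollifier \<epsilon> \<rho>" and f: "integrable lborel f"
  shows "integrable (lborel \<Otimes>\<^sub>M lborel) (\<lambda>(y, x). \<rho> (x - y) *\<^sub>R f y)"
proof -
  note [measurable] = mollifierD(6)[OF \<rho>] borel_measurable_integrable[OF f]
  have int: "integrable lborel (\<lambda>x. \<rho> (x - y))" for y
    using integrable_lborel_translate[of \<rho> "- y"] cutoff_kernel_integrable[OF mollifierD(1)[OF \<rho>]]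
    by simp
  \<comment> \<open>Integrating in \<open>x\<close> first is what makes Fubini easy: the translated
    kernel has unit mass, so \<open>norm (f y)\<close> is all that remains.\<close>
  have eq: "(\<integral>x. norm (\<rho> (x - y) *\<^sub>R f y) \<partial>lborel) = norm (f y)" for y
    using integral_lborel_translate[of \<rho> "- y"] mollifierD[OF \<rho>] by simp
  show ?thesis
  proof (rule lborel_pair.Fubini_integrable)
    show "integrable lborel (\<lambda>y. \<integral>x. norm (case (y, x) of (y, x) \<Rightarrow> \<rho> (x - y) *\<^sub>R f y) \<partial>lborel)"
      unfolding prod.case eq using f by simp
    show "AE y in lborel. integrable lborel (\<lambda>x. case (y, x) of (y, x) \<Rightarrow> \<rho> (x - y) *\<^sub>R f y)"
      using int by (intro AE_I2) simp
  qed measurable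
qed

lemma integrable_mollify:
  fixes f :: "'a::euclidean_space \<Rightarrow> 'b::euclidean_space"
  assumes "mollifier \<epsilon> \<rho>" and "integrable lborel f"
  shows "integrable lborel (mollify \<rho> f)"
  using lborel_pair.integrable_snd[OF integrable_mollify_pair[OF assms]]
  by (simp add: mollify_def[abs_def])

lemma integral_mollify:
  fixes f :: "'a::euclidean_space \<Rightarrow> 'b::euclidean_space"
  assumes \<rho>: "mollifier \<epsilon> \<rho>" and f: "integrable lborel f"
  shows "(\<integral>x. mollify \<rho> f x \<partial>lborel) = (\<integral>x. f x \<partial>lborel)"
proof -
  note [measurable] = mollifierD(6)[OF \<rho>]
  have int: "integrable lborel (\<lambda>x. \<rho> (x - y))" for y
    using integrable_lborel_translate[of \<rho> "- y"] cutoff_kernel_integrable[OF mollifierD(1)[OF \<rho>]]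
    by simp
  have "(\<integral>x. mollify \<rho> f x \<partial>lborel) = (\<integral>y. (\<integral>x. \<rho> (x - y) *\<^sub>R f y \<partial>lborel) \<partial>lborel)"
    unfolding mollify_def using lborel_pair.Fubini_integral[OF integrable_mollify_pair[OF assms]] .
  also have "\<dots> = (\<integral>y. f y \<partial>lborel)"
    using integral_lborel_translate[of \<rho> "- _"] mollifierD[OF \<rho>] int by simp
  finally show ?thesis .
qed

lemma integral_norm_mollify_le:
  fixes f :: "'a::euclidean_space \<Rightarrow> 'b::euclidean_space"
  assumes \<rho>: "mollifier \<epsilon> \<rho>" and f: "integrable lborel f"
  shows "(\<integral>x. norm (mollify \<rho> f x) \<partial>lborel) \<le> (\<integral>x. norm (f x) \<partial>lborel)"
proof -
  have "(\<integral>x. norm (mollify \<rho> f x) \<partial>lborel) \<le> (\<integral>x. mollify \<rho> (\<lambda>x. norm (f x)) x \<partial>lborel)"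
    using f by (intro integral_mono integrable_norm integrable_mollify[OF \<rho>] norm_mollify_le[OF \<rho>])
  then show ?thesis using integral_mollify[OF \<rho>, of "\<lambda>x. norm (f x)"] f by simp
qed

text \<open>If \<open>K \<subseteq> A \<subseteq> U\<close> and \<open>K\<close> has distance more than \<open>\<epsilon>\<close> from the complement of \<open>U\<close>, then
  \<open>0 \<le> 1\<^sub>K * \<rho> \<le> 1\<^sub>U\<close>, so the \<open>L\<^sup>1\<close> distance of these two functions is the difference of the measures.\<close>

lemma mollify_indicator_error:
  fixes A K U :: "'a::euclidean_space set"
  assumes \<rho>: "mollifier \<epsilon> \<rho>"
    and sets: "K \<in> sets borel" "A \<in> sets borel" "U \<in> sets borel" "K \<subseteq> A" "A \<subseteq> U"
    and fin: "emeasure lborel U < \<infinity>"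
    and near: "\<And>x y. x \<in> K \<Longrightarrow> dist x y \<le> \<epsilon> \<Longrightarrow> y \<in> U"
  shows "(\<integral>x. \<bar>mollify \<rho> (indicator A) x - indicator A x\<bar> \<partial>lborel)
      \<le> 2 * (measure lborel U - measure lborel K)"
proof -
  let ?I = "\<lambda>S x. indicator S x :: real"
  have "emeasure lborel A \<le> emeasure lborel U" "emeasure lborel K \<le> emeasure lborel U"
    using sets by (auto intro!: emeasure_mono)
  then have finAK: "emeasure lborel A < \<infinity>" "emeasure lborel K < \<infinity>"
    using fin by (auto intro: le_less_trans)
  have int: "integrable lborel (?I U)" "integrable lborel (?I A)" "integrable lborel (?I K)"
    using sets fin finAK by (auto intro!: integrable_real_indicator)
  note intm = integrable_mollify[OF \<rho>]
  let ?A = "mollify \<rho> (?I A)" and ?K = "mollify \<rho> (?I K)"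
  have K_le: "?K x \<le> ?I U x" for x
  proof (cases "x \<in> U")
    case True
    have "?K x \<le> (\<integral>y. \<rho> (x - y) \<partial>lborel)"
      unfolding mollify_def
    proof (rule integral_mono)
      show "integrable lborel (\<lambda>y. \<rho> (x - y) *\<^sub>R ?I K y)"
        using integrable_mollify_integrand[OF mollifierD(1)[OF \<rho>] int(3)] .
      \<comment> \<open>A non-integrable function has Bochner integral 0, whereas this integral
        equals 1.\<close>
      show "integrable lborel (\<lambda>y. \<rho> (x - y))"
      proof (rule ccontr)
        assume "\<not> integrable lborel (\<lambda>y. \<rho> (x - y))"
        then show False
          using integral_lborel_reflect[of \<rho> x] mollifierD(4,6)[OF \<rho>] by (simp add: not_integrable_integral_eq)
      qed
      show "\<rho> (x - y) *\<^sub>R ?I K y \<le> \<rho> (x - y)" for y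
        using mollifierD(3)[OF \<rho>] by (auto simp: indicator_def)
    qed
    then show ?thesis
      using True integral_lborel_reflect[of \<rho> x] mollifierD[OF \<rho>] by simp
  next
    case False
    have "?K x = 0"
      using mollifierD(1)[OF \<rho>]
      by (rule mollify_eq_0) (use False near in \<open>auto simp: indicator_def dist_commute\<close>)
    then show ?thesis by simp
  qed
  have A_ge: "?K x \<le> ?A x" for x
    using sets int by (intro mollify_mono[OF \<rho>]) (auto simp: indicator_def)
  \<comment> \<open>All three summands are nonnegative and mollification preserves integrals, so
    after integration the measure of \<open>A\<close> cancels and twice the difference of the
    measures of \<open>U\<close> and \<open>K\<close> is left.\<close>
  have "\<bar>?A x - ?I A x\<bar> \<le> (?A x - ?K x) + (?I U x - ?K x) + (?I U x - ?I A x)" for x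
  proof -
    have "?I A x \<le> ?I U x" using sets by (auto simp: indicator_def)
    then show ?thesis using K_le[of x] A_ge[of x] by linarith
  qed
  then have "(\<integral>x. \<bar>?A x - ?I A x\<bar> \<partial>lborel)
      \<le> (\<integral>x. (?A x - ?K x) + (?I U x - ?K x) + (?I U x - ?I A x) \<partial>lborel)"
    using int intm by (intro integral_mono integrable_abs Bochner_Integration.integrable_add
        Bochner_Integration.integrable_diff) auto
  also have "\<dots> = (measure lborel A - measure lborel K) + (measure lborel U - measure lborel K)
      + (measure lborel U - measure lborel A)"
    using int intm[OF int(2)] intm[OF int(3)] by (simp add: integral_mollify[OF \<rho>])
  finally show ?thesis by simp
qed

text \<open>Regularity of Lebesgue measure supplies the two comparison sets: an open
  \<open>U\<close> from outside, and from inside the part of \<open>A\<close> that stays a fixed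
  distance away from the complement of \<open>U\<close>.\<close>

lemma mollify_indicator_tendsto:
  fixes A :: "'a::euclidean_space set"
  assumes \<rho>: "\<And>n. mollifier (\<delta> n) (\<rho> n)" and \<delta>: "\<delta> \<longlonglongrightarrow> 0"
    and A: "A \<in> sets borel" "emeasure lborel A < \<infinity>"
  shows "(\<lambda>n. \<integral>x. \<bar>mollify (\<rho> n) (indicator A) x - indicator A x\<bar> \<partial>lborel) \<longlonglongrightarrow> (0::real)"
proof (rule LIMSEQ_I)
  fix e :: real assume "e > 0"
  \<comment> \<open>The tolerance \<open>e / 4\<close> is spent once outside \<open>A\<close> and
    once inside, and the error estimate doubles the sum.\<close>
  have "A \<in> sets lebesgue" "e / 4 > 0" using A \<open>e > 0\<close> by auto
  then obtain U where U: "open U" "A \<subseteq> U" "emeasure lebesgue (U - A) < ennreal (e / 4)"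
    by (rule sets_lebesgue_outer_open) blast
  have emU: "emeasure lborel (U - A) < ennreal (e / 4)"
    using U A by (simp add: emeasure_completion)
  have "emeasure lborel U = emeasure lborel A + emeasure lborel (U - A)"
    using U A by (subst plus_emeasure) (auto intro!: arg_cong[of _ _ "emeasure lborel"])
  also have "\<dots> < \<infinity>"
    using A(2) emU by (auto simp: less_top[symmetric])
  finally have finU: "emeasure lborel U < \<infinity>" .
  have mU: "measure lborel U < measure lborel A + e / 4"
  proof -
    have "measure lborel (U - A) < e / 4"
    proof -
      have "emeasure lborel (U - A) \<noteq> \<infinity>" using emU by auto
      then have "emeasure lborel (U - A) = ennreal (measure lborel (U - A))"
        by (simp add: emeasure_eq_ennreal_measure)
      then show ?thesis using emU by (simp add: ennreal_less_iff)
    qed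
    moreover have "measure lborel (U - A) = measure lborel U - measure lborel A"
      using U A finU by (intro measure_Diff) auto
    ultimately show ?thesis by simp
  qed
  \<comment> \<open>Points of \<open>A\<close> at distance at least \<open>1 / (m + 1)\<close> from
    the complement of \<open>U\<close>. Removing a union of open balls leaves a closed condition, so
    these sets are Borel, and they exhaust \<open>A\<close> because \<open>U\<close> is
    open.\<close>
  define E where "E m = A \<inter> - (\<Union>y\<in>-U. ball y (inverse (real (Suc m))))" for m :: nat
  have Eb: "E m \<in> sets borel" for m
    unfolding E_def by (intro sets.Int A borel_closed closed_Compl open_UN ballI open_ball)
  have "incseq E"
  proof (rule incseq_SucI)
    fix m
    have "inverse (real (Suc (Suc m))) \<le> inverse (real (Suc m))" by (simp add: field_simps)
    then show "E m \<subseteq> E (Suc m)" unfolding E_def using subset_ball by blast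
  qed
  moreover have "(\<Union>m. E m) = A"
  proof -
    have "\<exists>m. x \<in> E m" if "x \<in> A" for x
    proof -
      have "x \<in> U" using U(2) that by blast
      then have "\<exists>d>0. ball x d \<subseteq> U" by (rule open_contains_ball_eq[OF U(1), THEN iffD1])
      then obtain d where d: "d > 0" "ball x d \<subseteq> U" by (elim exE conjE)
      obtain m where "inverse (real (Suc m)) < d"
        using reals_Archimedean[OF d(1)] by blast
      then have "ball x (inverse (real (Suc m))) \<subseteq> U"
        by (intro order_trans[OF subset_ball d(2)] less_imp_le)
      then have "x \<notin> (\<Union>y\<in>-U. ball y (inverse (real (Suc m))))"
        by (auto simp: subset_eq dist_commute simp del: of_nat_Suc)
      then have "x \<in> E m"
        using that by (simp add: E_def)
      then show ?thesis ..
    qed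
    then show ?thesis by (auto simp: E_def)
  qed
  ultimately have "(\<lambda>m. measure lborel (E m)) \<longlonglongrightarrow> measure lborel A"
    using Lim_measure_incseq[of E lborel] Eb A(2) by (auto simp: less_top image_subset_iff)
  then have "\<forall>\<^sub>F m in sequentially. measure lborel A - e / 4 < measure lborel (E m)"
    using \<open>e > 0\<close> by (intro order_tendstoD) auto
  then obtain m where m: "measure lborel A - e / 4 < measure lborel (E m)"
    by (auto simp: eventually_sequentially)
  have "\<forall>\<^sub>F n in sequentially. \<delta> n < inverse (real (Suc m))"
    using \<delta> by (intro order_tendstoD) auto
  then obtain n0 where n0: "\<And>n. n \<ge> n0 \<Longrightarrow> \<delta> n < inverse (real (Suc m))"
    by (auto simp: eventually_sequentially)
  show "\<exists>no. \<forall>n\<ge>no. norm ((\<integral>x. \<bar>mollify (\<rho> n) (indicator A) x - indicator A x\<bar> \<partial>lborel) - 0 :: real) < e"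
  proof (intro exI[of _ n0] allI impI)
    fix n assume "n \<ge> n0"
    have "(\<integral>x. \<bar>mollify (\<rho> n) (indicator A) x - indicator A x\<bar> \<partial>lborel)
        \<le> 2 * (measure lborel U - measure lborel (E m))"
    proof (rule mollify_indicator_error[OF \<rho>])
      show "y \<in> U" if "x \<in> E m" "dist x y \<le> \<delta> n" for x y
        proof (rule ccontr)
        assume "y \<notin> U"
        moreover have "dist y x < inverse (real (Suc m))"
          using that(2) n0[OF \<open>n \<ge> n0\<close>] by (simp add: dist_commute)
        ultimately show False using that(1) unfolding E_def by (auto simp del: of_nat_Suc)
      qed
    qed (use A U Eb finU in \<open>auto simp: E_def\<close>)
    then show "norm ((\<integral>x. \<bar>mollify (\<rho> n) (indicator A) x - indicator A x\<bar> \<partial>lborel) - 0 :: real) < e"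
      using mU m by (simp add: abs_of_nonneg)
  qed
qed

text \<open>Density argument: indicators are settled above, sums follow from linearity, and the
  passage to limits works because mollification does not increase the \<open>L^1\<close> norm, so
  the approximation error survives it unchanged for every \<open>n\<close>.\<close>

theorem mollify_tendsto_L1:
  fixes f :: "'a::euclidean_space \<Rightarrow> 'b::euclidean_space"
  assumes \<rho>: "\<And>n. mollifier (\<delta> n) (\<rho> n)" and \<delta>: "\<delta> \<longlonglongrightarrow> 0" and f: "integrable lborel f"
  shows "(\<lambda>n. \<integral>x. norm (mollify (\<rho> n) f x - f x) \<partial>lborel) \<longlonglongrightarrow> 0"
  using f
proof (induction rule: integrable_induct)
  case (base A c)
  have "mollify (\<rho> n) (\<lambda>x. indicator A x *\<^sub>R c) x = mollify (\<rho> n) (indicator A) x *\<^sub>R c" for n x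
  proof -
    have "integrable lborel (\<lambda>y. \<rho> n (x - y) *\<^sub>R (indicator A y :: real))"
      using base by (intro integrable_mollify_integrand[OF mollifierD(1)[OF \<rho>]] integrable_real_indicator) auto
    then show ?thesis
      unfolding mollify_def by (subst integral_scaleR_left[symmetric]) auto
  qed
  then have "norm (mollify (\<rho> n) (\<lambda>x. indicator A x *\<^sub>R c) x - indicator A x *\<^sub>R c)
      = \<bar>mollify (\<rho> n) (indicator A) x - indicator A x\<bar> * norm c" for n x
    by (simp add: scaleR_diff_left[symmetric])
  then show ?case
    using tendsto_mult_left_zero[OF mollify_indicator_tendsto[OF \<rho> \<delta>, of A], of "norm c"] base
    by simp
next
  case (add f g)
  note mi = integrable_mollify[OF \<rho>] and md = mollifierD(1)[OF \<rho>]
  have "(\<integral>x. norm (mollify (\<rho> n) (\<lambda>x. f x + g x) x - (f x + g x)) \<partial>lborel)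
     \<le> (\<integral>x. norm (mollify (\<rho> n) f x - f x) \<partial>lborel) + (\<integral>x. norm (mollify (\<rho> n) g x - g x) \<partial>lborel)" for n
  proof (subst Bochner_Integration.integral_add[symmetric])
    show "(\<integral>x. norm (mollify (\<rho> n) (\<lambda>x. f x + g x) x - (f x + g x)) \<partial>lborel)
     \<le> (\<integral>x. norm (mollify (\<rho> n) f x - f x) + norm (mollify (\<rho> n) g x - g x) \<partial>lborel)"
    proof (rule integral_mono)
      show "norm (mollify (\<rho> n) (\<lambda>x. f x + g x) x - (f x + g x))
          \<le> norm (mollify (\<rho> n) f x - f x) + norm (mollify (\<rho> n) g x - g x)" for x
        unfolding mollify_add[OF md add(1,2)] by (rule norm_diff_triangle_ineq)
    qed (use add(1,2) in \<open>auto intro!: integrable_norm Bochner_Integration.integrable_add Bochner_Integration.integrable_diff mi\<close>)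
  qed (use add in \<open>auto intro!: integrable_norm Bochner_Integration.integrable_diff mi\<close>)
  then show ?case
    by (intro tendsto_sandwich[OF _ _ tendsto_const tendsto_add_zero[OF add(3,4)]] always_eventually)
       (auto intro!: integral_nonneg_AE)
next
  case (lim f s)
  note mi = integrable_mollify[OF \<rho>] and md = mollifierD(1)[OF \<rho>]
  show ?case
  proof (rule LIMSEQ_I)
    fix e :: real assume "e > 0"
    \<comment> \<open>The induction principle provides approximants with
      \<open>norm (s i x) \<le> 2 * norm (f x)\<close>, hence the majorant with factor 3.\<close>
    have "(\<lambda>i. \<integral>x. norm (s i x - f x) \<partial>lborel) \<longlonglongrightarrow> (\<integral>x. 0 \<partial>(lborel :: 'a measure))"
    proof (rule Bochner_Integration.integral_dominated_convergence[where w = "\<lambda>x. 3 * norm (f x)"])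
      show "integrable lborel (\<lambda>x. 3 * norm (f x))" using lim by auto
      show "AE x in lborel. (\<lambda>i. norm (s i x - f x)) \<longlonglongrightarrow> 0"
        using lim(2) by (auto simp: LIM_zero_iff intro!: AE_I2 tendsto_norm_zero)
      show "AE x in lborel. norm (norm (s i x - f x)) \<le> 3 * norm (f x)" for i
      proof (intro AE_I2)
        fix x :: 'a
        show "norm (norm (s i x - f x)) \<le> 3 * norm (f x)"
          using lim(3)[of x i] norm_triangle_ineq4[of "s i x" "f x"] by simp
      qed
    qed (use lim(1) lim(4) in \<open>auto intro!: borel_measurable_norm borel_measurable_diff\<close>)
    then have "\<forall>\<^sub>F i in sequentially. (\<integral>x. norm (s i x - f x) \<partial>lborel) < e / 3"
      using \<open>e > 0\<close> by (intro order_tendstoD) auto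
    then obtain i where i: "(\<integral>x. norm (s i x - f x) \<partial>lborel) < e / 3"
      by (auto simp: eventually_sequentially)
    have "\<forall>\<^sub>F n in sequentially. (\<integral>x. norm (mollify (\<rho> n) (s i) x - s i x) \<partial>lborel) < e / 3"
      using \<open>e > 0\<close> lim(5)[of i] by (intro order_tendstoD) auto
    then obtain n0 where n0: "\<And>n. n \<ge> n0 \<Longrightarrow> (\<integral>x. norm (mollify (\<rho> n) (s i) x - s i x) \<partial>lborel) < e / 3"
      by (auto simp: eventually_sequentially)
    show "\<exists>no. \<forall>n\<ge>no. norm ((\<integral>x. norm (mollify (\<rho> n) f x - f x) \<partial>lborel) - 0) < e"
    proof (intro exI[of _ n0] allI impI)
      fix n assume n: "n \<ge> n0"
      let ?d = "\<lambda>x. f x - s i x"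
      have d: "integrable lborel ?d" using lim by auto
      \<comment> \<open>The first and the last term are both at most the \<open>L^1\<close> distance
        of \<open>s i\<close> and \<open>f\<close>; only the middle one uses the convergence for
        \<open>s i\<close>.\<close>
      have "(\<integral>x. norm (mollify (\<rho> n) f x - f x) \<partial>lborel)
          \<le> (\<integral>x. norm (mollify (\<rho> n) ?d x) + norm (mollify (\<rho> n) (s i) x - s i x) + norm (s i x - f x) \<partial>lborel)"
      proof (rule integral_mono)
        fix x
        have "mollify (\<rho> n) f x - f x = mollify (\<rho> n) ?d x + (mollify (\<rho> n) (s i) x - s i x) + (s i x - f x)"
          unfolding mollify_diff[OF md lim(4,1)] by simp
        then show "norm (mollify (\<rho> n) f x - f x)
            \<le> norm (mollify (\<rho> n) ?d x) + norm (mollify (\<rho> n) (s i) x - s i x) + norm (s i x - f x)"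
          by (simp only:) (rule order_trans[OF norm_triangle_ineq add_right_mono[OF norm_triangle_ineq]])
      qed (use lim(1,4) d in \<open>auto intro!: integrable_norm Bochner_Integration.integrable_add Bochner_Integration.integrable_diff mi\<close>)
      also have "\<dots> = (\<integral>x. norm (mollify (\<rho> n) ?d x) \<partial>lborel)
          + (\<integral>x. norm (mollify (\<rho> n) (s i) x - s i x) \<partial>lborel) + (\<integral>x. norm (s i x - f x) \<partial>lborel)"
        using lim(1,4) mi[OF d] mi[OF lim(1)] by simp
      also have "\<dots> < e"
        using integral_norm_mollify_le[OF \<rho> d, of n] i n0[OF n] by (simp add: norm_minus_commute)
      finally show "norm ((\<integral>x. norm (mollify (\<rho> n) f x - f x) \<partial>lborel) - 0) < e"
        by (simp add: abs_of_nonneg)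
    qed
  qed
qed

subsection \<open>Passing between Lebesgue and Borel measurable functions\<close>

lemma AE_lebesgue_on_iff:
  assumes "S \<in> sets borel"
  shows "(AE x in lebesgue_on S. P x) \<longleftrightarrow> (AE x in lborel. x \<in> S \<longrightarrow> P x)"
  using assms by (simp add: AE_restrict_space_iff AE_completion_iff)

lemma AE_lebesgue_onI:
  assumes "AE x in lborel. P x" "S \<in> sets borel"
  shows "AE x in lebesgue_on S. P x"
  unfolding AE_lebesgue_on_iff[OF assms(2)] using assms(1) by eventually_elim simp

lemma lebesgue_on_lborel:
  fixes f :: "'a::euclidean_space \<Rightarrow> 'b::euclidean_space"
  assumes [measurable]: "S \<in> sets borel" "f \<in> borel_measurable borel"
    and 0: "\<And>x. x \<notin> S \<Longrightarrow> f x = 0"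
  shows integral_lebesgue_on_lborel: "(\<integral>x. f x \<partial>lebesgue_on S) = (\<integral>x. f x \<partial>lborel)"
    and integrable_lebesgue_on_lborel: "integrable (lebesgue_on S) f \<longleftrightarrow> integrable lborel f"
proof -
  have eq: "(\<lambda>x. indicator S x *\<^sub>R f x) = f"
    using 0 by (auto simp: indicator_def fun_eq_iff)
  show "(\<integral>x. f x \<partial>lebesgue_on S) = (\<integral>x. f x \<partial>lborel)"
    using assms by (simp add: integral_restrict_space integral_completion eq)
  show "integrable (lebesgue_on S) f \<longleftrightarrow> integrable lborel f"
    using assms by (simp add: integrable_restrict_space integrable_completion eq)
qed

lemma borel_measurable_lebesgue_onI:
  "f \<in> borel_measurable borel \<Longrightarrow> f \<in> borel_measurable (lebesgue_on S)"
  by (intro measurable_restrict_space1 measurable_completion) simp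

lemma lebesgue_measurable_ex_borel:
  fixes f :: "'a::euclidean_space \<Rightarrow> 'b::euclidean_space"
  assumes "f \<in> borel_measurable lebesgue"
  shows "\<exists>g\<in>borel_measurable borel. AE x in lborel. f x = g x"
proof -
  have "\<exists>g. g \<in> borel_measurable borel \<and> (AE x in lborel. f x \<bullet> b = g x)" for b
    using completion_ex_borel_measurable_real[of "\<lambda>x. f x \<bullet> b" lborel] assms by auto
  then obtain g where g: "\<And>b. g b \<in> borel_measurable borel" "\<And>b. AE x in lborel. f x \<bullet> b = g b x"
    by metis
  have "AE x in lborel. \<forall>b\<in>Basis. f x \<bullet> b = g b x"
    using g(2) by (subst AE_ball_countable) (auto simp: countable_finite)
  then have "AE x in lborel. f x = (\<Sum>b\<in>Basis. g b x *\<^sub>R b)"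
    by eventually_elim (metis (mono_tags, lifting) euclidean_representation sum.cong)
  moreover have "(\<lambda>x. \<Sum>b\<in>Basis. g b x *\<^sub>R b) \<in> borel_measurable borel"
    using g(1) by measurable
  ultimately show ?thesis by (rule bexI)
qed

text \<open>Replaces a function known almost everywhere on \<open>K\<close> by a Borel function
  vanishing off \<open>K\<close>, to which Fubini and the translation invariance of
  \<open>lborel\<close> apply and whose mollifications do not see arbitrary values
  elsewhere.\<close>

lemma set_integrable_ex_borel:
  fixes f :: "'a::euclidean_space \<Rightarrow> 'b::euclidean_space"
  assumes f: "set_integrable lebesgue K f" and K[measurable]: "K \<in> sets borel"
  obtains g where "g \<in> borel_measurable borel" "integrable lborel g" "\<And>x. x \<notin> K \<Longrightarrow> g x = 0"
    "AE x in lborel. x \<in> K \<longrightarrow> g x = f x"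
proof -
  have int: "integrable lebesgue (\<lambda>x. indicator K x *\<^sub>R f x)"
    using f by (simp add: set_integrable_def)
  then obtain g where [measurable]: "g \<in> borel_measurable borel"
    and g: "AE x in lborel. indicator K x *\<^sub>R f x = g x"
    using lebesgue_measurable_ex_borel[OF borel_measurable_integrable[OF int]] by blast
  let ?g = "\<lambda>x. indicator K x *\<^sub>R g x"
  have ae: "AE x in lborel. indicator K x *\<^sub>R f x = ?g x"
    using g by eventually_elim (auto simp: indicator_def split: if_splits)
  have "integrable lebesgue ?g"
    using int
  proof (rule Bochner_Integration.integrable_cong_AE_imp)
    show "?g \<in> borel_measurable lebesgue"
      by (intro measurable_completion) measurable
    show "AE x in lebesgue. indicator K x *\<^sub>R f x = ?g x"
      using ae by (intro AE_completion) auto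
  qed
  then have "integrable lborel ?g"
    by (subst (asm) integrable_completion) measurable
  moreover have "AE x in lborel. x \<in> K \<longrightarrow> ?g x = f x"
    using ae by eventually_elim auto
  ultimately show ?thesis by (intro that[of ?g]) auto
qed

subsection \<open>Test functions and weak gradients\<close>

lemma C0_infinityD:
  assumes "\<phi> \<in> C0_infinity \<Omega>"
  obtains K where "compact K" "K \<subseteq> \<Omega>" "\<And>x. x \<notin> K \<Longrightarrow> \<phi> x = 0" "\<And>n. Ck n \<phi>"
proof (rule that[of "closure {x. \<phi> x \<noteq> 0}"])
  show "\<phi> x = 0" if "x \<notin> closure {x. \<phi> x \<noteq> 0}" for x
    using that closure_subset[of "{x. \<phi> x \<noteq> 0}"] by blast
qed (use assms in \<open>simp_all add: C0_infinity_def\<close>)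

lemma C0_infinityI:
  assumes "\<And>n. Ck n \<phi>" "compact K" "K \<subseteq> \<Omega>" "\<And>x. x \<notin> K \<Longrightarrow> \<phi> x = 0"
  shows "\<phi> \<in> C0_infinity \<Omega>"
proof -
  have "closure {x. \<phi> x \<noteq> 0} \<subseteq> K"
    using assms by (intro closure_minimal compact_imp_closed) auto
  moreover from this have "compact (closure {x. \<phi> x \<noteq> 0})"
    using assms(2) by (meson bounded_subset closed_closure compact_eq_bounded_closed)
  ultimately show ?thesis using assms unfolding C0_infinity_def by blast
qed

lemma C0_infinity_mono: "\<Omega>' \<subseteq> \<Omega> \<Longrightarrow> C0_infinity \<Omega>' \<subseteq> C0_infinity \<Omega>"
  unfolding C0_infinity_def by blast

lemma C0_infinity_cutoff_kernel:
  assumes "\<phi> \<in> C0_infinity \<Omega>"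
  obtains R where "cutoff_kernel R \<phi>"
proof -
  obtain K where K: "compact K" "\<And>x. x \<notin> K \<Longrightarrow> \<phi> x = 0" "\<And>n. Ck n \<phi>"
    using C0_infinityD[OF assms] by metis
  obtain R where "\<And>x. x \<in> K \<Longrightarrow> norm x \<le> R"
    using compact_imp_bounded[OF K(1)] by (auto simp: bounded_iff)
  then have "cutoff_kernel R \<phi>"
    unfolding cutoff_kernel_def using K Ck_continuous[OF K(3)] by (meson not_less)
  then show ?thesis by (rule that)
qed

text \<open>The bridge between mollification and weak derivatives: the value of a mollification at
  \<open>x\<close> is an integral against this test function.\<close>

lemma mollifier_reflect_C0_infinity:
  assumes \<rho>: "mollifier \<epsilon> \<rho>" and "cball x \<epsilon> \<subseteq> \<Omega>"
  shows "(\<lambda>y. \<rho> (x - y)) \<in> C0_infinity \<Omega>"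
proof (rule C0_infinityI[of _ "cball x \<epsilon>"])
  show "Ck n (\<lambda>y. \<rho> (x - y))" for n using Ck_reflect mollifierD[OF \<rho>] by blast
  show "\<rho> (x - y) = 0" if "y \<notin> cball x \<epsilon>" for y
    using mollifierD(5)[OF \<rho>, of "x - y"] that by (auto simp: dist_norm)
qed (simp_all add: assms(2))

lemma integrable_locally_integrable_mult:
  fixes f :: "'a::euclidean_space \<Rightarrow> 'b::euclidean_space"
  assumes \<Omega>: "open \<Omega>" and f: "locally_integrable \<Omega> f"
    and \<psi>: "continuous_on UNIV (\<psi> :: 'a \<Rightarrow> real)" "compact K" "K \<subseteq> \<Omega>" "\<And>x. x \<notin> K \<Longrightarrow> \<psi> x = 0"
  shows "integrable (lebesgue_on \<Omega>) (\<lambda>x. \<psi> x *\<^sub>R f x)"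
proof -
  have K: "K \<in> sets lebesgue" "\<Omega> \<in> sets lebesgue"
    using \<psi>(2) \<Omega> by (auto simp: borel_compact)
  have int: "integrable lebesgue (\<lambda>x. indicator K x *\<^sub>R f x)"
    using f \<psi> by (auto simp: locally_integrable_def set_integrable_def)
  obtain B where B: "\<And>x. x \<in> K \<Longrightarrow> \<bar>\<psi> x\<bar> \<le> B"
    using compact_imp_bounded[OF compact_continuous_image[OF continuous_on_subset[OF \<psi>(1)] \<psi>(2)]]
    by (auto simp: bounded_real)
  have [measurable]: "\<psi> \<in> borel_measurable lebesgue"
    using \<psi>(1) by (intro measurable_completion) (simp add: borel_measurable_continuous_onI)
  have "integrable lebesgue (\<lambda>x. \<psi> x *\<^sub>R (indicator K x *\<^sub>R f x))"
  proof (rule Bochner_Integration.integrable_bound)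
    show "integrable lebesgue (\<lambda>x. B * norm (indicator K x *\<^sub>R f x))"
      using int by (intro integrable_mult_right integrable_norm)
    show "(\<lambda>x. \<psi> x *\<^sub>R (indicator K x *\<^sub>R f x)) \<in> borel_measurable lebesgue"
      using borel_measurable_integrable[OF int] by measurable
    have "norm (\<psi> x *\<^sub>R (indicator K x *\<^sub>R f x)) \<le> norm (B * norm (indicator K x *\<^sub>R f x))" for x
    proof (cases "x \<in> K")
      case True
      then have "\<bar>\<psi> x\<bar> \<le> \<bar>B\<bar>" using B[of x] by linarith
      then show ?thesis using True by (auto simp: abs_mult intro!: mult_right_mono)
    qed simp
    then show "AE x in lebesgue. norm (\<psi> x *\<^sub>R (indicator K x *\<^sub>R f x)) \<le> norm (B * norm (indicator K x *\<^sub>R f x))"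
      by simp
  qed
  moreover have "(\<lambda>x. \<psi> x *\<^sub>R (indicator K x *\<^sub>R f x)) = (\<lambda>x. indicator \<Omega> x *\<^sub>R (\<psi> x *\<^sub>R f x))"
    using \<psi> by (auto simp: fun_eq_iff indicator_def)
  ultimately show ?thesis using K by (simp add: integrable_restrict_space)
qed

lemma integrable_test_mult:
  fixes f :: "'a::euclidean_space \<Rightarrow> real"
  assumes "open \<Omega>" "locally_integrable \<Omega> f" "\<phi> \<in> C0_infinity \<Omega>"
  shows "integrable (lebesgue_on \<Omega>) (\<lambda>x. f x * \<phi> x)"
    and "b \<in> Basis \<Longrightarrow> integrable (lebesgue_on \<Omega>) (\<lambda>x. f x * partial_deriv \<phi> b x)"
proof -
  obtain K where K: "compact K" "K \<subseteq> \<Omega>" "\<And>x. x \<notin> K \<Longrightarrow> \<phi> x = 0" "\<And>n. Ck n \<phi>"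
    using C0_infinityD[OF assms(3)] by metis
  show "integrable (lebesgue_on \<Omega>) (\<lambda>x. f x * \<phi> x)"
    using integrable_locally_integrable_mult[OF assms(1,2) Ck_continuous[OF K(4)] K(1-3)]
    by (simp add: mult.commute)
  assume b: "b \<in> Basis"
  have cont: "continuous_on UNIV (partial_deriv \<phi> b)"
    using Ck_continuous[OF Ck_partial_deriv] K(4) b by blast
  have "partial_deriv \<phi> b x = 0" if "x \<notin> K" for x
    using partial_deriv_eq_0[OF compact_imp_closed[OF K(1)], of \<phi>] K(3) that by blast
  from integrable_locally_integrable_mult[OF assms(1,2) cont K(1,2) this]
  show "integrable (lebesgue_on \<Omega>) (\<lambda>x. f x * partial_deriv \<phi> b x)"
    by (simp add: mult.commute)
qed

lemma locally_integrable_inner: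
  assumes "locally_integrable \<Omega> g"
  shows "locally_integrable \<Omega> (\<lambda>x. g x \<bullet> b)"
  unfolding locally_integrable_def set_integrable_def
proof (intro allI impI)
  fix K assume K: "compact K \<and> K \<subseteq> \<Omega>"
  have "integrable lebesgue (\<lambda>x. (indicator K x *\<^sub>R g x) \<bullet> b)"
    using assms K unfolding locally_integrable_def set_integrable_def
    by (intro integrable_inner_left) blast
  then show "integrable lebesgue (\<lambda>x. indicator K x *\<^sub>R (g x \<bullet> b))" by simp
qed

lemma locally_integrable_diff:
  "locally_integrable \<Omega> f \<Longrightarrow> locally_integrable \<Omega> g \<Longrightarrow> locally_integrable \<Omega> (\<lambda>x. f x - g x)"
  unfolding locally_integrable_def by (auto intro: set_integral_diff)

lemma has_weak_gradient_diff:
  assumes \<Omega>: "open \<Omega>" and u: "has_weak_gradient \<Omega> u g" "has_weak_gradient \<Omega> u' g'"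
  shows "has_weak_gradient \<Omega> (\<lambda>x. u x - u' x) (\<lambda>x. g x - g' x)"
proof -
  note l = u[unfolded has_weak_gradient_def]
  have "(\<integral>x. (u x - u' x) * partial_deriv \<phi> b x \<partial>lebesgue_on \<Omega>)
      = - (\<integral>x. ((g x - g' x) \<bullet> b) * \<phi> x \<partial>lebesgue_on \<Omega>)" if "\<phi> \<in> C0_infinity \<Omega>" "b \<in> Basis" for \<phi> b
  proof -
    note i = integrable_test_mult[OF \<Omega> _ that(1)] 
    have "(\<integral>x. (u x - u' x) * partial_deriv \<phi> b x \<partial>lebesgue_on \<Omega>)
        = (\<integral>x. u x * partial_deriv \<phi> b x \<partial>lebesgue_on \<Omega>) - (\<integral>x. u' x * partial_deriv \<phi> b x \<partial>lebesgue_on \<Omega>)"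
      using l i(2)[OF _ that(2)] by (simp add: left_diff_distrib)
    also have "\<dots> = - ((\<integral>x. (g x \<bullet> b) * \<phi> x \<partial>lebesgue_on \<Omega>) - (\<integral>x. (g' x \<bullet> b) * \<phi> x \<partial>lebesgue_on \<Omega>))"
      using l that by simp
    also have "\<dots> = - (\<integral>x. ((g x - g' x) \<bullet> b) * \<phi> x \<partial>lebesgue_on \<Omega>)"
    proof -
      have "integrable (lebesgue_on \<Omega>) (\<lambda>x. (g x \<bullet> b) * \<phi> x)"
        "integrable (lebesgue_on \<Omega>) (\<lambda>x. (g' x \<bullet> b) * \<phi> x)"
        using l by (auto intro!: i(1) locally_integrable_inner)
      from Bochner_Integration.integral_diff[OF this] show ?thesis
        by (simp add: inner_diff_left left_diff_distrib)
    qed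
    finally show ?thesis .
  qed
  then show ?thesis using l by (auto simp: has_weak_gradient_def intro: locally_integrable_diff)
qed

section \<open>Fundamental lemma of the calculus of variations and uniqueness of weak
  gradients\<close>

lemma compact_subset_open_cball:
  fixes K :: "'a::euclidean_space set"
  assumes "compact K" "open \<Omega>" "K \<subseteq> \<Omega>"
  obtains d where "d > 0" "\<And>x. x \<in> K \<Longrightarrow> cball x d \<subseteq> \<Omega>" "compact (\<Union>x\<in>K. cball x d)"
proof -
  obtain d where d: "d > 0" "(\<Union>x\<in>K. cball x d) \<subseteq> \<Omega>"
    using compact_subset_open_imp_cball_epsilon_subset[OF assms] by blast
  have "(\<Union>x\<in>K. cball x d) = {x + y | x y. x \<in> K \<and> y \<in> cball 0 d}"
    by (force simp: dist_norm norm_minus_commute intro: exI[of _ "_ - _"])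
  then have "compact (\<Union>x\<in>K. cball x d)"
    using compact_sums[OF assms(1) compact_cball, of 0 d] by simp
  then show ?thesis using d by (intro that[of d]) auto
qed

lemma mollifier_sequence:
  assumes "r > 0"
  obtains C and \<rho> :: "nat \<Rightarrow> 'a::euclidean_space \<Rightarrow> real"
  where "C > 0" "\<And>n. mollifier (r / Suc n) (\<rho> n)" "\<And>n x. \<rho> n x * (r / Suc n) ^ DIM('a) \<le> C"
proof -
  obtain C where C: "C > 0"
    "\<And>\<epsilon>. \<epsilon> > 0 \<Longrightarrow> \<exists>\<rho>::'a \<Rightarrow> real. mollifier \<epsilon> \<rho> \<and> (\<forall>x. \<rho> x * \<epsilon> ^ DIM('a) \<le> C)"
    using mollifier_exists[where 'a = 'a] by metis
  have "\<forall>n. \<exists>\<rho>::'a \<Rightarrow> real. mollifier (r / Suc n) \<rho> \<and> (\<forall>x. \<rho> x * (r / Suc n) ^ DIM('a) \<le> C)"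
    using assms by (intro allI C(2)) simp
  then obtain \<rho> :: "nat \<Rightarrow> 'a \<Rightarrow> real"
    where "\<forall>n. mollifier (r / Suc n) (\<rho> n) \<and> (\<forall>x. \<rho> n x * (r / Suc n) ^ DIM('a) \<le> C)"
    by metis
  then show ?thesis using C(1) by (intro that[of C \<rho>]) auto
qed

lemma LIMSEQ_divide_Suc: "(\<lambda>n. r / real (Suc n)) \<longlonglongrightarrow> 0"
  using tendsto_mult_right_zero[OF LIMSEQ_inverse_real_of_nat, of r] by (simp only: divide_inverse)

text \<open>Testing with reflected mollifiers shows that every sufficiently fine mollification of a
  representative \<open>g\<close> vanishes on \<open>K\<close>. Since these mollifications converge
  to \<open>g\<close> in \<open>L^1\<close>, the integral of \<open>\<bar>g\<bar>\<close> over
  \<open>K\<close> is below a null sequence.\<close>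

lemma fundamental_lemma_compact:
  fixes h :: "'a::euclidean_space \<Rightarrow> real"
  assumes \<Omega>: "open \<Omega>" and h: "locally_integrable \<Omega> h"
    and test: "\<And>\<phi>. \<phi> \<in> C0_infinity \<Omega> \<Longrightarrow> (\<integral>x. h x * \<phi> x \<partial>lebesgue_on \<Omega>) = 0"
    and K: "compact K" "K \<subseteq> \<Omega>"
  shows "AE x in lborel. x \<in> K \<longrightarrow> h x = 0"
proof -
  obtain d where d: "d > 0" "\<And>x. x \<in> K \<Longrightarrow> cball x d \<subseteq> \<Omega>" and K': "compact (\<Union>x\<in>K. cball x d)"
    using compact_subset_open_cball[OF K(1) \<Omega> K(2)] by metis
  let ?K' = "\<Union>x\<in>K. cball x d"
  have K'\<Omega>: "?K' \<subseteq> \<Omega>" using d by auto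
  have [measurable]: "K \<in> sets borel" "?K' \<in> sets borel" "\<Omega> \<in> sets borel"
    using K K' \<Omega> by (auto intro: borel_compact)
  obtain g where [measurable]: "g \<in> borel_measurable borel" and g: "integrable lborel g"
      "\<And>x. x \<notin> ?K' \<Longrightarrow> g x = 0" "AE x in lborel. x \<in> ?K' \<longrightarrow> g x = h x"
    using set_integrable_ex_borel[of ?K' h] h K' K'\<Omega> by (auto simp: locally_integrable_def)
  obtain C and \<rho> :: "nat \<Rightarrow> 'a \<Rightarrow> real" where \<rho>: "\<And>n. mollifier (d / Suc n) (\<rho> n)"
    using mollifier_sequence[OF d(1), where 'a = 'a] by metis
  have zero: "mollify (\<rho> n) g x = 0" if "x \<in> K" for x n
  proof -
    have "cball x (d / Suc n) \<subseteq> cball x d"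
      using d(1) by (intro subset_cball) (simp add: field_simps)
    then have in\<Omega>: "cball x (d / Suc n) \<subseteq> \<Omega>" "cball x (d / Suc n) \<subseteq> ?K'" using d(2) that by auto
    note [measurable] = mollifierD(6)[OF \<rho>]
    have off: "\<rho> n (x - y) = 0" if "y \<notin> cball x (d / Suc n)" for y
      using mollifierD(5)[OF \<rho>, of n "x - y"] that by (auto simp: dist_norm)
    have "mollify (\<rho> n) g x = (\<integral>y. \<rho> n (x - y) * g y \<partial>lebesgue_on \<Omega>)"
      unfolding mollify_def real_scaleR_def
    proof (rule integral_lebesgue_on_lborel[symmetric])
      fix y assume "y \<notin> \<Omega>"
      then have "y \<notin> cball x (d / Suc n)" using in\<Omega>(1) by blast
      then show "\<rho> n (x - y) * g y = 0" using off by simp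
    next
      show "(\<lambda>y. \<rho> n (x - y) * g y) \<in> borel_measurable borel" by measurable
    qed (rule borel_open[OF \<Omega>])
    also have "\<dots> = (\<integral>y. h y * \<rho> n (x - y) \<partial>lebesgue_on \<Omega>)"
    proof (rule integral_cong_AE)
      have "AE y in lborel. \<rho> n (x - y) * g y = h y * \<rho> n (x - y)"
        using g(3)
      proof eventually_elim
        case (elim y)
        show ?case
        proof (cases "y \<in> cball x (d / Suc n)")
          case True
          then have "y \<in> ?K'" using in\<Omega>(2) by blast
          with elim show ?thesis by simp
        qed (use off in simp)
      qed
      then show "AE y in lebesgue_on \<Omega>. \<rho> n (x - y) * g y = h y * \<rho> n (x - y)"
        by (rule AE_lebesgue_onI) (rule borel_open[OF \<Omega>])
      show "(\<lambda>y. h y * \<rho> n (x - y)) \<in> borel_measurable (lebesgue_on \<Omega>)"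
        using integrable_test_mult(1)[OF \<Omega> h mollifier_reflect_C0_infinity[OF \<rho> in\<Omega>(1)]]
        by (rule borel_measurable_integrable)
      show "(\<lambda>y. \<rho> n (x - y) * g y) \<in> borel_measurable (lebesgue_on \<Omega>)"
        by (rule borel_measurable_lebesgue_onI) measurable
    qed
    also have "\<dots> = 0" by (rule test[OF mollifier_reflect_C0_infinity[OF \<rho> in\<Omega>(1)]])
    finally show ?thesis .
  qed
  have int: "integrable lborel (\<lambda>x. indicator K x * \<bar>g x\<bar>)"
    using g(1) by (rule Bochner_Integration.integrable_bound) (auto simp: indicator_def)
  have "(\<integral>x. indicator K x * \<bar>g x\<bar> \<partial>lborel) \<le> (\<integral>x. norm (mollify (\<rho> n) g x - g x) \<partial>lborel)" for n
    using zero g(1) int by (intro integral_mono)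
      (auto simp: indicator_def intro!: integrable_mollify[OF \<rho>])
  then have "(\<integral>x. indicator K x * \<bar>g x\<bar> \<partial>lborel) \<le> 0"
    using LIMSEQ_le_const[OF mollify_tendsto_L1[OF \<rho> LIMSEQ_divide_Suc g(1)]] by blast
  then have "(\<integral>x. indicator K x * \<bar>g x\<bar> \<partial>lborel) = 0"
    by (intro antisym integral_nonneg_AE) auto
  then have "AE x in lborel. indicator K x * \<bar>g x\<bar> = 0"
    using integral_nonneg_eq_0_iff_AE[OF int] by auto
  with g(3) show ?thesis
  proof eventually_elim
    case (elim x)
    show ?case
    proof
      assume "x \<in> K"
      moreover have "x \<in> ?K'" using \<open>x \<in> K\<close> d(1) by force
      ultimately show "h x = 0" using elim by auto
    qed
  qed
qed

text \<open>An open set is a union of countably many compact boxes, so the exceptional sets of the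
  compact case add up to a null set.\<close>

lemma fundamental_lemma_calculus_of_variations:
  fixes h :: "'a::euclidean_space \<Rightarrow> real"
  assumes \<Omega>: "open \<Omega>" and h: "locally_integrable \<Omega> h"
    and test: "\<And>\<phi>. \<phi> \<in> C0_infinity \<Omega> \<Longrightarrow> (\<integral>x. h x * \<phi> x \<partial>lebesgue_on \<Omega>) = 0"
  shows "AE x in lebesgue_on \<Omega>. h x = 0"
proof -
  obtain D where D: "countable D" "D \<subseteq> Pow \<Omega>" "\<And>X. X \<in> D \<Longrightarrow> \<exists>a b. X = cbox a b" "\<Union>D = \<Omega>"
    using open_countable_Union_open_cbox[OF \<Omega>] by metis
  have "AE x in lborel. x \<in> X \<longrightarrow> h x = 0" if "X \<in> D" for X
  proof (rule fundamental_lemma_compact[OF \<Omega> h test])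
    show "compact X" using D(3)[OF that] compact_cbox by metis
    show "X \<subseteq> \<Omega>" using that D(2) by blast
  qed
  then have "AE x in lborel. \<forall>X\<in>D. x \<in> X \<longrightarrow> h x = 0"
    unfolding AE_ball_countable[OF D(1)] by blast
  then show ?thesis
    using \<Omega> by (subst AE_lebesgue_on_iff) (auto elim!: eventually_mono simp: D(4)[symmetric])
qed

text \<open>The fundamental lemma is applied to each coordinate of \<open>g x - g' x\<close>, the
  weak gradient of a function that vanishes almost everywhere. This is what makes the choice in
  \<open>weak_gradient\<close> harmless: it agrees almost everywhere with any explicit
  gradient.\<close>

lemma weak_gradient_unique:
  assumes \<Omega>: "open \<Omega>" and u: "has_weak_gradient \<Omega> u g" "has_weak_gradient \<Omega> u' g'"
    and eq: "AE x in lebesgue_on \<Omega>. u x = u' x"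
  shows "AE x in lebesgue_on \<Omega>. g x = g' x"
proof -
  note d = has_weak_gradient_diff[OF \<Omega> u, unfolded has_weak_gradient_def]
  have "AE x in lebesgue_on \<Omega>. (g x - g' x) \<bullet> b = 0" if b: "b \<in> Basis" for b
  proof (rule fundamental_lemma_calculus_of_variations[OF \<Omega>])
    show "locally_integrable \<Omega> (\<lambda>x. (g x - g' x) \<bullet> b)"
      using d by (intro locally_integrable_inner) auto
    fix \<phi> assume \<phi>: "\<phi> \<in> C0_infinity \<Omega>"
    have "(\<integral>x. ((g x - g' x) \<bullet> b) * \<phi> x \<partial>lebesgue_on \<Omega>)
        = - (\<integral>x. (u x - u' x) * partial_deriv \<phi> b x \<partial>lebesgue_on \<Omega>)"
      using d \<phi> b by simp
    also have "(\<integral>x. (u x - u' x) * partial_deriv \<phi> b x \<partial>lebesgue_on \<Omega>) = 0"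
      using eq by (intro integral_eq_zero_AE) (auto elim!: eventually_mono)
    finally show "(\<integral>x. ((g x - g' x) \<bullet> b) * \<phi> x \<partial>lebesgue_on \<Omega>) = 0" by simp
  qed
  then have "AE x in lebesgue_on \<Omega>. \<forall>b\<in>Basis. (g x - g' x) \<bullet> b = 0"
    by (subst AE_ball_countable) (auto simp: countable_finite)
  then show ?thesis
    by eventually_elim (metis euclidean_all_zero_iff eq_iff_diff_eq_0)
qed

lemma has_weak_gradient_weak_gradient:
  "has_weak_gradient \<Omega> u g \<Longrightarrow> has_weak_gradient \<Omega> u (weak_gradient \<Omega> u)"
  unfolding weak_gradient_def by (rule someI[where P = "has_weak_gradient \<Omega> u"])

lemma weak_gradient_AE_eq:
  assumes "open \<Omega>" "has_weak_gradient \<Omega> u g"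
  shows "AE x in lebesgue_on \<Omega>. weak_gradient \<Omega> u x = g x"
  using weak_gradient_unique[OF assms(1) has_weak_gradient_weak_gradient assms(2)] assms(2) by blast

lemma has_weak_gradient_0: "has_weak_gradient \<Omega> (\<lambda>x. 0) (\<lambda>x. 0)"
  by (simp add: has_weak_gradient_def locally_integrable_def set_integrable_def)

lemma has_weak_gradient_subset:
  assumes \<Omega>: "open \<Omega>" "open \<Omega>'" "\<Omega>' \<subseteq> \<Omega>" and u: "has_weak_gradient \<Omega> u g"
  shows "has_weak_gradient \<Omega>' u g"
proof -
  have eq: "(\<integral>x. f x * \<psi> x \<partial>lebesgue_on \<Omega>') = (\<integral>x. f x * \<psi> x \<partial>lebesgue_on \<Omega>)"
    if "\<And>x. x \<notin> \<Omega>' \<Longrightarrow> \<psi> x = 0" for f \<psi> :: "'a \<Rightarrow> real"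
    using \<Omega> that by (subst (1 2) integral_restrict_space) (auto intro!: Bochner_Integration.integral_cong simp: indicator_def)
  have "(\<integral>x. u x * partial_deriv \<phi> b x \<partial>lebesgue_on \<Omega>') = - (\<integral>x. (g x \<bullet> b) * \<phi> x \<partial>lebesgue_on \<Omega>')"
    if \<phi>: "\<phi> \<in> C0_infinity \<Omega>'" and b: "b \<in> Basis" for \<phi> b
  proof -
    obtain K where K: "compact K" "K \<subseteq> \<Omega>'" "\<And>x. x \<notin> K \<Longrightarrow> \<phi> x = 0"
      using C0_infinityD[OF \<phi>] by metis
    have "\<phi> \<in> C0_infinity \<Omega>" using \<phi> C0_infinity_mono[OF \<Omega>(3)] by blast
    moreover have "partial_deriv \<phi> b x = 0" if "x \<notin> \<Omega>'" for x
    proof -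
      have "x \<notin> K" using K(2) that by blast
      then show ?thesis
        using partial_deriv_eq_0[OF compact_imp_closed[OF K(1)], of \<phi>] K(3) by blast
    qed
    ultimately show ?thesis
      using u b K(2,3) by (subst (1 2) eq) (auto simp: has_weak_gradient_def)
  qed
  then show ?thesis
    using u \<Omega>(3) unfolding has_weak_gradient_def locally_integrable_def by (meson order_trans)
qed

text \<open>On the open set \<open>\<Omega> - K\<close> the function agrees almost everywhere with
  0, so uniqueness can be applied there against the zero gradient.\<close>

lemma weak_gradient_eq_0_outside:
  assumes \<Omega>: "open \<Omega>" and K: "compact K" and u: "has_weak_gradient \<Omega> u g"
    and 0: "AE x in lebesgue_on \<Omega>. x \<notin> K \<longrightarrow> u x = 0"
  shows "AE x in lebesgue_on \<Omega>. x \<notin> K \<longrightarrow> g x = 0"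
proof -
  have o: "open (\<Omega> - K)" using \<Omega> K by (intro open_Diff compact_imp_closed)
  then have [measurable]: "\<Omega> \<in> sets borel" "\<Omega> - K \<in> sets borel" using \<Omega> by auto
  have "AE x in lebesgue_on (\<Omega> - K). g x = 0"
  proof (rule weak_gradient_unique[OF o _ has_weak_gradient_0])
    show "has_weak_gradient (\<Omega> - K) u g"
      by (rule has_weak_gradient_subset[OF \<Omega> o _ u]) auto
    show "AE x in lebesgue_on (\<Omega> - K). u x = 0"
      using 0 by (simp add: AE_lebesgue_on_iff) (auto elim!: eventually_mono)
  qed
  then show ?thesis by (simp add: AE_lebesgue_on_iff) (auto elim!: eventually_mono)
qed

text \<open>By translation invariance the increment \<open>f (x + t *\<^sub>R b) - f x\<close> has
  integral 0, so up to sign \<open>t\<close> times the integral in question is the integral of the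
  first order remainder. That remainder is uniformly small relative to \<open>t\<close> and lives on
  a fixed ball.\<close>

lemma integral_partial_deriv_eq_0:
  fixes f :: "'a::euclidean_space \<Rightarrow> real"
  assumes f: "\<forall>n. Ck n f" "cutoff_kernel R f" and b: "b \<in> Basis"
  shows "(\<integral>x. partial_deriv f b x \<partial>lborel) = 0"
proof (rule ccontr)
  let ?I = "\<integral>x. partial_deriv f b x \<partial>lborel" and ?B = "cball (0::'a) (R + 1)"
  assume "?I \<noteq> 0"
  \<comment> \<open>With tolerance \<open>\<bar>?I\<bar> / (2 * M)\<close> the remainder integrates
    over \<open>?B\<close> to less than \<open>t * \<bar>?I\<bar>\<close>, a contradiction. Radius
    \<open>R + 1\<close> suffices for \<open>?B\<close> because \<open>t < 1\<close>.\<close>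
  define M where "M = real DIM('a) * measure lborel ?B + 1"
  have "M > 0" by (auto simp: M_def intro!: add_nonneg_pos)
  then have "\<bar>?I\<bar> / (2 * M) > 0" using \<open>?I \<noteq> 0\<close> by simp
  then obtain d where d: "d > 0" "\<And>x h. norm h < d \<Longrightarrow>
      \<bar>f (x + h) - f x - (\<Sum>b\<in>Basis. (h \<bullet> b) * partial_deriv f b x)\<bar>
        \<le> real DIM('a) * (\<bar>?I\<bar> / (2 * M)) * norm h"
    by (rule cutoff_kernel_first_order[OF f]) blast
  define t where "t = min d 1 / 2"
  have t: "0 < t" "t < d" "t < 1" using d(1) by (auto simp: t_def)
  note kb = cutoff_kernel_partial_deriv[OF f b]
  note fm = cutoff_kernel_measurable[OF f(2)]
  define g where "g x = f (x + t *\<^sub>R b) - f x - t * partial_deriv f b x" for x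
  have ft: "integrable lborel (\<lambda>x. f (x + t *\<^sub>R b))" "(\<integral>x. f (x + t *\<^sub>R b) \<partial>lborel) = (\<integral>x. f x \<partial>lborel)"
    using cutoff_kernel_integrable[OF f(2)] integrable_lborel_translate[OF fm] integral_lborel_translate[OF fm]
    by auto
  have gint: "integrable lborel g"
    unfolding g_def using ft(1) cutoff_kernel_integrable[OF f(2)] cutoff_kernel_integrable[OF kb]
    by (intro Bochner_Integration.integrable_diff integrable_mult_right)
  have "(\<integral>x. g x \<partial>lborel) = - (t * ?I)"
    unfolding g_def using ft cutoff_kernel_integrable[OF f(2)] cutoff_kernel_integrable[OF kb] by simp
  then have "t * \<bar>?I\<bar> = norm (\<integral>x. g x \<partial>lborel)"
    using t by (simp add: abs_mult)
  also have "\<dots> \<le> (\<integral>x. (real DIM('a) * (\<bar>?I\<bar> / (2 * M)) * t) * indicator ?B x \<partial>lborel)"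
  proof (rule Bochner_Integration.integral_norm_bound_integral[OF gint])
    show "integrable lborel (\<lambda>x. (real DIM('a) * (\<bar>?I\<bar> / (2 * M)) * t) * indicator ?B x)"
      by (intro integrable_mult_right integrable_real_indicator emeasure_bounded_finite bounded_cball) simp
    fix x
    show "norm (g x) \<le> (real DIM('a) * (\<bar>?I\<bar> / (2 * M)) * t) * indicator ?B x"
    proof (cases "x \<in> ?B")
      case True
      have "(\<Sum>c\<in>Basis. ((t *\<^sub>R b) \<bullet> c) * partial_deriv f c x) = t * partial_deriv f b x"
      proof -
        have "(\<Sum>c\<in>Basis. ((t *\<^sub>R b) \<bullet> c) * partial_deriv f c x)
            = (\<Sum>c\<in>Basis. if c = b then t * partial_deriv f b x else 0)"
          by (rule sum.cong[OF refl]) (simp add: inner_Basis b)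
        then show ?thesis using b by simp
      qed
      then show ?thesis
        using d(2)[of "t *\<^sub>R b" x] t b True by (simp add: g_def)
    next
      case False
      have "norm (x + t *\<^sub>R b) \<ge> norm x - norm (t *\<^sub>R b)" by (rule norm_diff_ineq)
      then have "R < norm (x + t *\<^sub>R b)" "R < norm x" using False t b by auto
      then have "g x = 0" using f(2) kb by (simp add: g_def cutoff_kernel_def)
      then show ?thesis using False by simp
    qed
  qed
  also have "\<dots> = (real DIM('a) * (\<bar>?I\<bar> / (2 * M)) * t) * measure lborel ?B"
    by (subst integral_mult_right_zero) simp
  also have "\<dots> = t * (\<bar>?I\<bar> * (real DIM('a) * measure lborel ?B / (2 * M)))"
    by (simp only: times_divide_eq_left times_divide_eq_right mult_ac)
  finally have "\<bar>?I\<bar> \<le> \<bar>?I\<bar> * (real DIM('a) * measure lborel ?B / (2 * M))"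
    by (rule mult_left_le_imp_le[OF _ t(1)])
  also have "\<dots> < \<bar>?I\<bar> * 1"
    using \<open>?I \<noteq> 0\<close> \<open>M > 0\<close> by (intro mult_strict_left_mono) (auto simp: M_def field_simps)
  finally show False by simp
qed

lemma locally_integrable_continuous:
  fixes f :: "'a::euclidean_space \<Rightarrow> 'b::euclidean_space"
  assumes "continuous_on UNIV f"
  shows "locally_integrable \<Omega> f"
  unfolding locally_integrable_def set_integrable_def
proof (intro allI impI)
  fix K assume "compact K \<and> K \<subseteq> \<Omega>"
  then have "integrable lborel (\<lambda>x. indicator K x *\<^sub>R f x)"
    using continuous_on_subset[OF assms] by (intro borel_integrable_compact) auto
  then show "integrable lebesgue (\<lambda>x. indicator K x *\<^sub>R f x)"
    using integrable_completion[OF borel_measurable_integrable] by blast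
qed

definition gradient :: "('a::euclidean_space \<Rightarrow> real) \<Rightarrow> 'a \<Rightarrow> 'a" where
  "gradient \<phi> x = (\<Sum>b\<in>Basis. partial_deriv \<phi> b x *\<^sub>R b)"

lemma gradient_inner: "b \<in> Basis \<Longrightarrow> gradient \<phi> x \<bullet> b = partial_deriv \<phi> b x"
  by (simp add: gradient_def)

text \<open>Integration by parts: the product of the two test functions is smooth with bounded
  support, so each of its partial derivatives integrates to 0, and the product rule splits that
  integral.\<close>

lemma has_weak_gradient_gradient:
  assumes \<Omega>: "open \<Omega>" and \<phi>: "\<phi> \<in> C0_infinity \<Omega>"
  shows "has_weak_gradient \<Omega> \<phi> (gradient \<phi>)"
  unfolding has_weak_gradient_def
proof (intro conjI ballI)
  have Ck: "Ck n \<phi>" for n using C0_infinityD[OF \<phi>] by metis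
  obtain R where R: "cutoff_kernel R \<phi>" using C0_infinity_cutoff_kernel[OF \<phi>] by metis
  obtain K where K: "K \<subseteq> \<Omega>" "\<And>x. x \<notin> K \<Longrightarrow> \<phi> x = 0" "compact K" using C0_infinityD[OF \<phi>] by metis
  show "locally_integrable \<Omega> \<phi>" by (rule locally_integrable_continuous[OF Ck_continuous[OF Ck]])
  have "continuous_on UNIV (partial_deriv \<phi> b)" if "b \<in> Basis" for b
    using Ck_continuous[OF Ck_partial_deriv[OF _ that]] Ck by blast
  then show "locally_integrable \<Omega> (gradient \<phi>)"
    unfolding gradient_def[abs_def] by (intro locally_integrable_continuous continuous_intros)
  fix \<psi> b assume \<psi>: "\<psi> \<in> C0_infinity \<Omega>" and b: "(b::'a) \<in> Basis"
  have Ck': "Ck n \<psi>" for n using C0_infinityD[OF \<psi>] by metis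
  have pdk: "cutoff_kernel R (partial_deriv \<phi> b)"
    using cutoff_kernel_partial_deriv[OF _ R b] Ck by blast
  have cont: "continuous_on UNIV \<psi>" "continuous_on UNIV (partial_deriv \<psi> b)"
    using Ck_continuous[OF Ck'] Ck_continuous[OF Ck_partial_deriv[OF _ b]] Ck' by blast+
  have k: "cutoff_kernel R (\<lambda>x. \<phi> x * \<psi> x)" "cutoff_kernel R (\<lambda>x. \<phi> x * partial_deriv \<psi> b x)"
    "cutoff_kernel R (\<lambda>x. partial_deriv \<phi> b x * \<psi> x)"
    using R cont pdk unfolding cutoff_kernel_def by (auto intro!: continuous_on_mult)
  have d: "((\<lambda>x. \<phi> x * \<psi> x) has_derivative
      (\<lambda>h. \<phi> x * frechet_derivative \<psi> (at x) h + frechet_derivative \<phi> (at x) h * \<psi> x)) (at x)" for x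
    by (intro has_derivative_mult Ck_Suc_has_derivative[OF Ck] Ck_Suc_has_derivative[OF Ck'])
  have pd: "partial_deriv (\<lambda>x. \<phi> x * \<psi> x) b x = \<phi> x * partial_deriv \<psi> b x + partial_deriv \<phi> b x * \<psi> x" for x
    using fun_cong[OF frechet_derivative_at[OF d], of x b] by simp
  have "(\<integral>x. \<phi> x * partial_deriv \<psi> b x + partial_deriv \<phi> b x * \<psi> x \<partial>lborel) = 0"
    using integral_partial_deriv_eq_0[OF _ k(1) b] Ck_mult[OF Ck Ck'] unfolding pd by blast
  then have eq: "(\<integral>x. \<phi> x * partial_deriv \<psi> b x \<partial>lborel) = - (\<integral>x. partial_deriv \<phi> b x * \<psi> x \<partial>lborel)"
    using cutoff_kernel_integrable[OF k(2)] cutoff_kernel_integrable[OF k(3)] by simp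
  have pd0: "partial_deriv \<phi> b x = 0" if "x \<notin> K" for x
    using partial_deriv_eq_0[OF compact_imp_closed[OF K(3)], of \<phi>] K(2) that by blast
  have "(\<integral>x. \<phi> x * partial_deriv \<psi> b x \<partial>lebesgue_on \<Omega>) = (\<integral>x. \<phi> x * partial_deriv \<psi> b x \<partial>lborel)"
    using \<Omega> K cutoff_kernel_measurable[OF k(2)] by (intro integral_lebesgue_on_lborel) auto
  moreover have "(\<integral>x. partial_deriv \<phi> b x * \<psi> x \<partial>lebesgue_on \<Omega>) = (\<integral>x. partial_deriv \<phi> b x * \<psi> x \<partial>lborel)"
    using \<Omega> K pd0 cutoff_kernel_measurable[OF k(3)] by (intro integral_lebesgue_on_lborel) auto
  ultimately show "(\<integral>x. \<phi> x * partial_deriv \<psi> b x \<partial>lebesgue_on \<Omega>)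
      = - (\<integral>x. (gradient \<phi> x \<bullet> b) * \<psi> x \<partial>lebesgue_on \<Omega>)"
    using eq b by (simp add: gradient_inner)
qed

text \<open>If the \<epsilon>-ball about \<open>x\<close> lies in \<Omega>, the reflected kernel is
  a test function and the definition of the weak gradient applies. Otherwise the margin
  \<open>2 * \<epsilon>\<close> around \<open>K\<close> puts \<open>K\<close> out of reach of the
  kernel, and both sides are 0.\<close>

lemma partial_deriv_mollify_weak:
  fixes u v :: "'a::euclidean_space \<Rightarrow> real"
  assumes \<Omega>: "open \<Omega>" and u: "has_weak_gradient \<Omega> u G" and \<rho>: "mollifier \<epsilon> \<rho>" and b: "b \<in> Basis"
    and v: "integrable lborel v" "\<And>x. x \<notin> K \<Longrightarrow> v x = 0" "AE x in lebesgue_on \<Omega>. v x = u x"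
    and g: "integrable lborel g" "\<And>x. x \<notin> K \<Longrightarrow> g x = 0" "AE x in lebesgue_on \<Omega>. g x = G x"
    and K: "\<And>x. x \<in> K \<Longrightarrow> cball x (2 * \<epsilon>) \<subseteq> \<Omega>"
  shows "partial_deriv (mollify \<rho> v) b x = mollify \<rho> (\<lambda>y. g y \<bullet> b) x"
proof -
  note k = mollifierD(1)[OF \<rho>]
  have Ck: "\<forall>n. Ck n \<rho>" using mollifierD(2)[OF \<rho>] by blast
  note kb = cutoff_kernel_partial_deriv[OF Ck k b]
  note [measurable] = borel_measurable_integrable[OF v(1), simplified]
    borel_measurable_integrable[OF g(1), simplified]
    cutoff_kernel_measurable[OF k] cutoff_kernel_measurable[OF kb]
  have eq: "partial_deriv (mollify \<rho> v) b x = mollify (partial_deriv \<rho> b) v x"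
    by (rule partial_deriv_mollify[OF Ck k v(1) b])
  show ?thesis
  proof (cases "cball x \<epsilon> \<subseteq> \<Omega>")
    case True
    note \<phi> = mollifier_reflect_C0_infinity[OF \<rho> True]
    have out: "\<rho> (x - y) = 0" "partial_deriv \<rho> b (x - y) = 0" if "y \<notin> \<Omega>" for y
    proof -
      have "\<epsilon> < norm (x - y)" using True that by (force simp: dist_norm)
      then show "\<rho> (x - y) = 0" "partial_deriv \<rho> b (x - y) = 0"
        using k kb by (auto simp: cutoff_kernel_def)
    qed
    \<comment> \<open>The sign produced by the reflection cancels the sign in the definition of the
      weak gradient.\<close>
    have pd: "partial_deriv (\<lambda>y. \<rho> (x - y)) b y = - partial_deriv \<rho> b (x - y)" for y
      using partial_deriv_reflect[of 0 \<rho>] Ck by blast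
    have "mollify (partial_deriv \<rho> b) v x = (\<integral>y. partial_deriv \<rho> b (x - y) * v y \<partial>lebesgue_on \<Omega>)"
      unfolding mollify_def real_scaleR_def
    proof (rule integral_lebesgue_on_lborel[symmetric])
      show "(\<lambda>y. partial_deriv \<rho> b (x - y) * v y) \<in> borel_measurable borel" by measurable
    qed (use \<Omega> out in auto)
    also have "\<dots> = (\<integral>y. - (u y * partial_deriv (\<lambda>y. \<rho> (x - y)) b y) \<partial>lebesgue_on \<Omega>)"
    proof (rule integral_cong_AE)
      show "AE y in lebesgue_on \<Omega>. partial_deriv \<rho> b (x - y) * v y = - (u y * partial_deriv (\<lambda>y. \<rho> (x - y)) b y)"
        using v(3) by eventually_elim (simp add: pd)
      show "(\<lambda>y. partial_deriv \<rho> b (x - y) * v y) \<in> borel_measurable (lebesgue_on \<Omega>)"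
        by (rule borel_measurable_lebesgue_onI) measurable
      show "(\<lambda>y. - (u y * partial_deriv (\<lambda>y. \<rho> (x - y)) b y)) \<in> borel_measurable (lebesgue_on \<Omega>)"
        using integrable_test_mult(2)[OF \<Omega> _ \<phi> b] u
        by (intro borel_measurable_uminus borel_measurable_integrable) (auto simp: has_weak_gradient_def)
    qed
    also have "\<dots> = (\<integral>y. (G y \<bullet> b) * \<rho> (x - y) \<partial>lebesgue_on \<Omega>)"
      using u \<phi> b by (simp add: has_weak_gradient_def)
    also have "\<dots> = (\<integral>y. \<rho> (x - y) * (g y \<bullet> b) \<partial>lebesgue_on \<Omega>)"
    proof (rule integral_cong_AE)
      show "AE y in lebesgue_on \<Omega>. (G y \<bullet> b) * \<rho> (x - y) = \<rho> (x - y) * (g y \<bullet> b)"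
        using g(3) by eventually_elim simp
      show "(\<lambda>y. \<rho> (x - y) * (g y \<bullet> b)) \<in> borel_measurable (lebesgue_on \<Omega>)"
        by (rule borel_measurable_lebesgue_onI) measurable
      show "(\<lambda>y. (G y \<bullet> b) * \<rho> (x - y)) \<in> borel_measurable (lebesgue_on \<Omega>)"
        using integrable_test_mult(1)[OF \<Omega> _ \<phi>] u locally_integrable_inner[of \<Omega> G b]
        by (intro borel_measurable_integrable) (auto simp: has_weak_gradient_def)
    qed
    also have "\<dots> = mollify \<rho> (\<lambda>y. g y \<bullet> b) x"
      unfolding mollify_def real_scaleR_def
    proof (rule integral_lebesgue_on_lborel)
      show "(\<lambda>y. \<rho> (x - y) * (g y \<bullet> b)) \<in> borel_measurable borel" by measurable
    qed (use \<Omega> out in auto)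
    finally show ?thesis using eq by simp
  next
    case False
    then obtain z where z: "dist x z \<le> \<epsilon>" "z \<notin> \<Omega>" unfolding subset_eq by auto
    have "y \<notin> K" if "dist x y \<le> \<epsilon>" for y
    proof
      assume "y \<in> K"
      have "dist y z \<le> 2 * \<epsilon>"
        using dist_triangle[of y z x] that z(1) by (simp add: dist_commute)
      then show False using K[OF \<open>y \<in> K\<close>] z(2) by auto
    qed
    then show ?thesis
      using eq v(2) g(2) by (simp add: mollify_eq_0[OF k] mollify_eq_0[OF kb])
  qed
qed

subsection \<open>Convexity estimates\<close>

text \<open>No convergence of the majorants almost everywhere is required: \<open>h n - \<bar>g' n - g\<bar>\<close> lies below \<open>\<bar>g\<bar>\<close>.\<close>

lemma generalized_dominated_convergence:
  fixes h g' :: "nat \<Rightarrow> 'a \<Rightarrow> real" and g :: "'a \<Rightarrow> real"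
  assumes g: "\<And>n. integrable M (g' n)" "integrable M g"
      "(\<lambda>n. \<integral>x. \<bar>g' n x - g x\<bar> \<partial>M) \<longlonglongrightarrow> 0"
    and h[measurable]: "\<And>n. h n \<in> borel_measurable M"
    and bound: "\<And>n. AE x in M. 0 \<le> h n x \<and> h n x \<le> g' n x"
    and lim: "AE x in M. (\<lambda>n. h n x) \<longlonglongrightarrow> 0"
  shows "integrable M (h n)" and "(\<lambda>n. \<integral>x. h n x \<partial>M) \<longlonglongrightarrow> 0"
proof -
  note [measurable] = borel_measurable_integrable[OF g(1)] borel_measurable_integrable[OF g(2)]
  show int: "integrable M (h n)" for n
  proof (rule Bochner_Integration.integrable_bound[OF g(1)[of n] h])
    show "AE x in M. norm (h n x) \<le> norm (g' n x)"
      using bound[of n] by eventually_elim auto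
  qed
  let ?k = "\<lambda>n x. max 0 (h n x - \<bar>g' n x - g x\<bar>)"
  have kb: "AE x in M. 0 \<le> ?k n x \<and> ?k n x \<le> \<bar>g x\<bar> \<and> ?k n x \<le> h n x" for n
    using bound[of n] by eventually_elim auto
  have all: "AE x in M. \<forall>n. 0 \<le> ?k n x \<and> ?k n x \<le> h n x"
    unfolding AE_all_countable
  proof
    show "AE x in M. 0 \<le> ?k n x \<and> ?k n x \<le> h n x" for n
      using kb[of n] by eventually_elim auto
  qed
  have kint: "integrable M (?k n)" for n
  proof (rule Bochner_Integration.integrable_bound[OF int[of n]])
    show "AE x in M. norm (?k n x) \<le> norm (h n x)"
      using kb[of n] by eventually_elim auto
  qed measurable
  have "(\<lambda>n. \<integral>x. ?k n x \<partial>M) \<longlonglongrightarrow> (\<integral>x. 0 \<partial>M)"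
  proof (rule Bochner_Integration.integral_dominated_convergence[where w = "\<lambda>x. \<bar>g x\<bar>"])
    show "AE x in M. (\<lambda>n. ?k n x) \<longlonglongrightarrow> 0"
      using all lim
    proof eventually_elim
      case (elim x)
      then show ?case by (intro tendsto_sandwich[OF _ _ tendsto_const elim(2)]) auto
    qed
    show "AE x in M. norm (?k n x) \<le> \<bar>g x\<bar>" for n
      using kb[of n] by eventually_elim auto
  qed (use g(2) in \<open>auto intro: integrable_abs\<close>)
  then have sum0: "(\<lambda>n. (\<integral>x. ?k n x \<partial>M) + (\<integral>x. \<bar>g' n x - g x\<bar> \<partial>M)) \<longlonglongrightarrow> 0"
    by (intro tendsto_add_zero g(3)) simp
  have upper: "(\<integral>x. h n x \<partial>M) \<le> (\<integral>x. ?k n x \<partial>M) + (\<integral>x. \<bar>g' n x - g x\<bar> \<partial>M)" for n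
  proof -
    have i: "integrable M (\<lambda>x. \<bar>g' n x - g x\<bar>)" using g by auto
    have "(\<integral>x. h n x \<partial>M) \<le> (\<integral>x. ?k n x + \<bar>g' n x - g x\<bar> \<partial>M)"
      using int kint i by (intro integral_mono) auto
    then show ?thesis using kint[of n] i by simp
  qed
  have lower: "0 \<le> (\<integral>x. h n x \<partial>M)" for n
  proof (rule integral_nonneg_AE)
    show "AE x in M. 0 \<le> h n x" using bound[of n] by eventually_elim auto
  qed
  show "(\<lambda>n. \<integral>x. h n x \<partial>M) \<longlonglongrightarrow> 0"
    by (rule tendsto_sandwich[OF always_eventually always_eventually tendsto_const sum0])
       (use lower upper in blast)+
qed

text \<open>Convexity and differentiability are used on the open half line; the endpoints
  \<open>s = 0\<close> and \<open>t = 0\<close> are computed directly.\<close>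

lemma powr_above_tangent:
  fixes r s t :: real
  assumes "1 < r" "0 \<le> s" "0 \<le> t"
  shows "s powr r + r * s powr (r - 1) * (t - s) \<le> t powr r"
proof -
  consider "s = 0" | "s > 0" "t = 0" | "s > 0" "t > 0" using assms by linarith
  then show ?thesis
  proof cases
    case 2
    then have "s powr (r - 1) * s = s powr r" by (simp add: powr_mult_base mult.commute)
    then have "s powr r + r * s powr (r - 1) * (t - s) = (1 - r) * s powr r"
      using 2 by (simp add: algebra_simps)
    also have "\<dots> \<le> 0" using assms by (intro mult_nonpos_nonneg) auto
    finally show ?thesis using 2 by simp
  next
    case 3
    have "t powr r - s powr r \<ge> (r * s powr (r - 1)) * (t - s)"
    proof (rule convex_on_imp_above_tangent[of "{0<..}"])
      show "convex_on {0<..} (\<lambda>x. x powr r)" using assms by (intro powr_convex) simp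
      show "((\<lambda>x. x powr r) has_field_derivative r * s powr (r - 1)) (at s within {0<..})"
        using 3 by (intro has_field_derivative_at_within[OF has_real_derivative_powr]) simp
    qed (use 3 in \<open>auto simp: interior_open\<close>)
    then show ?thesis by linarith
  qed (use assms in auto)
qed

lemma integral_mollifier_reflect:
  assumes \<rho>: "mollifier \<epsilon> \<rho>"
  shows "integrable lborel (\<lambda>y. \<rho> (x - y))" "(\<integral>y. \<rho> (x - y) \<partial>lborel) = 1"
proof -
  show 1: "(\<integral>y. \<rho> (x - y) \<partial>lborel) = 1"
    using integral_lborel_reflect[of \<rho> x] mollifierD(4,6)[OF \<rho>] by simp
  show "integrable lborel (\<lambda>y. \<rho> (x - y))"
    by (rule ccontr) (use 1 in \<open>simp add: not_integrable_integral_eq\<close>)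
qed

text \<open>Jensen's inequality with a frozen weight: \<open>m\<close> is a constant below the true
  weight on the support of the kernel, and \<open>W\<close> is the weighted power. With
  \<open>m = 1\<close> and \<open>W\<close> the power itself it is the usual inequality. The proof
  integrates the tangent at the mean \<open>s\<close> against the unit-mass kernel.\<close>

lemma mollify_jensen:
  fixes f W :: "'a::euclidean_space \<Rightarrow> real"
  assumes \<rho>: "mollifier \<epsilon> \<rho>" and r: "1 < r" and m: "0 \<le> m"
    and f: "integrable lborel f" "\<And>y. 0 \<le> f y" and W: "integrable lborel W"
    and le: "\<And>y. \<rho> (x - y) \<noteq> 0 \<Longrightarrow> m * f y powr r \<le> W y"
  shows "m * mollify \<rho> f x powr r \<le> mollify \<rho> W x"
proof -
  define s where "s = mollify \<rho> f x"
  have "0 \<le> s" unfolding s_def by (rule mollify_nonneg[OF \<rho> f(2)])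
  \<comment> \<open>Intercept and slope of the tangent to \<open>m * t powr r\<close> at
    \<open>t = s\<close>; at the mean the tangent reproduces \<open>m * s powr r\<close>.\<close>
  let ?A = "m * (s powr r - r * s powr (r - 1) * s)" and ?B = "m * (r * s powr (r - 1))"
  note k = mollifierD(1)[OF \<rho>]
  note i = integral_mollifier_reflect[OF \<rho>, of x]
  have s': "(\<integral>y. \<rho> (x - y) * f y \<partial>lborel) = s" by (simp add: s_def mollify_def)
  have if': "integrable lborel (\<lambda>y. \<rho> (x - y) * f y)" and iW: "integrable lborel (\<lambda>y. \<rho> (x - y) * W y)"
    using integrable_mollify_integrand[OF k f(1), of x] integrable_mollify_integrand[OF k W, of x] by simp_all
  have "m * s powr r = ?A * (\<integral>y. \<rho> (x - y) \<partial>lborel) + ?B * (\<integral>y. \<rho> (x - y) * f y \<partial>lborel)"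
    unfolding s' i(2) by (simp add: algebra_simps)
  also have "\<dots> = (\<integral>y. ?A * \<rho> (x - y) + ?B * (\<rho> (x - y) * f y) \<partial>lborel)"
    using i if' by simp
  also have "\<dots> \<le> (\<integral>y. \<rho> (x - y) * W y \<partial>lborel)"
  proof (rule integral_mono)
    show "integrable lborel (\<lambda>y. ?A * \<rho> (x - y) + ?B * (\<rho> (x - y) * f y))"
      using i if' by (intro Bochner_Integration.integrable_add integrable_mult_right)
    fix y
    show "?A * \<rho> (x - y) + ?B * (\<rho> (x - y) * f y) \<le> \<rho> (x - y) * W y"
    proof (cases "\<rho> (x - y) = 0")
      case False
      have "m * (s powr r + r * s powr (r - 1) * (f y - s)) \<le> m * f y powr r"
        using m powr_above_tangent[OF r \<open>0 \<le> s\<close> f(2)] by (intro mult_left_mono)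
      also have "\<dots> \<le> W y" by (rule le[OF False])
      finally have "\<rho> (x - y) * (m * (s powr r + r * s powr (r - 1) * (f y - s))) \<le> \<rho> (x - y) * W y"
        using mollifierD(3)[OF \<rho>] by (intro mult_left_mono)
      then show ?thesis by (simp add: algebra_simps)
    qed simp
  qed (rule iW)
  finally show ?thesis by (simp add: s_def mollify_def)
qed

lemma mollify_sup_le:
  fixes f :: "'a::euclidean_space \<Rightarrow> real"
  assumes \<rho>: "mollifier \<epsilon> \<rho>" and C: "\<And>x. \<rho> x \<le> C" and f: "integrable lborel f" "\<And>y. 0 \<le> f y"
  shows "mollify \<rho> f x \<le> C * (\<integral>y. f y \<partial>lborel)"
proof -
  have "mollify \<rho> f x \<le> (\<integral>y. C * f y \<partial>lborel)"
    unfolding mollify_def using integrable_mollify_integrand[OF mollifierD(1)[OF \<rho>] f(1), of x] f C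
    by (intro integral_mono) (auto intro: mult_right_mono)
  then show ?thesis by simp
qed

text \<open>The role of \<open>q / p \<le> 1 + \<alpha> / N\<close>: the loss \<open>\<epsilon> powr (- N (q / p - 1))\<close> in the sup bound for the
  mollified gradient is compensated by the gain \<open>\<epsilon> powr \<alpha>\<close> from the Hoelder continuity of the weight.\<close>

lemma hoelder_gain_bound:
  fixes \<epsilon> s S \<Lambda> :: real
  assumes pq: "1 < p" "0 < q" and N: "0 < N" and gap: "q / p \<le> 1 + \<alpha> / N" and "0 < \<alpha>"
    and \<epsilon>: "0 < \<epsilon>" "\<epsilon> \<le> 1" and s: "0 \<le> s" "s powr p \<le> S" and S: "S * \<epsilon> powr N \<le> \<Lambda>"
  shows "\<epsilon> powr \<alpha> * s powr q \<le> (1 + \<Lambda> powr (q / p - 1)) * (1 + S)"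
proof -
  have "0 \<le> s powr p" by simp
  then have "0 \<le> S" using s(2) by linarith
  have "\<epsilon> powr \<alpha> \<le> 1" using \<epsilon> \<open>0 < \<alpha>\<close> by (simp add: powr_le1)
  show ?thesis
  \<comment> \<open>For \<open>q \<le> p\<close> the \<open>q\<close>-th power is dominated by 1
    plus the \<open>p\<close>-th power, so \<open>\<epsilon> powr \<alpha> \<le> 1\<close> is
    enough; the gap condition enters in the other case.\<close>
  proof (cases "q \<le> p")
    case True
    have "s powr q \<le> 1 + S"
    proof (cases "s \<le> 1")
      case True
      then have "s powr q \<le> 1" using s pq by (simp add: powr_le1)
      then show ?thesis using \<open>0 \<le> S\<close> by linarith
    next
      case False
      then have "s powr q \<le> s powr p" using \<open>q \<le> p\<close> by (intro powr_mono) auto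
      then show ?thesis using s(2) by linarith
    qed
    then have "\<epsilon> powr \<alpha> * s powr q \<le> 1 * (1 + S)"
      using \<open>\<epsilon> powr \<alpha> \<le> 1\<close> by (intro mult_mono) auto
    also have "\<dots> \<le> (1 + \<Lambda> powr (q / p - 1)) * (1 + S)"
      using \<open>0 \<le> S\<close> by (intro mult_right_mono) auto
    finally show ?thesis .
  next
    case False
    define \<theta> where "\<theta> = q / p - 1"
    have \<theta>: "0 \<le> \<theta>" "N * \<theta> \<le> \<alpha>"
      using False pq gap N by (auto simp: \<theta>_def field_simps)
    have "s powr q = (s powr p) powr (q / p)" using pq by (simp add: powr_powr)
    also have "\<dots> \<le> S powr (1 + \<theta>)"
      unfolding \<theta>_def using s pq by (simp add: powr_mono2)
    also have "\<dots> = S * S powr \<theta>"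
      using \<open>0 \<le> S\<close> \<theta> by (cases "S = 0") (auto simp: powr_add)
    finally have 1: "s powr q \<le> S * S powr \<theta>" .
    have "\<epsilon> powr \<alpha> \<le> \<epsilon> powr (N * \<theta>)"
      using \<epsilon> \<theta> by (intro powr_mono') auto
    then have "\<epsilon> powr \<alpha> * s powr q \<le> \<epsilon> powr (N * \<theta>) * (S * S powr \<theta>)"
      using 1 by (intro mult_mono) auto
    \<comment> \<open>Only the excess factor \<open>S powr \<theta>\<close> is traded against
      \<open>\<epsilon> powr (N * \<theta>)\<close>. One factor \<open>S\<close> remains linear, and
      this is what keeps the final bound integrable.\<close>
    also have "\<dots> = S * (S * \<epsilon> powr N) powr \<theta>"
      using \<open>0 \<le> S\<close> \<epsilon> by (simp add: powr_mult powr_powr)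
    also have "\<dots> \<le> S * \<Lambda> powr \<theta>"
      using \<open>0 \<le> S\<close> S \<theta> by (intro mult_left_mono powr_mono2) auto
    also have "\<dots> \<le> (1 + S) * (1 + \<Lambda> powr \<theta>)"
      using \<open>0 \<le> S\<close> by (intro mult_mono) auto
    finally show ?thesis by (simp add: \<theta>_def mult.commute)
  qed
qed

text \<open>The weight at \<open>x\<close> is split into a part lying below \<open>a\<close> on the
  whole support of the kernel, which passes through Jensen, and a remainder
  \<open>c * \<epsilon> powr \<alpha>\<close>, which is absorbed by the gap condition.\<close>

lemma weight_mollify_bound:
  fixes a :: "'a::euclidean_space \<Rightarrow> real" and g :: "'a \<Rightarrow> 'a" and W :: "'a \<Rightarrow> real"
  assumes pq: "1 < p" "1 < q" and gap: "q / p \<le> 1 + \<alpha> / real DIM('a)" and "0 < \<alpha>"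
    and \<epsilon>: "0 < \<epsilon>" "\<epsilon> \<le> 1" and \<rho>: "mollifier \<epsilon> \<rho>" "\<And>x. \<rho> x * \<epsilon> ^ DIM('a) \<le> C" "0 \<le> C"
    and a: "\<And>x y. x \<in> \<Omega> \<Longrightarrow> y \<in> \<Omega> \<Longrightarrow> \<bar>a x - a y\<bar> \<le> c * dist x y powr \<alpha>" "\<And>x. x \<in> \<Omega> \<Longrightarrow> 0 \<le> a x" "0 \<le> c"
    and g: "integrable lborel g" "integrable lborel (\<lambda>y. norm (g y) powr p)" "\<And>x. x \<notin> \<Omega> \<Longrightarrow> g x = 0"
    and W: "integrable lborel W" "\<And>y. y \<in> \<Omega> \<Longrightarrow> W y = a y * norm (g y) powr q" "\<And>y. 0 \<le> W y"
    and x: "x \<in> \<Omega>"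
  shows "a x * norm (mollify \<rho> g x) powr q \<le> mollify \<rho> W x
    + c * (1 + (C * (\<integral>y. norm (g y) powr p \<partial>lborel)) powr (q / p - 1))
      * (1 + mollify \<rho> (\<lambda>y. norm (g y) powr p) x)"
proof -
  let ?P = "\<integral>y. norm (g y) powr p \<partial>lborel" and ?S = "mollify \<rho> (\<lambda>y. norm (g y) powr p) x"
  define s where "s = mollify \<rho> (\<lambda>y. norm (g y)) x"
  have s0: "0 \<le> s" unfolding s_def by (rule mollify_nonneg[OF \<rho>(1)]) simp
  \<comment> \<open>By Hoelder continuity this is a lower bound for \<open>a\<close> on the part of
    the kernel's support inside \<Omega>; truncation at 0 keeps it an admissible weight. Outside
    \<Omega>, where \<open>a\<close> is arbitrary, \<open>g\<close> vanishes.\<close>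
  define m where "m = max 0 (a x - c * \<epsilon> powr \<alpha>)"
  have gn: "integrable lborel (\<lambda>y. norm (g y))" using g(1) by simp
  have "1 * s powr p \<le> ?S"
    unfolding s_def by (rule mollify_jensen[OF \<rho>(1) pq(1) _ gn _ g(2)]) auto
  then have sp: "s powr p \<le> ?S" by simp
  have mq: "m * s powr q \<le> mollify \<rho> W x"
    unfolding s_def
  proof (rule mollify_jensen[OF \<rho>(1) pq(2) _ gn _ W(1)])
    show "0 \<le> m" by (simp add: m_def)
    fix y assume "\<rho> (x - y) \<noteq> 0"
    then have xy: "dist x y \<le> \<epsilon>" using mollifierD(5)[OF \<rho>(1)] by (simp add: dist_norm)
    show "m * norm (g y) powr q \<le> W y"
    proof (cases "y \<in> \<Omega>")
      case True
      have "c * dist x y powr \<alpha> \<le> c * \<epsilon> powr \<alpha>"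
        using xy a(3) \<open>0 < \<alpha>\<close> by (intro mult_left_mono powr_mono2) auto
      then have "m \<le> a y" using a(1)[OF x True] a(2)[OF True] by (auto simp: m_def)
      then show ?thesis using W(2)[OF True] by (simp add: mult_right_mono)
    qed (use g(3) W(3) in simp)
  qed simp
  have "norm (mollify \<rho> g x) \<le> s" unfolding s_def by (rule norm_mollify_le[OF \<rho>(1)])
  then have "a x * norm (mollify \<rho> g x) powr q \<le> a x * s powr q"
    using pq a(2)[OF x] by (intro mult_left_mono powr_mono2) auto
  also have "\<dots> \<le> (m + c * \<epsilon> powr \<alpha>) * s powr q"
    by (intro mult_right_mono) (auto simp: m_def)
  also have "\<dots> = m * s powr q + c * (\<epsilon> powr \<alpha> * s powr q)"
    by (simp add: algebra_simps)
  also have "\<dots> \<le> mollify \<rho> W x + c * ((1 + (C * ?P) powr (q / p - 1)) * (1 + ?S))"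
  proof (intro add_mono mq mult_left_mono a(3))
    show "\<epsilon> powr \<alpha> * s powr q \<le> (1 + (C * ?P) powr (q / p - 1)) * (1 + ?S)"
    proof (rule hoelder_gain_bound[OF pq(1) _ _ gap \<open>0 < \<alpha>\<close> \<epsilon> s0 sp])
      \<comment> \<open>Here the scaling of the kernel enters: its supremum is at most
        \<open>C / \<epsilon> ^ N\<close>, so an \<open>L^1\<close> quantity is bounded
        pointwise.\<close>
      have "?S \<le> (C / \<epsilon> ^ DIM('a)) * ?P"
        using g(2) \<rho> \<epsilon> by (intro mollify_sup_le[OF \<rho>(1)]) (auto simp: field_simps)
      then show "?S * \<epsilon> powr real DIM('a) \<le> C * ?P"
        using \<epsilon> by (simp add: powr_realpow field_simps)
    qed (use pq in auto)
  qed
  finally show ?thesis by (simp add: mult.assoc)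
qed

subsection \<open>Function spaces and compositions\<close>

text \<open>Rests on the completeness of Lebesgue measure; it transfers measurability from an
  explicit gradient to the chosen \<open>weak_gradient\<close>.\<close>

lemma borel_measurable_lebesgue_on_AE:
  fixes f g :: "'a::euclidean_space \<Rightarrow> 'b::euclidean_space"
  assumes f: "f \<in> borel_measurable (lebesgue_on S)" and S: "S \<in> sets borel"
    and eq: "AE x in lebesgue_on S. f x = g x"
  shows "g \<in> borel_measurable (lebesgue_on S)"
proof -
  have S': "S \<inter> space lebesgue \<in> sets lebesgue" using S by simp
  have "(\<lambda>x. indicator S x *\<^sub>R f x) \<in> borel_measurable lebesgue"
    using f borel_measurable_restrict_space_iff[OF S'] by blast
  moreover have "AE x in lebesgue. indicator S x *\<^sub>R f x = indicator S x *\<^sub>R g x"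
    using eq S by (auto simp: AE_restrict_space_iff indicator_def elim!: eventually_mono)
  ultimately have "(\<lambda>x. indicator S x *\<^sub>R g x) \<in> borel_measurable lebesgue"
    by (rule borel_measurable_AE)
  then show ?thesis using borel_measurable_restrict_space_iff[OF S'] by blast
qed

lemma integrable_lebesgue_on_AE:
  fixes f g :: "'a::euclidean_space \<Rightarrow> 'b::euclidean_space"
  assumes f: "integrable (lebesgue_on S) f" and S: "S \<in> sets borel"
    and eq: "AE x in lebesgue_on S. f x = g x"
  shows "integrable (lebesgue_on S) g"
  using f borel_measurable_lebesgue_on_AE[OF borel_measurable_integrable[OF f] S eq] eq
  by (rule Bochner_Integration.integrable_cong_AE_imp)

lemma integrable_lborel_lebesgue_on:
  fixes f :: "'a::euclidean_space \<Rightarrow> real"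
  assumes f: "integrable lborel f" and S: "S \<in> sets borel"
  shows "integrable (lebesgue_on S) f" "(\<integral>x. \<bar>f x\<bar> \<partial>lebesgue_on S) \<le> (\<integral>x. \<bar>f x\<bar> \<partial>lborel)"
proof -
  have [measurable]: "f \<in> borel_measurable borel" using borel_measurable_integrable[OF f] by simp
  have i: "integrable lborel (\<lambda>x. indicator S x *\<^sub>R f x)"
    using f S by (intro integrable_mult_indicator) auto
  have "integrable (lebesgue_on S) (\<lambda>x. indicator S x *\<^sub>R f x)"
    using i S by (subst integrable_lebesgue_on_lborel) auto
  then show "integrable (lebesgue_on S) f"
    by (rule Bochner_Integration.integrable_cong[THEN iffD1, rotated -1]) auto
  have "(\<integral>x. \<bar>f x\<bar> \<partial>lebesgue_on S) = (\<integral>x. \<bar>indicator S x *\<^sub>R f x\<bar> \<partial>lebesgue_on S)"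
    by (rule Bochner_Integration.integral_cong) auto
  also have "\<dots> = (\<integral>x. \<bar>indicator S x *\<^sub>R f x\<bar> \<partial>lborel)"
    using S by (intro integral_lebesgue_on_lborel) auto
  also have "\<dots> \<le> (\<integral>x. \<bar>f x\<bar> \<partial>lborel)"
    using i f by (intro integral_mono) (auto simp: indicator_def)
  finally show "(\<integral>x. \<bar>f x\<bar> \<partial>lebesgue_on S) \<le> (\<integral>x. \<bar>f x\<bar> \<partial>lborel)" .
qed

text \<open>For a simple function in place of \<open>(v, z)\<close> the composition is a finite sum
  of sections of \<open>F\<close> cut off to measurable sets. Continuity in the last two arguments
  then passes to the limit.\<close>

lemma caratheodory_measurable:
  fixes F :: "'a::euclidean_space \<Rightarrow> real \<Rightarrow> 'a \<Rightarrow> real"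
  assumes F: "caratheodory \<Omega> F" and \<Omega>: "\<Omega> \<in> sets borel"
    and v: "v \<in> borel_measurable (lebesgue_on \<Omega>)" and z: "z \<in> borel_measurable (lebesgue_on \<Omega>)"
  shows "(\<lambda>x. F x (v x) (z x)) \<in> borel_measurable (lebesgue_on \<Omega>)"
proof -
  let ?M = "lebesgue_on \<Omega>"
  have [measurable]: "(\<lambda>x. F x a b) \<in> borel_measurable ?M" for a b
    using F by (simp add: caratheodory_def)
  have "(\<lambda>x. (v x, z x)) \<in> borel_measurable ?M" using v z by (rule borel_measurable_Pair)
  then obtain s where s: "\<And>i. simple_function ?M (s i)"
      "\<And>x. x \<in> space ?M \<Longrightarrow> (\<lambda>i. s i x) \<longlonglongrightarrow> (v x, z x)"
    using borel_measurable_implies_sequence_metric[of "\<lambda>x. (v x, z x)" ?M 0] by metis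
  have m: "(\<lambda>x. F x (fst (s i x)) (snd (s i x))) \<in> borel_measurable ?M" for i
  proof -
    have "(\<lambda>x. \<Sum>c\<in>s i ` space ?M. indicator (s i -` {c} \<inter> space ?M) x * F x (fst c) (snd c)) \<in> borel_measurable ?M"
      using simple_functionD(2)[OF s(1)]
      by (intro borel_measurable_sum borel_measurable_times borel_measurable_indicator) auto
    moreover have "(\<Sum>c\<in>s i ` space ?M. indicator (s i -` {c} \<inter> space ?M) x * F x (fst c) (snd c))
        = F x (fst (s i x)) (snd (s i x))" if "x \<in> space ?M" for x
    proof -
      have "(\<Sum>c\<in>s i ` space ?M. indicator (s i -` {c} \<inter> space ?M) x * F x (fst c) (snd c))
          = (\<Sum>c\<in>s i ` space ?M. if c = s i x then F x (fst (s i x)) (snd (s i x)) else 0)"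
        using that by (intro sum.cong) (auto simp: indicator_def)
      also have "\<dots> = F x (fst (s i x)) (snd (s i x))"
        using that simple_functionD(1)[OF s(1)] by simp
      finally show ?thesis .
    qed
    ultimately show ?thesis by (subst measurable_cong) auto
  qed
  have "AE x in ?M. continuous_on UNIV (\<lambda>(v, z). F x v z)"
    using F by (simp add: caratheodory_def)
  then obtain N where N: "{x \<in> space ?M. \<not> continuous_on UNIV (\<lambda>(v, z). F x v z)} \<subseteq> N"
      "emeasure ?M N = 0" "N \<in> sets ?M"
    by (rule AE_E)
  \<comment> \<open>Continuity is given almost everywhere only, so the limit is taken with the value
    0 on the exceptional null set.\<close>
  let ?G = "\<lambda>x. if x \<in> N then 0 else F x (v x) (z x)"
  have "?G \<in> borel_measurable ?M"
  proof (rule borel_measurable_LIMSEQ_metric)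
    show "(\<lambda>x. if x \<in> N then 0 else F x (fst (s i x)) (snd (s i x))) \<in> borel_measurable ?M" for i
      using m N(3) by (intro measurable_If_set) auto
    fix x assume x: "x \<in> space ?M"
    show "(\<lambda>i. if x \<in> N then 0 else F x (fst (s i x)) (snd (s i x))) \<longlonglongrightarrow> ?G x"
    proof (cases "x \<in> N")
      case False
      then have "continuous_on UNIV (\<lambda>(v, z). F x v z)" using N(1) x by auto
      then have "isCont (\<lambda>(v, z). F x v z) (v x, z x)"
        by (simp add: continuous_on_eq_continuous_at)
      from isCont_tendsto_compose[OF this s(2)[OF x]] show ?thesis
        using False by (simp add: case_prod_beta)
    qed simp
  qed
  moreover have "AE x in ?M. ?G x = F x (v x) (z x)"
    using AE_not_in[of N ?M] N by (auto simp: null_sets_def elim!: eventually_mono)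
  ultimately show ?thesis by (rule borel_measurable_lebesgue_on_AE[OF _ \<Omega>])
qed

lemma integrable_norm_powr_compact_support:
  fixes f :: "'a::euclidean_space \<Rightarrow> 'b::euclidean_space"
  assumes f: "continuous_on UNIV f" "\<And>x. R < norm x \<Longrightarrow> f x = 0" and r: "0 < r"
  shows "integrable lborel (\<lambda>x. norm (f x) powr r)"
proof (rule cutoff_kernel_integrable)
  have "continuous_on UNIV (\<lambda>x. norm (f x) powr r)"
    by (rule continuous_on_powr'[OF continuous_on_norm[OF f(1)] continuous_on_const]) (use r in simp)
  then show "cutoff_kernel R (\<lambda>x. norm (f x) powr r)"
    unfolding cutoff_kernel_def using f(2) by simp
qed

lemma C0_infinity_W1p:
  assumes \<Omega>: "open \<Omega>" and \<phi>: "\<phi> \<in> C0_infinity \<Omega>" and r: "0 < r"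
  shows "\<phi> \<in> W1p \<Omega> r"
proof -
  have S: "\<Omega> \<in> sets borel" using \<Omega> by simp
  note wg = has_weak_gradient_gradient[OF \<Omega> \<phi>]
  obtain R where R: "cutoff_kernel R \<phi>" using C0_infinity_cutoff_kernel[OF \<phi>] by metis
  have Ck: "\<forall>n. Ck n \<phi>" using C0_infinityD[OF \<phi>] by metis
  have cont: "continuous_on UNIV \<phi>" "continuous_on UNIV (gradient \<phi>)"
    using Ck_continuous[of 0] Ck Ck_continuous[OF Ck_partial_deriv[OF Ck]]
    unfolding gradient_def[abs_def] by (auto intro!: continuous_intros simp del: Ck.simps)
  have 0: "gradient \<phi> x = 0" if "R < norm x" for x
    using cutoff_kernel_partial_deriv[OF Ck R] that by (simp add: gradient_def cutoff_kernel_def)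
  have ae: "AE x in lebesgue_on \<Omega>. gradient \<phi> x = weak_gradient \<Omega> \<phi> x"
    using weak_gradient_AE_eq[OF \<Omega> wg] by (auto elim!: eventually_mono)
  have "\<phi> \<in> Lp_space \<Omega> r"
    unfolding Lp_space_def
    using borel_measurable_lebesgue_onI[OF borel_measurable_continuous_onI[OF cont(1)]]
      integrable_lborel_lebesgue_on(1)[OF integrable_norm_powr_compact_support[OF cont(1) _ r] S] R
    by (auto simp: cutoff_kernel_def)
  moreover have "weak_gradient \<Omega> \<phi> \<in> Lp_space \<Omega> r"
    unfolding Lp_space_def
  proof (intro CollectI conjI)
    show "weak_gradient \<Omega> \<phi> \<in> borel_measurable (lebesgue_on \<Omega>)"
      by (rule borel_measurable_lebesgue_on_AE[OF
            borel_measurable_lebesgue_onI[OF borel_measurable_continuous_onI[OF cont(2)]] S ae])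
    show "integrable (lebesgue_on \<Omega>) (\<lambda>x. norm (weak_gradient \<Omega> \<phi> x) powr r)"
    proof (rule integrable_lebesgue_on_AE[OF _ S])
      show "integrable (lebesgue_on \<Omega>) (\<lambda>x. norm (gradient \<phi> x) powr r)"
        using integrable_lborel_lebesgue_on(1)[OF integrable_norm_powr_compact_support[OF cont(2) 0 r] S] .
      show "AE x in lebesgue_on \<Omega>. norm (gradient \<phi> x) powr r = norm (weak_gradient \<Omega> \<phi> x) powr r"
        using ae by eventually_elim simp
    qed
  qed
  ultimately show ?thesis
    using wg by (auto simp: W1p_def weakly_differentiable_def)
qed

text \<open>A test function approximates itself; the work lies in the chosen gradient of the zero
  function, which is known to vanish only almost everywhere.\<close>

lemma C0_infinity_W1p_0:
  assumes \<Omega>: "open \<Omega>" and \<phi>: "\<phi> \<in> C0_infinity \<Omega>" and r: "0 < r"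
  shows "\<phi> \<in> W1p_0 \<Omega> r"
proof -
  have "(\<integral>x. norm (weak_gradient \<Omega> (\<lambda>x. 0) x) powr r \<partial>lebesgue_on \<Omega>) = 0"
    using weak_gradient_AE_eq[OF \<Omega> has_weak_gradient_0]
    by (intro integral_eq_zero_AE) (auto elim!: eventually_mono)
  then have "W1p_norm \<Omega> r (\<lambda>x. \<phi> x - \<phi> x) = 0"
    by (simp add: W1p_norm_def Lp_norm_def)
  then have "\<forall>e>0. \<exists>\<psi>\<in>C0_infinity \<Omega>. W1p_norm \<Omega> r (\<lambda>x. \<phi> x - \<psi> x) < e"
    using \<phi> by (intro allI impI bexI[of _ \<phi>]) auto
  then show ?thesis using C0_infinity_W1p[OF assms] by (simp add: W1p_0_def)
qed

lemma norm_diff_powr_le: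
  fixes x y :: "'b::real_normed_vector"
  assumes "0 \<le> r"
  shows "norm (x - y) powr r \<le> 2 powr r * (norm x powr r + norm y powr r)"
proof -
  have "norm (x - y) \<le> 2 * max (norm x) (norm y)"
    using norm_triangle_ineq4[of x y] by linarith
  then have "norm (x - y) powr r \<le> (2 * max (norm x) (norm y)) powr r"
    using assms by (intro powr_mono2) auto
  also have "\<dots> = 2 powr r * max (norm x) (norm y) powr r"
    by (simp add: powr_mult)
  also have "\<dots> \<le> 2 powr r * (norm x powr r + norm y powr r)"
    by (intro mult_left_mono) (auto simp: max_def)
  finally show ?thesis .
qed

text \<open>A doubling inequality: the modular of a difference is controlled by the two modulars,
  without rescaling the argument. This permits modular convergence with the constant 1.\<close>

lemma double_phase_diff_le:
  fixes y z :: "'b::real_normed_vector"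
  assumes "0 \<le> p" "0 \<le> q" "0 \<le> a x"
  shows "double_phase p q a x (y - z)
    \<le> (2 powr p + 2 powr q) * (double_phase p q a x y + double_phase p q a x z)"
proof -
  let ?A = "norm y powr p + norm z powr p" and ?B = "a x * (norm y powr q + norm z powr q)"
  have "a x * norm (y - z) powr q \<le> a x * (2 powr q * (norm y powr q + norm z powr q))"
    using assms by (intro mult_left_mono norm_diff_powr_le) auto
  then have "double_phase p q a x (y - z) \<le> 2 powr p * ?A + 2 powr q * ?B"
    unfolding double_phase_def using norm_diff_powr_le[OF assms(1), of y z] by (simp add: mult_ac)
  also have "\<dots> \<le> (2 powr p + 2 powr q) * (?A + ?B)"
    using assms(3) by (simp add: algebra_simps)
  finally show ?thesis by (simp add: double_phase_def algebra_simps)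
qed

subsection \<open>Approximation by mollification\<close>

text \<open>The common engine of all three convergences: the majorants
  \<open>c * (mollify (\<rho> n) Z x + Z0 x)\<close> converge in \<open>L^1\<close>, so pointwise
  convergence to 0 suffices.\<close>

lemma mollify_dominated_L1:
  fixes Z Z0 :: "'a::euclidean_space \<Rightarrow> real" and h :: "nat \<Rightarrow> 'a \<Rightarrow> real"
  assumes \<rho>: "\<And>n. mollifier (\<epsilon> n) (\<rho> n)" and \<epsilon>: "\<epsilon> \<longlonglongrightarrow> 0" and S: "S \<in> sets borel"
    and Z: "integrable lborel Z" and Z0: "integrable lborel Z0"
    and h: "\<And>n. h n \<in> borel_measurable (lebesgue_on S)"
    and bound: "\<And>n. AE x in lebesgue_on S. 0 \<le> h n x \<and> h n x \<le> c * (mollify (\<rho> n) Z x + Z0 x)"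
    and lim: "AE x in lebesgue_on S. (\<lambda>n. h n x) \<longlonglongrightarrow> 0"
  shows "integrable (lebesgue_on S) (h n)" and "(\<lambda>n. \<integral>x. h n x \<partial>lebesgue_on S) \<longlonglongrightarrow> 0"
proof -
  let ?g' = "\<lambda>n x. c * (mollify (\<rho> n) Z x + Z0 x)" and ?g = "\<lambda>x. c * (Z x + Z0 x)"
  note i = integrable_lborel_lebesgue_on[OF _ S]
  have 1: "integrable (lebesgue_on S) (?g' n)" for n
    by (intro i(1) integrable_mult_right Bochner_Integration.integrable_add integrable_mollify[OF \<rho>] Z Z0)
  have 2: "integrable (lebesgue_on S) ?g"
    by (intro i(1) integrable_mult_right Bochner_Integration.integrable_add Z Z0)
  have lim0: "(\<lambda>n. \<bar>c\<bar> * (\<integral>x. norm (mollify (\<rho> n) Z x - Z x) \<partial>lborel)) \<longlonglongrightarrow> 0"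
    by (rule tendsto_mult_right_zero[OF mollify_tendsto_L1[OF \<rho> \<epsilon> Z]])
  have le: "(\<integral>x. \<bar>?g' n x - ?g x\<bar> \<partial>lebesgue_on S) \<le> \<bar>c\<bar> * (\<integral>x. norm (mollify (\<rho> n) Z x - Z x) \<partial>lborel)" for n
  proof -
    have "(\<lambda>x. \<bar>?g' n x - ?g x\<bar>) = (\<lambda>x. \<bar>c\<bar> * \<bar>mollify (\<rho> n) Z x - Z x\<bar>)"
      by (simp add: abs_mult[symmetric] algebra_simps)
    moreover have "(\<integral>x. \<bar>mollify (\<rho> n) Z x - Z x\<bar> \<partial>lebesgue_on S) \<le> (\<integral>x. \<bar>mollify (\<rho> n) Z x - Z x\<bar> \<partial>lborel)"
      by (intro i(2) Bochner_Integration.integrable_diff integrable_mollify[OF \<rho>] Z)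
    ultimately show ?thesis by (simp add: mult_left_mono)
  qed
  have 3: "(\<lambda>n. \<integral>x. \<bar>?g' n x - ?g x\<bar> \<partial>lebesgue_on S) \<longlonglongrightarrow> 0"
    by (rule tendsto_sandwich[OF always_eventually always_eventually tendsto_const lim0])
       (use le in \<open>auto intro!: integral_nonneg_AE\<close>)
  show "integrable (lebesgue_on S) (h n)" "(\<lambda>n. \<integral>x. h n x \<partial>lebesgue_on S) \<longlonglongrightarrow> 0"
    using generalized_dominated_convergence[OF 1 2 3 h bound lim] by blast+
qed

text \<open>Fixes once and for all the representatives \<open>v\<close> and \<open>g\<close>, the
  subsequence, and one compact \<open>K'\<close> containing the supports of all mollified gradients,
  so that one sequence serves every convergence.\<close>

lemma smooth_approximation:
  fixes u :: "'a::euclidean_space \<Rightarrow> real"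
  assumes \<Omega>: "open \<Omega>" and u: "has_weak_gradient \<Omega> u G"
    and K: "compact K" "K \<subseteq> \<Omega>" "AE x in lebesgue_on \<Omega>. x \<notin> K \<longrightarrow> u x = 0"
  obtains C :: real and \<epsilon> \<rho> v g K' where
    "0 < C" "\<And>n. mollifier (\<epsilon> n) (\<rho> n)" "\<And>n. 0 < \<epsilon> n" "\<And>n. \<epsilon> n \<le> 1" "\<epsilon> \<longlonglongrightarrow> 0"
    "\<And>n x. \<rho> n x * \<epsilon> n ^ DIM('a) \<le> C"
    "integrable lborel v" "\<And>x. x \<notin> K \<Longrightarrow> v x = 0" "AE x in lebesgue_on \<Omega>. v x = u x"
    "integrable lborel g" "\<And>x. x \<notin> K \<Longrightarrow> g x = 0" "AE x in lebesgue_on \<Omega>. g x = G x"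
    "compact K'" "K' \<subseteq> \<Omega>" "\<And>n x. x \<notin> K' \<Longrightarrow> mollify (\<rho> n) g x = 0"
    "\<And>n. mollify (\<rho> n) v \<in> C0_infinity \<Omega>"
    "\<And>n x. gradient (mollify (\<rho> n) v) x = mollify (\<rho> n) g x"
    "AE x in lebesgue_on \<Omega>. (\<lambda>n. mollify (\<rho> n) v x) \<longlonglongrightarrow> v x"
    "AE x in lebesgue_on \<Omega>. (\<lambda>n. mollify (\<rho> n) g x) \<longlonglongrightarrow> g x"
proof -
  have [measurable]: "\<Omega> \<in> sets borel" "K \<in> sets borel" using \<Omega> K by (auto intro: borel_compact)
  have loc: "locally_integrable \<Omega> u" "locally_integrable \<Omega> G"
    using u by (auto simp: has_weak_gradient_def)
  obtain v where v: "v \<in> borel_measurable borel" "integrable lborel v" "\<And>x. x \<notin> K \<Longrightarrow> v x = 0"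
      "AE x in lborel. x \<in> K \<longrightarrow> v x = u x"
    using set_integrable_ex_borel[of K u] loc(1) K by (auto simp: locally_integrable_def)
  obtain g where g: "g \<in> borel_measurable borel" "integrable lborel g" "\<And>x. x \<notin> K \<Longrightarrow> g x = 0"
      "AE x in lborel. x \<in> K \<longrightarrow> g x = G x"
    using set_integrable_ex_borel[of K G] loc(2) K by (auto simp: locally_integrable_def)
  have vu: "AE x in lebesgue_on \<Omega>. v x = u x"
    using AE_lebesgue_onI[OF v(4), of \<Omega>] K(3) v(3) \<Omega> by (auto elim: eventually_elim2)
  have gG: "AE x in lebesgue_on \<Omega>. g x = G x"
    using AE_lebesgue_onI[OF g(4), of \<Omega>] weak_gradient_eq_0_outside[OF \<Omega> K(1) u K(3)] g(3) \<Omega>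
    by (auto elim: eventually_elim2)
  obtain d where d: "d > 0" "\<And>x. x \<in> K \<Longrightarrow> cball x d \<subseteq> \<Omega>" "compact (\<Union>x\<in>K. cball x d)"
    using compact_subset_open_cball[OF K(1) \<Omega> K(2)] by metis
  define K' where "K' = (\<Union>x\<in>K. cball x d)"
  \<comment> \<open>\<open>r \<le> 1\<close> is for the estimate with
    \<open>\<epsilon> powr \<alpha>\<close>; \<open>2 * r \<le> d\<close> provides the doubled
    margin needed to commute mollification with the weak gradient.\<close>
  define r where "r = min 1 (d / 2)"
  have r: "0 < r" "r \<le> 1" "2 * r \<le> d" using d(1) by (auto simp: r_def)
  obtain C and \<rho> :: "nat \<Rightarrow> 'a \<Rightarrow> real" where C: "C > 0" and \<rho>: "\<And>n. mollifier (r / Suc n) (\<rho> n)"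
      "\<And>n x. \<rho> n x * (r / Suc n) ^ DIM('a) \<le> C"
    using mollifier_sequence[OF r(1)] by metis
  have rn: "0 < r / Suc n" "r / Suc n \<le> r" for n using r(1) by (auto simp: field_simps)
  have near: "mollify (\<rho> n) f x = 0" if "x \<notin> K'" "\<And>x. x \<notin> K \<Longrightarrow> f x = 0"
    for n x and f :: "'a \<Rightarrow> 'c::euclidean_space"
  proof (rule mollify_eq_0[OF mollifierD(1)[OF \<rho>(1)]])
    fix y assume "dist x y \<le> r / Suc n"
    then have "dist y x \<le> d" using rn(2)[of n] r d(1) by (simp add: dist_commute)
    then have "y \<notin> K" using that(1) by (auto simp: K'_def)
    then show "f y = 0" by (rule that(2))
  qed
  have C0: "mollify (\<rho> n) v \<in> C0_infinity \<Omega>" for n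
  proof (rule C0_infinityI)
    show "Ck m (mollify (\<rho> n) v)" for m
      using mollifierD(1,2)[OF \<rho>(1)] v(2) by (intro Ck_mollify) auto
    show "compact K'" "K' \<subseteq> \<Omega>" using d by (auto simp: K'_def)
  qed (use near v(3) in blast)
  have grad: "gradient (mollify (\<rho> n) v) x = mollify (\<rho> n) g x" for n x
  proof (rule euclidean_eqI)
    fix b :: 'a assume b: "b \<in> Basis"
    have "gradient (mollify (\<rho> n) v) x \<bullet> b = mollify (\<rho> n) (\<lambda>y. g y \<bullet> b) x"
      unfolding gradient_inner[OF b]
    proof (rule partial_deriv_mollify_weak[OF \<Omega> u \<rho>(1) b v(2,3) vu g(2,3) gG])
      fix y assume "y \<in> K"
      have "cball y (2 * (r / Suc n)) \<subseteq> cball y d"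
        using rn(2)[of n] r(3) by (intro subset_cball) linarith
      then show "cball y (2 * (r / Suc n)) \<subseteq> \<Omega>" using d(2)[OF \<open>y \<in> K\<close>] by blast
    qed
    also have "\<dots> = mollify (\<rho> n) g x \<bullet> b"
      using integral_inner_left[of b lborel "\<lambda>y. \<rho> n (x - y) *\<^sub>R g y"]
        integrable_mollify_integrand[OF mollifierD(1)[OF \<rho>(1)] g(2), of n x]
      by (simp add: mollify_def)
    finally show "gradient (mollify (\<rho> n) v) x \<bullet> b = mollify (\<rho> n) g x \<bullet> b" .
  qed
  \<comment> \<open>Adding the two errors yields a single subsequence along which functions and
    gradients both converge almost everywhere.\<close>
  let ?D = "\<lambda>n x. norm (mollify (\<rho> n) v x - v x) + norm (mollify (\<rho> n) g x - g x)"
  have "integrable lborel (\<lambda>x. norm (mollify (\<rho> n) v x - v x))"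
    "integrable lborel (\<lambda>x. norm (mollify (\<rho> n) g x - g x))" for n
    using v(2) g(2) by (auto intro!: integrable_norm Bochner_Integration.integrable_diff integrable_mollify[OF \<rho>(1)])
  moreover note tendsto_add_zero[OF mollify_tendsto_L1[OF \<rho>(1) LIMSEQ_divide_Suc v(2)]
    mollify_tendsto_L1[OF \<rho>(1) LIMSEQ_divide_Suc g(2)]]
  ultimately have "\<And>n. integrable lborel (?D n)" "(\<lambda>n. \<integral>x. norm (?D n x) \<partial>lborel) \<longlonglongrightarrow> 0"
    by auto
  then obtain \<sigma> :: "nat \<Rightarrow> nat" where \<sigma>: "strict_mono \<sigma>" "AE x in lborel. (\<lambda>n. ?D (\<sigma> n) x) \<longlonglongrightarrow> 0"
    using tendsto_L1_AE_subseq[of lborel ?D] by blast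
  have D: "AE x in lebesgue_on \<Omega>. (\<lambda>n. ?D (\<sigma> n) x) \<longlonglongrightarrow> 0"
    using \<sigma>(2) \<Omega> by (intro AE_lebesgue_onI) auto
  have vlim: "AE x in lebesgue_on \<Omega>. (\<lambda>n. mollify (\<rho> (\<sigma> n)) v x) \<longlonglongrightarrow> v x"
    using D
  proof eventually_elim
    case (elim x)
    have "(\<lambda>n. mollify (\<rho> (\<sigma> n)) v x - v x) \<longlonglongrightarrow> 0"
      by (rule Lim_null_comparison[OF always_eventually elim]) simp
    then show ?case by (simp add: LIM_zero_iff)
  qed
  have glim: "AE x in lebesgue_on \<Omega>. (\<lambda>n. mollify (\<rho> (\<sigma> n)) g x) \<longlonglongrightarrow> g x"
    using D
  proof eventually_elim
    case (elim x)
    have "(\<lambda>n. mollify (\<rho> (\<sigma> n)) g x - g x) \<longlonglongrightarrow> 0"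
      by (rule Lim_null_comparison[OF always_eventually elim]) simp
    then show ?case by (simp add: LIM_zero_iff)
  qed
  have \<epsilon>0: "(\<lambda>n. r / Suc (\<sigma> n)) \<longlonglongrightarrow> 0"
    using LIMSEQ_subseq_LIMSEQ[OF LIMSEQ_divide_Suc \<sigma>(1), of r] by (simp add: o_def)
  show ?thesis
  proof (rule that[of C "\<lambda>n. r / Suc (\<sigma> n)" "\<lambda>n. \<rho> (\<sigma> n)" v g K'])
    show "r / Suc (\<sigma> n) \<le> 1" for n using rn(2)[of "\<sigma> n"] r(2) by linarith
    show "compact K'" "K' \<subseteq> \<Omega>" using d by (auto simp: K'_def)
    show "mollify (\<rho> (\<sigma> n)) g x = 0" if "x \<notin> K'" for n x
      by (rule near[OF that g(3)])
  qed (fact C \<rho> rn \<epsilon>0 v(2,3) vu g(2,3) gG C0 grad vlim glim)+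
qed

lemma hoelder_continuous_on_imp_continuous_on:
  fixes a :: "'a::metric_space \<Rightarrow> real"
  assumes "hoelder_continuous_on \<alpha> S a" "0 < \<alpha>"
  shows "continuous_on S a"
proof -
  obtain c where c: "0 \<le> c" "\<And>x y. x \<in> S \<Longrightarrow> y \<in> S \<Longrightarrow> \<bar>a x - a y\<bar> \<le> c * dist x y powr \<alpha>"
    using assms(1) by (auto simp: hoelder_continuous_on_def)
  have "(a \<longlongrightarrow> a x) (at x within S)" if x: "x \<in> S" for x
  proof (rule Lim_transform[of "\<lambda>_. a x"])
    have "((\<lambda>y. dist y x) \<longlongrightarrow> dist x x) (at x within S)"
      by (intro tendsto_intros)
    then have "((\<lambda>y. dist y x powr \<alpha>) \<longlongrightarrow> dist x x powr \<alpha>) (at x within S)"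
      using assms(2) by (intro tendsto_powr') auto
    then have lim: "((\<lambda>y. c * dist y x powr \<alpha>) \<longlongrightarrow> 0) (at x within S)"
      by (intro tendsto_mult_right_zero) simp
    have "\<forall>\<^sub>F y in at x within S. norm (a y - a x) \<le> c * dist y x powr \<alpha>"
      using c(2)[OF _ x] by (auto simp: eventually_at_filter)
    then show "((\<lambda>y. a y - a x) \<longlongrightarrow> 0) (at x within S)"
      by (rule Lim_null_comparison[OF _ lim])
  qed simp
  then show ?thesis by (simp add: continuous_on_def)
qed

lemma tendsto_norm_diff_powr_0:
  fixes f :: "nat \<Rightarrow> 'b::real_normed_vector"
  assumes "f \<longlonglongrightarrow> l" "0 < r"
  shows "(\<lambda>n. norm (f n - l) powr r) \<longlonglongrightarrow> 0"
proof -
  have "(\<lambda>n. norm (f n - l)) \<longlonglongrightarrow> 0"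
    using assms(1) by (simp add: LIM_zero tendsto_norm_zero)
  then have "(\<lambda>n. norm (f n - l) powr r) \<longlonglongrightarrow> 0 powr r"
    using assms(2) by (intro tendsto_powr') auto
  then show ?thesis using assms(2) by simp
qed

text \<open>By Jensen the majorant is built from \<open>Z = \<bar>f\<bar>^p\<close>. The error is an
  abstract \<open>h n\<close>, matched almost everywhere only, because the weak gradient of a
  difference is not literally the difference of gradients.\<close>

lemma mollify_Lp_tendsto:
  fixes f :: "'a::euclidean_space \<Rightarrow> 'b::euclidean_space"
  assumes \<rho>: "\<And>n. mollifier (\<epsilon> n) (\<rho> n)" and \<epsilon>: "\<epsilon> \<longlonglongrightarrow> 0" and S: "S \<in> sets borel" and p: "1 < p"
    and f: "integrable lborel f" "integrable lborel (\<lambda>x. norm (f x) powr p)"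
    and lim: "AE x in lebesgue_on S. (\<lambda>n. mollify (\<rho> n) f x) \<longlonglongrightarrow> f x"
    and h: "\<And>n. h n \<in> borel_measurable (lebesgue_on S)"
      "\<And>n. AE x in lebesgue_on S. h n x = mollify (\<rho> n) f x - f x"
  shows "(\<lambda>n. Lp_norm S p (h n)) \<longlonglongrightarrow> 0"
proof -
  have le: "norm (mollify (\<rho> n) f x) powr p \<le> mollify (\<rho> n) (\<lambda>x. norm (f x) powr p) x" for n x
  proof -
    have "norm (mollify (\<rho> n) f x) powr p \<le> 1 * mollify (\<rho> n) (\<lambda>x. norm (f x)) x powr p"
      using norm_mollify_le[OF \<rho>] p by (auto intro!: powr_mono2)
    also have "\<dots> \<le> mollify (\<rho> n) (\<lambda>x. norm (f x) powr p) x"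
      by (rule mollify_jensen[OF \<rho> p _ _ _ f(2)]) (use f in auto)
    finally show ?thesis .
  qed
  have all: "AE x in lebesgue_on S. \<forall>n. h n x = mollify (\<rho> n) f x - f x"
    using h(2) by (simp add: AE_all_countable)
  have "(\<lambda>n. \<integral>x. norm (h n x) powr p \<partial>lebesgue_on S) \<longlonglongrightarrow> 0"
  proof (rule mollify_dominated_L1(2)[OF \<rho> \<epsilon> S f(2) f(2), of _ "2 powr p"])
    show "(\<lambda>x. norm (h n x) powr p) \<in> borel_measurable (lebesgue_on S)" for n
      using h(1)[of n] by measurable
    show "AE x in lebesgue_on S. 0 \<le> norm (h n x) powr p \<and> norm (h n x) powr p
        \<le> 2 powr p * (mollify (\<rho> n) (\<lambda>x. norm (f x) powr p) x + norm (f x) powr p)" for n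
      using h(2)[of n]
    proof eventually_elim
      case (elim x)
      have "norm (h n x) powr p \<le> 2 powr p * (norm (mollify (\<rho> n) f x) powr p + norm (f x) powr p)"
        unfolding elim using p by (intro norm_diff_powr_le) simp
      also have "\<dots> \<le> 2 powr p * (mollify (\<rho> n) (\<lambda>x. norm (f x) powr p) x + norm (f x) powr p)"
        by (intro mult_left_mono add_right_mono le) simp
      finally show ?case by simp
    qed
    show "AE x in lebesgue_on S. (\<lambda>n. norm (h n x) powr p) \<longlonglongrightarrow> 0"
      using all lim
    proof eventually_elim
      case (elim x)
      show ?case using tendsto_norm_diff_powr_0[OF elim(2), of p] elim(1) p by simp
    qed
  qed
  then have "(\<lambda>n. (\<integral>x. norm (h n x) powr p \<partial>lebesgue_on S) powr (1 / p)) \<longlonglongrightarrow> 0 powr (1 / p)"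
    using p by (intro tendsto_powr') (auto intro!: always_eventually integral_nonneg_AE)
  then show ?thesis using p by (simp add: Lp_norm_def)
qed

theorem mainTheorem5:
  fixes \<Omega> :: "'a::euclidean_space set"
    and p q \<alpha> \<nu> L :: real
    and a :: "'a \<Rightarrow> real"
    and F :: "'a \<Rightarrow> real \<Rightarrow> 'a \<Rightarrow> real"
    and u :: "'a \<Rightarrow> real"
  assumes "open \<Omega>" and "connected \<Omega>" and "\<Omega> \<noteq> {}"
    and "segment_property \<Omega>"
    and "p > 1" and "q > 1"
    and "0 < \<alpha>" and "\<alpha> < 1"
    and "hoelder_continuous_on \<alpha> \<Omega> a"
    and "\<And>x. x \<in> \<Omega> \<Longrightarrow> 0 \<le> a x"
    and "q / p \<le> 1 + \<alpha> / real DIM('a)"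
    and "caratheodory \<Omega> F"
    and "0 < \<nu>" and "\<nu> \<le> L"
    and "\<And>x v z. x \<in> \<Omega> \<Longrightarrow>
           \<nu> * double_phase p q a x z \<le> F x v z \<and> F x v z \<le> L * double_phase p q a x z"
    and "u \<in> W1p_0 \<Omega> p \<inter> W1F \<Omega> F"
    and "compactly_supported_in \<Omega> u"
  shows "\<exists>uk :: nat \<Rightarrow> 'a \<Rightarrow> real.
           (\<forall>k. uk k \<in> C0_infinity \<Omega>) \<and>
           converges_W1p \<Omega> p uk u \<and>
           converges_modularly_W1H \<Omega> p q a uk u \<and>
           converges_Lp \<Omega> 1
             (\<lambda>k x. F x (uk k x) (weak_gradient \<Omega> (uk k) x))
             (\<lambda>x. F x (u x) (weak_gradient \<Omega> u x))"
proof -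
  note \<Omega> = assms(1) and p = assms(5) and q = assms(6) and \<alpha> = assms(7)
    and hoelder = assms(9) and a0 = assms(10) and gap = assms(11) and car = assms(12)
    and \<nu> = assms(13) and L = assms(14) and F = assms(15)
  let ?M = "lebesgue_on \<Omega>" and ?H = "double_phase p q a"
  have S: "\<Omega> \<in> sets borel" using \<Omega> by simp
  have uW: "u \<in> W1p \<Omega> p" "u \<in> W1p_0 \<Omega> 1"
    and Fint: "integrable ?M (\<lambda>x. F x (u x) (weak_gradient \<Omega> u x))"
    using assms(16) by (auto simp: W1p_0_def W1F_def)
  define G where "G = weak_gradient \<Omega> u"
  have u: "has_weak_gradient \<Omega> u G"
    using uW(1) has_weak_gradient_weak_gradient unfolding G_def W1p_def weakly_differentiable_def by blast
  have Lp: "u \<in> borel_measurable ?M" "integrable ?M (\<lambda>x. norm (u x) powr p)"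
    "G \<in> borel_measurable ?M" "integrable ?M (\<lambda>x. norm (G x) powr p)"
    using uW(1) by (auto simp: W1p_def Lp_space_def G_def)
  obtain K where K: "compact K" "K \<subseteq> \<Omega>" "AE x in ?M. x \<notin> K \<longrightarrow> u x = 0"
    using assms(17) by (auto simp: compactly_supported_in_def)
  obtain C :: real and \<epsilon> \<rho> v g K' where C: "0 < C"
    and \<rho>: "\<And>n. mollifier (\<epsilon> n) (\<rho> n)" and \<epsilon>: "\<And>n. 0 < \<epsilon> n" "\<And>n. \<epsilon> n \<le> 1" "\<epsilon> \<longlonglongrightarrow> 0"
    and \<rho>C: "\<And>n x. \<rho> n x * \<epsilon> n ^ DIM('a) \<le> C"
    and v: "integrable lborel v" "\<And>x. x \<notin> K \<Longrightarrow> v x = 0" "AE x in ?M. v x = u x"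
    and g: "integrable lborel g" "\<And>x. x \<notin> K \<Longrightarrow> g x = 0" "AE x in ?M. g x = G x"
    and K': "compact K'" "K' \<subseteq> \<Omega>" "\<And>n x. x \<notin> K' \<Longrightarrow> mollify (\<rho> n) g x = 0"
    and C0: "\<And>n. mollify (\<rho> n) v \<in> C0_infinity \<Omega>"
    and grad: "\<And>n x. gradient (mollify (\<rho> n) v) x = mollify (\<rho> n) g x"
    and vlim: "AE x in ?M. (\<lambda>n. mollify (\<rho> n) v x) \<longlonglongrightarrow> v x"
    and glim: "AE x in ?M. (\<lambda>n. mollify (\<rho> n) g x) \<longlonglongrightarrow> g x"
    by (rule smooth_approximation[OF \<Omega> u K]) blast
  define uk where "uk n = mollify (\<rho> n) v" for n
  define gk where "gk n = mollify (\<rho> n) g" for n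
  have [measurable]: "v \<in> borel_measurable borel" "g \<in> borel_measurable borel"
    using borel_measurable_integrable[OF v(1)] borel_measurable_integrable[OF g(1)] by simp_all
  have wk: "has_weak_gradient \<Omega> (uk n) (gk n)" for n
    using has_weak_gradient_gradient[OF \<Omega> C0, of n] by (simp add: uk_def gk_def grad[abs_def])
  have wk_eq: "AE x in ?M. weak_gradient \<Omega> (uk n) x = gk n x" for n
    by (rule weak_gradient_AE_eq[OF \<Omega> wk])
  have wd: "has_weak_gradient \<Omega> (\<lambda>x. uk n x - u x) (\<lambda>x. gk n x - G x)" for n
    by (rule has_weak_gradient_diff[OF \<Omega> wk u])
  have meas: "uk n \<in> borel_measurable ?M" "gk n \<in> borel_measurable ?M" for n
    unfolding uk_def gk_def
    by (intro borel_measurable_lebesgue_onI borel_measurable_continuous_onI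
        continuous_on_mollify[OF mollifierD(1)[OF \<rho>]] v(1) g(1))+
  have wmeas: "weak_gradient \<Omega> (uk n) \<in> borel_measurable ?M" for n
    by (rule borel_measurable_lebesgue_on_AE[OF meas(2) S, of n]) (use wk_eq[of n] in \<open>auto elim!: eventually_mono\<close>)
  have amea: "a \<in> borel_measurable ?M"
    using hoelder_continuous_on_imp_continuous_on[OF hoelder \<alpha>] S
    by (intro continuous_imp_measurable_on_sets_lebesgue) auto
  have Hmeas: "(\<lambda>x. ?H x (f x)) \<in> borel_measurable ?M" if "f \<in> borel_measurable ?M"
    for f :: "'a \<Rightarrow> 'a"
    unfolding double_phase_def using that amea by measurable
  have H0: "0 \<le> ?H x z" if "x \<in> \<Omega>" for x and z :: 'a
    using a0[OF that] by (simp add: double_phase_def)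

  have vp: "integrable lborel (\<lambda>x. norm (v x) powr p)"
  proof -
    have "integrable ?M (\<lambda>x. norm (v x) powr p)"
      by (rule integrable_lebesgue_on_AE[OF Lp(2) S]) (use v(3) in \<open>auto elim!: eventually_mono\<close>)
    then show ?thesis using S K(2) v(2) by (subst (asm) integrable_lebesgue_on_lborel) auto
  qed
  have gp: "integrable lborel (\<lambda>x. norm (g x) powr p)"
  proof -
    have "integrable ?M (\<lambda>x. norm (g x) powr p)"
      by (rule integrable_lebesgue_on_AE[OF Lp(4) S]) (use g(3) in \<open>auto elim!: eventually_mono\<close>)
    then show ?thesis using S K(2) g(2) by (subst (asm) integrable_lebesgue_on_lborel) auto
  qed
  \<comment> \<open>The lower bound on \<open>F\<close> turns finite energy of \<open>u\<close> into
    integrability of the double phase.\<close>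
  have HG: "integrable ?M (\<lambda>x. ?H x (G x))"
  proof (rule Bochner_Integration.integrable_bound)
    show "integrable ?M (\<lambda>x. (1 / \<nu>) * F x (u x) (G x))"
      using Fint unfolding G_def by (rule integrable_mult_right)
    show "AE x in ?M. norm (?H x (G x)) \<le> norm ((1 / \<nu>) * F x (u x) (G x))"
    proof (rule AE_I2)
      fix x assume "x \<in> space ?M"
      then have x: "x \<in> \<Omega>" by simp
      have "?H x (G x) \<le> (1 / \<nu>) * F x (u x) (G x)"
        using F[OF x, of "G x" "u x"] \<nu> by (simp add: field_simps)
      then show "norm (?H x (G x)) \<le> norm ((1 / \<nu>) * F x (u x) (G x))"
        using H0[OF x, of "G x"] unfolding real_norm_def by linarith
    qed
  qed (rule Hmeas[OF Lp(3)])
  \<comment> \<open>The indicator discards the arbitrary values of \<open>a\<close> off \<Omega> and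
    makes \<open>W\<close> Borel and nonnegative everywhere.\<close>
  define W where "W x = indicator \<Omega> x * a x * norm (g x) powr q" for x
  have W0: "0 \<le> W x" for x using a0 by (auto simp: W_def indicator_def)
  have W\<Omega>: "W x = a x * norm (g x) powr q" if "x \<in> \<Omega>" for x using that by (simp add: W_def)
  have Wint: "integrable lborel W"
  proof -
    have "(\<lambda>x. indicator \<Omega> x *\<^sub>R a x) \<in> borel_measurable borel"
      using hoelder_continuous_on_imp_continuous_on[OF hoelder \<alpha>] S
      by (intro borel_measurable_continuous_on_indicator) auto
    then have Wb: "W \<in> borel_measurable borel" unfolding W_def by simp
    have "integrable ?M W"
    proof (rule Bochner_Integration.integrable_bound[OF HG])
      show "AE x in ?M. norm (W x) \<le> norm (?H x (G x))"
        using g(3) AE_space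
      proof eventually_elim
        case (elim x)
        then have "x \<in> \<Omega>" by simp
        then show ?case using a0[of x] elim(1) by (simp add: W_def double_phase_def)
      qed
    qed (rule borel_measurable_lebesgue_onI[OF Wb])
    then show ?thesis using S Wb by (subst (asm) integrable_lebesgue_on_lborel) (auto simp: W_def)
  qed

  obtain c where c: "0 \<le> c" "\<And>x y. x \<in> \<Omega> \<Longrightarrow> y \<in> \<Omega> \<Longrightarrow> \<bar>a x - a y\<bar> \<le> c * dist x y powr \<alpha>"
    using hoelder by (auto simp: hoelder_continuous_on_def)
  \<comment> \<open>The constant of \<open>weight_mollify_bound\<close>; it depends on the total
    \<open>p\<close>-energy of \<open>g\<close> but not on \<open>n\<close>.\<close>
  define B where "B = c * (1 + (C * (\<integral>y. norm (g y) powr p \<partial>lborel)) powr (q / p - 1))"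
  have B0: "0 \<le> B" using c(1) by (simp add: B_def)
  \<comment> \<open>The coefficient \<open>1 + B\<close> collects the \<open>p\<close>-phase itself
    and the price of the weight comparison, so one integrable function controls both phases.\<close>
  define Z where "Z x = (1 + B) * norm (g x) powr p + W x" for x
  \<comment> \<open>The constant term \<open>B\<close> from the weight comparison is needed only on
    \<open>K'\<close>, where the mollified gradients live, so it stays integrable even if \<Omega>
    has infinite measure. The summand \<open>Z x\<close> covers the limit gradient.\<close>
  define Z0 where "Z0 x = B * indicator K' x + Z x" for x
  have Z_nonneg: "0 \<le> Z x" for x using B0 W0[of x] by (simp add: Z_def)
  have Zint: "integrable lborel Z"
    unfolding Z_def using gp Wint by (intro Bochner_Integration.integrable_add integrable_mult_right)
  have Z0int: "integrable lborel Z0"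
    unfolding Z0_def using Zint K'(1)
    by (intro Bochner_Integration.integrable_add integrable_mult_right integrable_real_indicator
        emeasure_bounded_finite compact_imp_bounded) (auto intro: borel_compact)
  have Hg: "?H x (g x) \<le> Z x" if "x \<in> \<Omega>" for x
    using B0 W\<Omega>[OF that] by (simp add: Z_def double_phase_def algebra_simps)
  have Hk: "?H x (gk n x) \<le> mollify (\<rho> n) Z x + B * indicator K' x" if x: "x \<in> \<Omega>" for n x
  proof (cases "x \<in> K'")
    case True
    let ?S = "mollify (\<rho> n) (\<lambda>y. norm (g y) powr p) x"
    have "norm (gk n x) powr p \<le> 1 * mollify (\<rho> n) (\<lambda>y. norm (g y)) x powr p"
      unfolding gk_def using norm_mollify_le[OF \<rho>] p by (auto intro!: powr_mono2)
    also have "\<dots> \<le> ?S"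
      by (rule mollify_jensen[OF \<rho> p _ _ _ gp]) (use g(1) in auto)
    finally have 1: "norm (gk n x) powr p \<le> ?S" .
    have 2: "a x * norm (gk n x) powr q \<le> mollify (\<rho> n) W x + B * (1 + ?S)"
      unfolding gk_def B_def
      by (rule weight_mollify_bound[OF p q gap \<alpha> \<epsilon>(1,2) \<rho> \<rho>C _ c(2) a0 c(1) g(1) gp _ Wint W\<Omega> W0 x])
         (use C g(2) K(2) in auto)
    have "mollify (\<rho> n) Z x = (1 + B) * ?S + mollify (\<rho> n) W x"
    proof -
      have "mollify (\<rho> n) Z x = mollify (\<rho> n) (\<lambda>y. (1 + B) * norm (g y) powr p) x + mollify (\<rho> n) W x"
        unfolding Z_def using gp Wint by (intro mollify_add[OF mollifierD(1)[OF \<rho>]] integrable_mult_right)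
      moreover have "mollify (\<rho> n) (\<lambda>y. (1 + B) * norm (g y) powr p) x = (1 + B) * ?S"
        unfolding mollify_def real_scaleR_def
        by (subst integral_mult_right_zero[symmetric]) (simp add: mult_ac)
      ultimately show ?thesis by simp
    qed
    then show ?thesis using 1 2 True by (simp add: double_phase_def algebra_simps)
  next
    case False
    then have "gk n x = 0" using K'(3) by (simp add: gk_def)
    then show ?thesis
      using False mollify_nonneg[OF \<rho>[of n] Z_nonneg] p q by (simp add: double_phase_def)
  qed
  have sum_bound: "?H x (gk n x) + ?H x (g x) \<le> mollify (\<rho> n) Z x + Z0 x" if "x \<in> \<Omega>" for n x
    using Hk[OF that, of n] Hg[OF that] by (simp add: Z0_def)
  \<comment> \<open>All exceptional sets, including those for each \<open>n\<close>, are merged, so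
    that the later estimates are pointwise.\<close>
  have eqs: "AE x in ?M. x \<in> \<Omega> \<and> v x = u x \<and> g x = G x \<and> (\<forall>n. weak_gradient \<Omega> (uk n) x = gk n x)
      \<and> (\<lambda>n. uk n x) \<longlonglongrightarrow> u x \<and> (\<lambda>n. gk n x) \<longlonglongrightarrow> G x"
  proof -
    have "AE x in ?M. \<forall>n. weak_gradient \<Omega> (uk n) x = gk n x"
      using wk_eq by (simp add: AE_all_countable)
    then show ?thesis
      using v(3) g(3) vlim glim AE_space
      by eventually_elim (auto simp: uk_def gk_def)
  qed

  have W1p_conv: "converges_W1p \<Omega> p uk u"
  proof -
    \<comment> \<open>The gradient of the difference is a separate arbitrary choice; measurability
      is inherited from the explicit gradient \<open>gk n x - G x\<close>.\<close>
    have dmeas: "weak_gradient \<Omega> (\<lambda>x. uk n x - u x) \<in> borel_measurable ?M" for n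
    proof (rule borel_measurable_lebesgue_on_AE[OF _ S])
      show "(\<lambda>x. gk n x - G x) \<in> borel_measurable ?M" using meas(2) Lp(3) by measurable
      show "AE x in ?M. gk n x - G x = weak_gradient \<Omega> (\<lambda>x. uk n x - u x) x"
        using weak_gradient_AE_eq[OF \<Omega> wd, of n] by eventually_elim simp
    qed
    have "(\<lambda>n. Lp_norm \<Omega> p (\<lambda>x. uk n x - u x)) \<longlonglongrightarrow> 0"
    proof (rule mollify_Lp_tendsto[OF \<rho> \<epsilon>(3) S p v(1) vp vlim])
      show "(\<lambda>x. uk n x - u x) \<in> borel_measurable ?M" for n using meas(1) Lp(1) by measurable
      show "AE x in ?M. uk n x - u x = mollify (\<rho> n) v x - v x" for n
        using v(3) by eventually_elim (simp add: uk_def)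
    qed
    moreover have "(\<lambda>n. Lp_norm \<Omega> p (weak_gradient \<Omega> (\<lambda>x. uk n x - u x))) \<longlonglongrightarrow> 0"
    proof (rule mollify_Lp_tendsto[OF \<rho> \<epsilon>(3) S p g(1) gp glim dmeas])
      show "AE x in ?M. weak_gradient \<Omega> (\<lambda>x. uk n x - u x) x = mollify (\<rho> n) g x - g x" for n
        using weak_gradient_AE_eq[OF \<Omega> wd, of n] g(3) by eventually_elim (simp add: gk_def)
    qed
    ultimately have "(\<lambda>n. W1p_norm \<Omega> p (\<lambda>x. uk n x - u x)) \<longlonglongrightarrow> 0"
      unfolding W1p_norm_def by (rule tendsto_add_zero)
    then show ?thesis
      using C0_infinity_W1p[OF \<Omega> C0, of p] p uW(1) by (simp add: converges_W1p_def uk_def)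
  qed

  have modular: "converges_modularly_W1H \<Omega> p q a uk u"
  proof -
    let ?h = "\<lambda>n x. ?H x (weak_gradient \<Omega> (uk n) x - G x)"
    have hmeas: "?h n \<in> borel_measurable ?M" for n
      using wmeas[of n] Lp(3) by (intro Hmeas) measurable
    note dom = mollify_dominated_L1[OF \<rho> \<epsilon>(3) S Zint Z0int hmeas, where c = "2 powr p + 2 powr q"]
    have bound: "AE x in ?M. 0 \<le> ?h n x \<and> ?h n x \<le> (2 powr p + 2 powr q) * (mollify (\<rho> n) Z x + Z0 x)" for n
      using eqs
    proof eventually_elim
      case (elim x)
      have "?h n x \<le> (2 powr p + 2 powr q) * (?H x (gk n x) + ?H x (g x))"
        using double_phase_diff_le[of p q a x "gk n x" "g x"] elim p q a0 by simp
      also have "\<dots> \<le> (2 powr p + 2 powr q) * (mollify (\<rho> n) Z x + Z0 x)"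
        using sum_bound[of x n] elim by (intro mult_left_mono) auto
      finally show ?case using H0[of x] elim by simp
    qed
    have lim: "AE x in ?M. (\<lambda>n. ?h n x) \<longlonglongrightarrow> 0"
      using eqs
    proof eventually_elim
      case (elim x)
      have "(\<lambda>n. norm (gk n x - G x) powr p + a x * norm (gk n x - G x) powr q) \<longlonglongrightarrow> 0"
        using p q elim by (intro tendsto_add_zero tendsto_mult_right_zero tendsto_norm_diff_powr_0) auto
      then show ?case using elim by (simp add: double_phase_def)
    qed
    have int: "integrable ?M (?h n)" for n using dom(1)[OF bound lim] .
    have "(\<lambda>n. \<integral>x. ?h n x \<partial>?M) \<longlonglongrightarrow> 0" using dom(2)[OF bound lim] .
    then have "(\<lambda>n. ennreal (\<integral>x. ?h n x \<partial>?M)) \<longlonglongrightarrow> ennreal 0" by (rule tendsto_ennrealI)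
    moreover have "(\<integral>\<^sup>+ x. ennreal (?H x (norm (weak_gradient \<Omega> (uk n) x - weak_gradient \<Omega> u x) / 1)) \<partial>?M)
        = ennreal (\<integral>x. ?h n x \<partial>?M)" for n
    proof -
      have "AE x in ?M. 0 \<le> ?h n x" using bound[of n] by eventually_elim simp
      from nn_integral_eq_integral[OF int this] show ?thesis by (simp add: G_def double_phase_def)
    qed
    ultimately have "(\<lambda>n. \<integral>\<^sup>+ x. ennreal (?H x (norm (weak_gradient \<Omega> (uk n) x - weak_gradient \<Omega> u x) / 1)) \<partial>?M) \<longlonglongrightarrow> 0"
      by simp
    then have conv: "\<exists>c>0. (\<lambda>n. \<integral>\<^sup>+ x. ennreal (?H x (norm (weak_gradient \<Omega> (uk n) x - weak_gradient \<Omega> u x) / c)) \<partial>?M) \<longlonglongrightarrow> 0"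
      by (intro exI[of _ 1]) simp
    have "integrable ?M (\<lambda>x. ?H x (weak_gradient \<Omega> (uk n) x))" for n
    proof (rule Bochner_Integration.integrable_bound)
      show "integrable ?M (\<lambda>x. mollify (\<rho> n) Z x + Z0 x)"
        by (intro integrable_lborel_lebesgue_on(1)[OF _ S] Bochner_Integration.integrable_add
            integrable_mollify[OF \<rho>] Zint Z0int)
      show "AE x in ?M. norm (?H x (weak_gradient \<Omega> (uk n) x)) \<le> norm (mollify (\<rho> n) Z x + Z0 x)"
        using eqs
      proof eventually_elim
        case (elim x)
        then show ?case
          using sum_bound[of x n] H0[of x "gk n x"] H0[of x "g x"] by simp
      qed
    qed (rule Hmeas[OF wmeas])
    then have "uk n \<in> W1H \<Omega> ?H" for n
      using C0_infinity_W1p_0[OF \<Omega> C0, of 1 n] by (simp add: W1H_def uk_def)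
    moreover have "u \<in> W1H \<Omega> ?H" using uW(2) HG by (simp add: W1H_def G_def)
    ultimately show ?thesis using conv by (simp add: converges_modularly_W1H_def)
  qed

  have F_conv: "converges_Lp \<Omega> 1 (\<lambda>k x. F x (uk k x) (weak_gradient \<Omega> (uk k) x))
      (\<lambda>x. F x (u x) (weak_gradient \<Omega> u x))"
  proof -
    let ?F = "\<lambda>k x. F x (uk k x) (weak_gradient \<Omega> (uk k) x)" and ?Fu = "\<lambda>x. F x (u x) (G x)"
    have Fm: "?F n \<in> borel_measurable ?M" for n
      by (rule caratheodory_measurable[OF car S meas(1) wmeas])
    have F0m: "?Fu \<in> borel_measurable ?M"
      by (rule caratheodory_measurable[OF car S Lp(1,3)])
    have dm: "(\<lambda>x. \<bar>?F n x - ?Fu x\<bar>) \<in> borel_measurable ?M" for n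
      using Fm F0m by measurable
    note dom = mollify_dominated_L1[OF \<rho> \<epsilon>(3) S Zint Z0int dm, where c = L]
    have bound: "AE x in ?M. 0 \<le> \<bar>?F n x - ?Fu x\<bar> \<and> \<bar>?F n x - ?Fu x\<bar> \<le> L * (mollify (\<rho> n) Z x + Z0 x)" for n
      using eqs
    proof eventually_elim
      case (elim x)
      then have x: "x \<in> \<Omega>" by simp
      have nonneg: "0 \<le> F x s z" for s z
        using F[OF x, of z s] mult_nonneg_nonneg[OF less_imp_le[OF \<nu>] H0[OF x, of z]] by linarith
      have "\<bar>?F n x - ?Fu x\<bar> \<le> ?F n x + ?Fu x"
        using nonneg[of "uk n x" "weak_gradient \<Omega> (uk n) x"] nonneg[of "u x" "G x"] by linarith
      also have "\<dots> \<le> L * ?H x (gk n x) + L * ?H x (g x)"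
        using F[OF x, of "gk n x" "uk n x"] F[OF x, of "G x" "u x"] elim by (intro add_mono) auto
      also have "\<dots> = L * (?H x (gk n x) + ?H x (g x))" by (simp add: distrib_left)
      also have "\<dots> \<le> L * (mollify (\<rho> n) Z x + Z0 x)"
        using sum_bound[OF x] \<nu> L by (intro mult_left_mono) auto
      finally show ?case by simp
    qed
    have lim: "AE x in ?M. (\<lambda>n. \<bar>?F n x - ?Fu x\<bar>) \<longlonglongrightarrow> 0"
    proof -
      have "AE x in ?M. continuous_on UNIV (\<lambda>(v, z). F x v z)" using car by (simp add: caratheodory_def)
      then show ?thesis
        using eqs
      proof eventually_elim
        case (elim x)
        have "isCont (\<lambda>(v, z). F x v z) (u x, G x)"
          using elim(1) by (simp add: continuous_on_eq_continuous_at)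
        moreover have "(\<lambda>n. (uk n x, gk n x)) \<longlonglongrightarrow> (u x, G x)"
          using elim(2) by (intro tendsto_Pair) auto
        ultimately have "(\<lambda>n. case (uk n x, gk n x) of (v, z) \<Rightarrow> F x v z) \<longlonglongrightarrow> (case (u x, G x) of (v, z) \<Rightarrow> F x v z)"
          by (rule isCont_tendsto_compose)
        then show ?case using elim(2) by (simp add: LIM_zero tendsto_rabs_zero)
      qed
    qed
    have dint: "integrable ?M (\<lambda>x. \<bar>?F n x - ?Fu x\<bar>)" for n using dom(1)[OF bound lim] .
    have dlim: "(\<lambda>n. \<integral>x. \<bar>?F n x - ?Fu x\<bar> \<partial>?M) \<longlonglongrightarrow> 0" using dom(2)[OF bound lim] .
    have F0int: "integrable ?M ?Fu" using Fint by (simp add: G_def)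
    \<comment> \<open>Obtained from the integrable difference by adding back the integrable
      limit.\<close>
    have Fnint: "integrable ?M (?F n)" for n
    proof -
      have "integrable ?M (\<lambda>x. ?F n x - ?Fu x)"
      proof (rule Bochner_Integration.integrable_bound[OF dint[of n]])
        show "(\<lambda>x. ?F n x - ?Fu x) \<in> borel_measurable ?M" using Fm F0m by measurable
      qed simp
      from Bochner_Integration.integrable_add[OF this F0int] show ?thesis by simp
    qed
    have "(\<lambda>n. Lp_norm \<Omega> 1 (\<lambda>x. ?F n x - ?Fu x)) \<longlonglongrightarrow> 0"
    proof -
      have "Lp_norm \<Omega> 1 (\<lambda>x. ?F n x - ?Fu x) = (\<integral>x. \<bar>?F n x - ?Fu x\<bar> \<partial>?M)" for n
        by (simp add: Lp_norm_def)
      then show ?thesis using dlim by simp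
    qed
    moreover have "?F n \<in> Lp_space \<Omega> 1" "?Fu \<in> Lp_space \<Omega> 1" for n
      using Fm F0m integrable_norm[OF Fnint] integrable_norm[OF F0int] by (simp_all add: Lp_space_def)
    ultimately show ?thesis by (simp add: converges_Lp_def G_def)
  qed
  show ?thesis
    using C0 W1p_conv modular F_conv by (intro exI[of _ uk]) (auto simp: uk_def[abs_def])
qed

end
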